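(* Let the game $\Gamma(N,\{\boldsymbol A^i\},\{J^i\})$ satisfy Assumptions 1, 2 and 3 of the context, and let $\varepsilon>0$ denote a small constant. Optimality below refers to the choice of the exponents $(g,s,r,e)$, $0<g,s,r,e<1$, of the algorithm, as defined in the context. (1) If player $i$ implements the payoff-based algorithm of the context with an arbitrary $\boldsymbol\mu^i(0)$, then, regardless of the other players' choice of algorithm, her optimal regret rate (bound on $\mathbb E\,R^i(T,\boldsymbol a^i)/T$), over exponents with $r<s$ and $g-2s>0$, is $O\left(T^{-1/3}\right)$ with respect to a reference point $\boldsymbol a^i\in\mathrm{int}(\boldsymbol A^i)$ and $O\left(T^{-(1/4-\varepsilon)}\right)$ with respect to a reference point $\boldsymbol a^i\in\partial\boldsymbol A^i$. (2) If all players implement the algorithm, and the exponents are such that the parameters satisfy Assumption 4 of the context (which guarantees convergence to a Nash equilibrium), then the optimal regret rate is $O\left(T^{-(1/4-\varepsilon)}\right)$ with respect to $\boldsymbol a^i\in\mathrm{int}(\boldsymbol A^i)$ (in the interior case, where Assumption 4 is taken with condition 2* )), and $O\left(T^{-(1/6-\varepsilon)}\right)$ with respect to $\boldsymbol a^i\in\partial\boldsymbol A^i$ (where Assumption 4 is taken with condition 2)).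
   Context: Game. There are $N$ players; player $i$ has action set $\boldsymbol A^i\subseteq\mathbb R^d$ and cost function $J^i$; $\boldsymbol A=\boldsymbol A^1\times\dots\times\boldsymbol A^N\subseteq\mathbb R^{Nd}$. The pseudo-gradient is $\boldsymbol M(\boldsymbol a)=(\nabla_{\boldsymbol a^i}J^i(\boldsymbol a^i,\boldsymbol a^{-i}))_{i=1}^N$. The solutions of $VI(\boldsymbol M,\boldsymbol A)$ are the $\boldsymbol a^*\in\boldsymbol A$ with $\langle \boldsymbol M(\boldsymbol a^* ),\boldsymbol a-\boldsymbol a^*\rangle\ge 0$ for all $\boldsymbol a\in\boldsymbol A$; under Assumption 1 these are the Nash equilibria. Assumption 1. For every $i$, $\boldsymbol A^i$ is convex and compact with nonempty interior; $J^i$ is defined on $\mathbb R^{Nd}$, continuously differentiable in $\boldsymbol a$, and convex in $\boldsymbol a^i$ for each fixed $\boldsymbol a^{-i}$ on $\mathbb R^{Nd}$. Assumption 2. $\boldsymbol M$ is merely monotone on $\boldsymbol A$: $\langle \boldsymbol M(\boldsymbol y)-\boldsymbol M(\tilde{\boldsymbol y}),\boldsymbol y-\tilde{\boldsymbol y}\rangle\ge0$ for all $\boldsymbol y,\tilde{\boldsymbol y}\in\boldsymbol A$, but $\boldsymbol M$ is not strictly monotone. Assumption 3. (1) $\boldsymbol M$ is continuously differentiable over $\mathbb R^{Nd}$. (2) For each $i$, $J^i(\boldsymbol x)=O(\exp\{\|\boldsymbol x\|^{\alpha}\})$ as $\|\boldsymbol x\|\to\infty$, for some $\alpha<2$. Assumption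 4. $\lim\gamma_t=\lim\epsilon_t=\lim\sigma_t=\lim\rho_t=0$, and 1) $\lim\rho_t/\epsilon_t=0$; 2) $\sum_{t\ge1}\left(\frac{|\epsilon_t-\epsilon_{t-1}|^2}{\epsilon_t^3\gamma_t}+\frac{|\rho_t-\rho_{t-1}|^2}{\epsilon_t^{5+2\varepsilon'}\gamma_t}\right)<\infty$ for some $\varepsilon'>0$; 3) $\lim\rho_t/\sigma_t=\infty$; 4) $\sum_t\gamma_t\epsilon_t=\infty$; 5) $\sum_t\gamma_t^2/\sigma_t^2<\infty$; 6) $\sum_t\gamma_t\sigma_t<\infty$. If the least-norm solutions of $VI(\boldsymbol M,\boldsymbol A)$ are contained in $\mathrm{int}(\boldsymbol A)$ (the interior case), condition 2) is relaxed to 2* ) $\sum_{t\ge1}\frac{|\epsilon_t-\epsilon_{t-1}|^2}{\epsilon_t^3\gamma_t}<\infty$. Notation. $\mathrm{Proj}_Y$ is Euclidean projection onto a convex closed set $Y$; for $0\le\rho<1$, $(1-\rho)Y:=\{\boldsymbol x\in Y:\mathrm{dist}(\boldsymbol x,\partial Y)\ge\rho\}$. Algorithm of player $i$. Parameters $\gamma_t,\sigma_t,\rho_t,\epsilon_t$ are positive constant multiples of $t^{-g},t^{-s},t^{-r},t^{-e}$ respectively for $t\ge1$, with $(1-\rho_t)\boldsymbol A^i$ having nonempty interior for all $t$; $\boldsymbol\mu^i(0)\in\mathbb R^d$ arbitrary. At each $t=0,1,2,\dots$: given the past, sample $\boldsymbol\xi^i(t)$ from the normal distribution with mean $\boldsymbol\mu^i(t)$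 and covariance $\sigma_t^2\mathbf I_d$ (independently of the other players' current choices); play $\boldsymbol a^i(t)=\mathrm{Proj}_{\boldsymbol A^i}[\boldsymbol\xi^i(t)]$; receive $J^i(t)=J^i(\boldsymbol a^i(t),\boldsymbol a^{-i}(t))$; set $\boldsymbol m^i(t)=J^i(t)\frac{\boldsymbol\xi^i(t)-\boldsymbol\mu^i(t)}{\sigma_t^2}$ and $\boldsymbol\mu^i(t+1)=\mathrm{Proj}_{(1-\rho_t)\boldsymbol A^i}[\boldsymbol\mu^i(t)-\gamma_t(\boldsymbol m^i(t)+\epsilon_t\boldsymbol\mu^i(t))]$. Regret. $R^i(T,\boldsymbol a^i)=\sum_{t=1}^TJ^i(\boldsymbol a^i(t),\boldsymbol a^{-i}(t))-\sum_{t=1}^TJ^i(\boldsymbol a^i,\boldsymbol a^{-i}(t))$. Optimal regret rate. The algorithm's expected average regret satisfies, for $r<s$ and $g-2s>0$, the bound $\mathbb E\,R^i(T,\boldsymbol a^i)/T\le O\big(T^{-(1-g)}+T^{-(g-2s)}+T^{-2s}+T^{-r}\boldsymbol 1_{\boldsymbol a^i\in\partial\boldsymbol A^i}+T^{-e}\big)$. The guaranteed exponent is therefore $\beta=\min\{1-g,\,g-2s,\,2s,\,e\}$ for an interior reference point and $\beta=\min\{1-g,\,g-2s,\,2s,\,r,\,e\}$ for a boundary reference point. "The optimal regret rate is $O(T^{-b})$" means that the maximum of $\beta$ over the admissible exponents $(g,s,r,e)$ equals $b$ (and is attained); "the optimal regret rate is $O(T^{-(b-\varepsilon)})$" means that the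 supremum of $\beta$ over the admissible exponents equals $b$, so that for every small $\varepsilon>0$ some admissible exponents guarantee the rate $O(T^{-(b-\varepsilon)})$. *)

theory Defs
  imports "HOL-Probability.Probability" "HOL-Library.Landau_Symbols"
begin

(* Players are the elements of the finite type 'n and an action is a vector in real^'d, so a joint
   action is an element of real^'d^'n, whose inner product and norm are those of R^(N d). *)

type_synonym ('d, 'n) profile = "real^'d^'n"
type_synonym ('d, 'n) action_sets = "'n \<Rightarrow> (real^'d) set"
type_synonym ('d, 'n) costs = "'n \<Rightarrow> real^'d^'n \<Rightarrow> real"

definition deviate :: "('d::finite, 'n::finite) profile \<Rightarrow> 'n \<Rightarrow> real^'d \<Rightarrow> ('d, 'n) profile" where
  "deviate a i x = (\<chi> j. if j = i then x else a $ j)"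

definition joint_actions :: "('d::finite, 'n::finite) action_sets \<Rightarrow> ('d, 'n) profile set" where
  "joint_actions A = {a. \<forall>i. a $ i \<in> A i}"

definition pseudo_gradient :: "('d::finite, 'n::finite) costs \<Rightarrow> ('d, 'n) profile \<Rightarrow> ('d, 'n) profile" where
  "pseudo_gradient J a = (\<chi> i. THE D. GDERIV (\<lambda>x. J i (deviate a i x)) (a $ i) :> D)"

definition VI_solutions :: "('a::real_inner \<Rightarrow> 'a) \<Rightarrow> 'a set \<Rightarrow> 'a set" where
  "VI_solutions M Y = {a \<in> Y. \<forall>b\<in>Y. M a \<bullet> (b - a) \<ge> 0}"

definition least_norm_VI_solutions :: "('a::real_inner \<Rightarrow> 'a) \<Rightarrow> 'a set \<Rightarrow> 'a set" where
  "least_norm_VI_solutions M Y =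
     {a \<in> VI_solutions M Y. \<forall>b\<in>VI_solutions M Y. norm a \<le> norm b}"

definition interior_case :: "('d::finite, 'n::finite) action_sets \<Rightarrow> ('d, 'n) costs \<Rightarrow> bool" where
  "interior_case A J \<longleftrightarrow>
     least_norm_VI_solutions (pseudo_gradient J) (joint_actions A) \<subseteq> interior (joint_actions A)"

definition continuously_differentiable :: "('a::real_normed_vector \<Rightarrow> 'b::real_normed_vector) \<Rightarrow> bool" where
  "continuously_differentiable f \<longleftrightarrow>
     (\<exists>f'. (\<forall>x. (f has_derivative blinfun_apply (f' x)) (at x)) \<and> continuous_on UNIV f')"

definition convex_game :: "('d::finite, 'n::finite) action_sets \<Rightarrow> ('d, 'n) costs \<Rightarrow> bool" where
  "convex_game A J \<longleftrightarrow>
     (\<forall>i. convex (A i) \<and> compact (A i) \<and> interior (A i) \<noteq> {} \<and>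
          continuously_differentiable (J i) \<and>
          (\<forall>a. convex_on UNIV (\<lambda>x. J i (deviate a i x))))"

definition monotone_map_on :: "'a set \<Rightarrow> ('a::real_inner \<Rightarrow> 'a) \<Rightarrow> bool" where
  "monotone_map_on Y M \<longleftrightarrow> (\<forall>y\<in>Y. \<forall>z\<in>Y. (M y - M z) \<bullet> (y - z) \<ge> 0)"

definition strictly_monotone_map_on :: "'a set \<Rightarrow> ('a::real_inner \<Rightarrow> 'a) \<Rightarrow> bool" where
  "strictly_monotone_map_on Y M \<longleftrightarrow>
     (\<forall>y\<in>Y. \<forall>z\<in>Y. y \<noteq> z \<longrightarrow> (M y - M z) \<bullet> (y - z) > 0)"

definition merely_monotone_game :: "('d::finite, 'n::finite) action_sets \<Rightarrow> ('d, 'n) costs \<Rightarrow> bool" where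
  "merely_monotone_game A J \<longleftrightarrow>
     monotone_map_on (joint_actions A) (pseudo_gradient J) \<and>
     \<not> strictly_monotone_map_on (joint_actions A) (pseudo_gradient J)"

definition smooth_growth_game :: "('d::finite, 'n::finite) costs \<Rightarrow> bool" where
  "smooth_growth_game J \<longleftrightarrow>
     continuously_differentiable (pseudo_gradient J) \<and>
     (\<forall>i. \<exists>\<alpha><2. J i \<in> O[at_infinity](\<lambda>x. exp (norm x powr \<alpha>)))"

(* The set written (1 - rho) Y in the literature; it is not the scaled set. *)
definition shrink :: "real \<Rightarrow> (real^'d::finite) set \<Rightarrow> (real^'d) set" where
  "shrink \<rho> Y = {x \<in> Y. infdist x (frontier Y) \<ge> \<rho>}"

(* Normal distribution with mean m and covariance matrix s^2 I. *)
definition gaussian :: "real^'d::finite \<Rightarrow> real \<Rightarrow> (real^'d) measure" where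
  "gaussian m s = density lborel (\<lambda>x. ennreal (\<Prod>k\<in>UNIV. normal_density (m $ k) s (x $ k)))"

definition generated :: "'w measure \<Rightarrow> ('w \<Rightarrow> real^'d::finite) set \<Rightarrow> 'w measure" where
  "generated P XX = sigma (space P) {X -` B \<inter> space P |X B. X \<in> XX \<and> B \<in> sets borel}"

(* Given the information in F, the random vector X is normal with (random) mean m
   and covariance s^2 I. *)
definition cond_gaussian ::
  "'w measure \<Rightarrow> 'w measure \<Rightarrow> ('w \<Rightarrow> real^'d::finite) \<Rightarrow> ('w \<Rightarrow> real^'d) \<Rightarrow> real \<Rightarrow> bool" where
  "cond_gaussian P F X m s \<longleftrightarrow>
     X \<in> borel_measurable P \<and>
     (\<forall>B\<in>sets borel.
        AE w in P. real_cond_exp P F (\<lambda>v. indicator B (X v)) w = measure (gaussian (m w) s) B)"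

(* A positive constant multiple of t^(-q) for t >= 1. The value at t = 0, which the algorithm also
   uses, is any positive number. *)
definition power_sequence :: "real \<Rightarrow> (nat \<Rightarrow> real) \<Rightarrow> bool" where
  "power_sequence q f \<longleftrightarrow>
     (\<forall>t. f t > 0) \<and> (\<exists>c>0. \<forall>t\<ge>1. f t = c * real t powr (-q))"

(* The exponents (g, s, r, e) of the step size gamma, the spread sigma, the shrinkage rho and
   the regularization epsilon. *)
type_synonym exponents = "real \<times> real \<times> real \<times> real"

definition parameters ::
  "exponents \<Rightarrow> (nat \<Rightarrow> real) \<Rightarrow> (nat \<Rightarrow> real) \<Rightarrow> (nat \<Rightarrow> real) \<Rightarrow> (nat \<Rightarrow> real) \<Rightarrow> bool" where
  "parameters x \<gamma> \<sigma> \<rho> \<epsilon> \<longleftrightarrow>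
     (case x of (g, s, r, e) \<Rightarrow>
        power_sequence g \<gamma> \<and> power_sequence s \<sigma> \<and> power_sequence r \<rho> \<and> power_sequence e \<epsilon>)"

definition shrinkage_ok :: "(nat \<Rightarrow> real) \<Rightarrow> (real^'d::finite) set \<Rightarrow> bool" where
  "shrinkage_ok \<rho> Y \<longleftrightarrow> (\<forall>t. \<rho> t < 1 \<and> interior (shrink (\<rho> t) Y) \<noteq> {})"

(* The first argument selects the relaxed summability condition of the interior case. *)
definition convergence_conditions ::
  "bool \<Rightarrow> (nat \<Rightarrow> real) \<Rightarrow> (nat \<Rightarrow> real) \<Rightarrow> (nat \<Rightarrow> real) \<Rightarrow> (nat \<Rightarrow> real) \<Rightarrow> bool" where
  "convergence_conditions relaxed \<gamma> \<sigma> \<rho> \<epsilon> \<longleftrightarrow>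
     \<gamma> \<longlonglongrightarrow> 0 \<and> \<epsilon> \<longlonglongrightarrow> 0 \<and> \<sigma> \<longlonglongrightarrow> 0 \<and> \<rho> \<longlonglongrightarrow> 0 \<and>
     (\<lambda>t. \<rho> t / \<epsilon> t) \<longlonglongrightarrow> 0 \<and>
     (if relaxed then
        summable (\<lambda>t. \<bar>\<epsilon> (Suc t) - \<epsilon> t\<bar>\<^sup>2 / (\<epsilon> (Suc t) ^ 3 * \<gamma> (Suc t)))
      else
        (\<exists>\<epsilon>'>0. summable (\<lambda>t.
           \<bar>\<epsilon> (Suc t) - \<epsilon> t\<bar>\<^sup>2 / (\<epsilon> (Suc t) ^ 3 * \<gamma> (Suc t)) +
           \<bar>\<rho> (Suc t) - \<rho> t\<bar>\<^sup>2 / (\<epsilon> (Suc t) powr (5 + 2 * \<epsilon>') * \<gamma> (Suc t))))) \<and>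
     filterlim (\<lambda>t. \<rho> t / \<sigma> t) at_top sequentially \<and>
     filterlim (\<lambda>T. \<Sum>t=1..T. \<gamma> t * \<epsilon> t) at_top sequentially \<and>
     summable (\<lambda>t. (\<gamma> t)\<^sup>2 / (\<sigma> t)\<^sup>2) \<and>
     summable (\<lambda>t. \<gamma> t * \<sigma> t)"

(* Player i uses the payoff-based algorithm: F t is the information conditionally on which
   the query point xi t is drawn, mu0 is the initial mean, a t the joint action actually played. *)
definition follows_algorithm ::
  "'w measure \<Rightarrow> ('d::finite, 'n::finite) action_sets \<Rightarrow> ('d, 'n) costs \<Rightarrow>
   (nat \<Rightarrow> real) \<Rightarrow> (nat \<Rightarrow> real) \<Rightarrow> (nat \<Rightarrow> real) \<Rightarrow> (nat \<Rightarrow> real) \<Rightarrow>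
   'n \<Rightarrow> real^'d \<Rightarrow> (nat \<Rightarrow> 'w measure) \<Rightarrow>
   (nat \<Rightarrow> 'w \<Rightarrow> real^'d) \<Rightarrow> (nat \<Rightarrow> 'w \<Rightarrow> real^'d) \<Rightarrow> (nat \<Rightarrow> 'w \<Rightarrow> ('d, 'n) profile) \<Rightarrow> bool" where
  "follows_algorithm P A J \<gamma> \<sigma> \<rho> \<epsilon> i \<mu>0 F \<xi> \<mu> a \<longleftrightarrow>
     (\<forall>w\<in>space P. \<mu> 0 w = \<mu>0) \<and>
     (\<forall>t. cond_gaussian P (F t) (\<xi> t) (\<mu> t) (\<sigma> t)) \<and>
     (\<forall>t. \<forall>w\<in>space P.
        a t w $ i = closest_point (A i) (\<xi> t w) \<and>
        (let m = (J i (a t w) / (\<sigma> t)\<^sup>2) *\<^sub>R (\<xi> t w - \<mu> t w) in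
         \<mu> (Suc t) w =
           closest_point (shrink (\<rho> t) (A i)) (\<mu> t w - \<gamma> t *\<^sub>R (m + \<epsilon> t *\<^sub>R \<mu> t w))))"

definition regret :: "('d::finite, 'n::finite) costs \<Rightarrow> 'n \<Rightarrow> (nat \<Rightarrow> ('d, 'n) profile) \<Rightarrow>
    real^'d \<Rightarrow> nat \<Rightarrow> real" where
  "regret J i a y T = (\<Sum>t=1..T. J i (a t)) - (\<Sum>t=1..T. J i (deviate (a t) i y))"

definition expected_average_regret ::
  "'w measure \<Rightarrow> ('d::finite, 'n::finite) costs \<Rightarrow> 'n \<Rightarrow> (nat \<Rightarrow> 'w \<Rightarrow> ('d, 'n) profile) \<Rightarrow>
   real^'d \<Rightarrow> nat \<Rightarrow> real" where
  "expected_average_regret P J i a y T = (\<integral>w. regret J i (\<lambda>t. a t w) y T \<partial>P) / real T"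

(* Only player i follows the algorithm. The other players' actions form an arbitrary process
   of feasible actions; player i samples independently of their current choices, hence the
   information consists of her own past samples and of their past and current actions. *)
definition unilateral_run ::
  "'w measure \<Rightarrow> ('d::finite, 'n::finite) action_sets \<Rightarrow> ('d, 'n) costs \<Rightarrow>
   (nat \<Rightarrow> real) \<Rightarrow> (nat \<Rightarrow> real) \<Rightarrow> (nat \<Rightarrow> real) \<Rightarrow> (nat \<Rightarrow> real) \<Rightarrow>
   'n \<Rightarrow> (nat \<Rightarrow> 'w \<Rightarrow> ('d, 'n) profile) \<Rightarrow> bool" where
  "unilateral_run P A J \<gamma> \<sigma> \<rho> \<epsilon> i a \<longleftrightarrow>
     (\<forall>j t. (\<lambda>w. a t w $ j) \<in> borel_measurable P \<and> (\<forall>w\<in>space P. a t w $ j \<in> A j)) \<and>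
     (\<exists>\<mu>0 \<xi> \<mu>. follows_algorithm P A J \<gamma> \<sigma> \<rho> \<epsilon> i \<mu>0
        (\<lambda>t. generated P ({\<xi> u |u. u < t} \<union> {\<lambda>w. a u w $ j |u j. u \<le> t \<and> j \<noteq> i})) \<xi> \<mu> a)"

(* All players follow the algorithm. Each one's information consists of all past samples
   and of the other players' current samples, so the current samples are conditionally
   independent given the past. *)
definition collective_run ::
  "'w measure \<Rightarrow> ('d::finite, 'n::finite) action_sets \<Rightarrow> ('d, 'n) costs \<Rightarrow>
   (nat \<Rightarrow> real) \<Rightarrow> (nat \<Rightarrow> real) \<Rightarrow> (nat \<Rightarrow> real) \<Rightarrow> (nat \<Rightarrow> real) \<Rightarrow>
   (nat \<Rightarrow> 'w \<Rightarrow> ('d, 'n) profile) \<Rightarrow> bool" where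
  "collective_run P A J \<gamma> \<sigma> \<rho> \<epsilon> a \<longleftrightarrow>
     (\<exists>\<mu>0 \<xi> \<mu>. \<forall>i. follows_algorithm P A J \<gamma> \<sigma> \<rho> \<epsilon> i (\<mu>0 i)
        (\<lambda>t. generated P ({\<xi> j u |j u. u < t} \<union> {\<xi> j t |j. j \<noteq> i})) (\<xi> i) (\<mu> i) a)"

(* E R^i(T, y) / T <= O(f T). The constant may depend on the game, the parameters and y,
   but not on the run. *)
definition unilateral_bound :: "'w itself \<Rightarrow> ('d::finite, 'n::finite) action_sets \<Rightarrow>
    ('d, 'n) costs \<Rightarrow> 'n \<Rightarrow> real^'d \<Rightarrow> exponents \<Rightarrow> (nat \<Rightarrow> real) \<Rightarrow> bool" where
  "unilateral_bound W A J i y x f \<longleftrightarrow>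
     (\<forall>\<gamma> \<sigma> \<rho> \<epsilon>. parameters x \<gamma> \<sigma> \<rho> \<epsilon> \<and> shrinkage_ok \<rho> (A i) \<longrightarrow>
        (\<exists>C. \<forall>(P :: 'w measure) a. prob_space P \<and> unilateral_run P A J \<gamma> \<sigma> \<rho> \<epsilon> i a \<longrightarrow>
           (\<forall>T\<ge>1. expected_average_regret P J i a y T \<le> C * f T)))"

definition collective_bound :: "'w itself \<Rightarrow> ('d::finite, 'n::finite) action_sets \<Rightarrow>
    ('d, 'n) costs \<Rightarrow> 'n \<Rightarrow> real^'d \<Rightarrow> exponents \<Rightarrow> (nat \<Rightarrow> real) \<Rightarrow> bool" where
  "collective_bound W A J i y x f \<longleftrightarrow>
     (\<forall>\<gamma> \<sigma> \<rho> \<epsilon>. parameters x \<gamma> \<sigma> \<rho> \<epsilon> \<and> (\<forall>j. shrinkage_ok \<rho> (A j)) \<longrightarrow>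
        (\<exists>C. \<forall>(P :: 'w measure) a. prob_space P \<and> collective_run P A J \<gamma> \<sigma> \<rho> \<epsilon> a \<longrightarrow>
           (\<forall>T\<ge>1. expected_average_regret P J i a y T \<le> C * f T)))"

(* In the next two definitions the first argument tells whether the reference point lies on
   the boundary of the player's action set. *)
definition regret_terms :: "bool \<Rightarrow> exponents \<Rightarrow> nat \<Rightarrow> real" where
  "regret_terms bd x T = (case x of (g, s, r, e) \<Rightarrow>
     real T powr (-(1 - g)) + real T powr (-(g - 2 * s)) + real T powr (-(2 * s)) +
     (if bd then real T powr (-r) else 0) + real T powr (-e))"

definition guaranteed_exponent :: "bool \<Rightarrow> exponents \<Rightarrow> real" where
  "guaranteed_exponent bd x = (case x of (g, s, r, e) \<Rightarrow>
     if bd then Min {1 - g, g - 2 * s, 2 * s, r, e} else Min {1 - g, g - 2 * s, 2 * s, e})"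

definition unit_exponents :: "exponents set" where
  "unit_exponents = {(g, s, r, e). 0 < g \<and> g < 1 \<and> 0 < s \<and> s < 1 \<and> 0 < r \<and> r < 1 \<and> 0 < e \<and> e < 1}"

definition unilateral_exponents :: "exponents set" where
  "unilateral_exponents = {(g, s, r, e) \<in> unit_exponents. r < s \<and> g - 2 * s > 0}"

definition convergent_exponents :: "bool \<Rightarrow> exponents set" where
  "convergent_exponents relaxed =
     {x \<in> unit_exponents. \<forall>\<gamma> \<sigma> \<rho> \<epsilon>. parameters x \<gamma> \<sigma> \<rho> \<epsilon> \<longrightarrow>
        convergence_conditions relaxed \<gamma> \<sigma> \<rho> \<epsilon>}"

(* Bd x f reads: with exponents x the expected average regret is at most O(f T).
   The optimal rate is O(T^(-b)) if b is the attained maximum of the guaranteed exponent over X. *)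
definition optimal_rate_attained ::
  "exponents set \<Rightarrow> bool \<Rightarrow> (exponents \<Rightarrow> (nat \<Rightarrow> real) \<Rightarrow> bool) \<Rightarrow> real \<Rightarrow> bool" where
  "optimal_rate_attained X bd Bd b \<longleftrightarrow>
     (\<forall>x\<in>X. Bd x (regret_terms bd x)) \<and>
     (\<forall>x\<in>X. guaranteed_exponent bd x \<le> b) \<and>
     (\<exists>x\<in>X. guaranteed_exponent bd x = b \<and> Bd x (\<lambda>T. real T powr (-b)))"

(* The optimal rate is O(T^(-(b - eta))) for small eta > 0 if b is the supremum of the
   guaranteed exponent over X. *)
definition optimal_rate_approached ::
  "exponents set \<Rightarrow> bool \<Rightarrow> (exponents \<Rightarrow> (nat \<Rightarrow> real) \<Rightarrow> bool) \<Rightarrow> real \<Rightarrow> bool" where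
  "optimal_rate_approached X bd Bd b \<longleftrightarrow>
     (\<forall>x\<in>X. Bd x (regret_terms bd x)) \<and>
     X \<noteq> {} \<and> bdd_above (guaranteed_exponent bd ` X) \<and> (SUP x\<in>X. guaranteed_exponent bd x) = b \<and>
     (\<forall>\<eta>>0. \<exists>x\<in>X. guaranteed_exponent bd x \<ge> b - \<eta> \<and> Bd x (\<lambda>T. real T powr (-(b - \<eta>))))"

end

theory Submission
  imports Defs
begin

text \<open>Player \<open>i\<close> runs projected stochastic gradient descent on her own cost, and her gradient estimate is built from
one payoff per round. Three facts make the regret bounds work.

First, the estimate is a gradient of the right function up to a small error. Freeze the other players' actions, and
let \<open>f\<close> be the cost as a function of her own action, \<open>X\<close> a centred Gaussian vector with standard deviation \<open>\<sigma>\<close>.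
The expectation of \<open>f (\<mu> + X)\<close> times \<open>X / \<sigma>\<^sup>2\<close> is the gradient at \<open>\<mu>\<close> of the Gaussian smoothing of
\<open>f\<close>. The smoothing is convex, so the estimate satisfies the first-order convexity inequality, and since \<open>f\<close> has a Lipschitz gradient, smoothing
changes values by \<open>O(\<sigma>\<^sup>2)\<close> only, not by \<open>O(\<sigma>)\<close>. The action played is the projection of the sample, not the
sample; but \<open>\<mu>\<close> keeps the distance \<open>\<rho>\<close> to the boundary, and Markov's inequality with a high moment makes the
effect of the projection smaller than any given negative power of \<open>t\<close>, because \<open>\<sigma> / \<rho>\<close> tends to \<open>0\<close> polynomially (\<open>r < s\<close>). This is
\<open>payoff_gradient_estimate\<close>; \<open>cond_gaussian_expectation\<close> transfers it to the conditional expectation given the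
information of the player, whatever the others do.

Second, the usual descent inequality for projected gradient steps, summed over \<open>t\<close> (\<open>cumulative_regret\<close>): the
telescoping part contributes \<open>1 / \<gamma>\<^sub>T\<close>, the second moment of the estimate \<open>\<gamma>\<^sub>t / \<sigma>\<^sub>t\<^sup>2\<close> per step, the
regularization \<open>\<epsilon>\<^sub>t\<close>, the smoothing \<open>\<sigma>\<^sub>t\<^sup>2\<close>. The comparator has to lie in the shrunken set; an interior point
eventually does, a boundary point is pushed inward by a distance proportional to \<open>\<rho>\<^sub>t\<close>. After division by \<open>T\<close> these are
the terms of the regret rate (\<open>bandit_regret_rate\<close>). The two scenarios of the theorem are instances: the information of
the player always contains her own past and the current actions of the others.

Third, a small linear optimization over the exponents. Since \<open>(1 - g) + (g - 2 s) + 2 s = 1\<close>, no choice guarantees more than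
\<open>1/3\<close>; when the guaranteed exponent is also bounded by a number below \<open>s\<close> (by \<open>r\<close> for a boundary point, by \<open>e\<close> under the convergence
conditions, which force \<open>e < r < s\<close>), this becomes \<open>1/4\<close>; and for a boundary point the convergence conditions add
\<open>5 e + g < 2 r + 1\<close>, which gives \<open>1/6\<close>. Explicit exponents attain or approach these values.\<close>

section \<open>Isotropic Gaussian measures\<close>

lemma prod_Basis_vec: "(\<Prod>b\<in>(Basis::(real^'d::finite) set). f b) = (\<Prod>k\<in>UNIV. f (axis k 1))"
proof -
  have B: "(Basis::(real^'d) set) = range (\<lambda>k. axis k 1)"
    by (auto simp: Basis_vec_def)
  have "inj (\<lambda>k::'d. axis k (1::real))" by (auto simp: inj_def axis_eq_axis)
  then show ?thesis unfolding B by (simp add: prod.reindex)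
qed

lemma nn_integral_prod_vec:
  fixes f :: "'d::finite \<Rightarrow> real \<Rightarrow> ennreal"
  assumes [measurable]: "\<And>k. f k \<in> borel_measurable borel"
  shows "(\<integral>\<^sup>+x. (\<Prod>k\<in>UNIV. f k (x $ k)) \<partial>(lborel :: (real^'d) measure)) = (\<Prod>k\<in>UNIV. \<integral>\<^sup>+x. f k x \<partial>lborel)"
proof -
  define h where "h b = f (THE k. b = axis k (1::real))" for b :: "real^'d"
  have h: "h (axis k 1) = f k" for k
    by (auto simp: h_def axis_eq_axis)
  have "(\<integral>\<^sup>+x. (\<Prod>b\<in>Basis. h b (x \<bullet> b)) \<partial>(lborel :: (real^'d) measure)) = (\<Prod>b\<in>Basis. \<integral>\<^sup>+x. h b x \<partial>lborel)"
    by (rule nn_integral_lborel_prod) (auto simp: h_def)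
  then show ?thesis
    by (simp add: prod_Basis_vec h inner_axis)
qed

lemma gaussian_density_eq:
  fixes x m :: "real^'d::finite"
  shows "(\<Prod>k\<in>UNIV. normal_density (m $ k) s (x $ k)) =
    (1 / sqrt (2 * pi * s\<^sup>2)) ^ CARD('d) * exp (- (norm (x - m))\<^sup>2 / (2 * s\<^sup>2))"
proof -
  have "(norm (x - m))\<^sup>2 = (\<Sum>k\<in>UNIV. (x $ k - m $ k)\<^sup>2)"
    unfolding power2_norm_eq_inner inner_vec_def by (simp add: power2_eq_square)
  then show ?thesis
    by (simp add: normal_density_def prod_dividef power_divide sum_divide_distrib exp_sum flip: sum_negf)
qed

lemma sets_gaussian [simp, measurable_cong]: "sets (gaussian m s) = sets borel"
  and space_gaussian [simp]: "space (gaussian m s) = UNIV"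
  by (simp_all add: gaussian_def)

lemma prob_space_gaussian:
  assumes "s > 0" shows "prob_space (gaussian m s)"
proof
  have "emeasure (gaussian m s) UNIV = (\<integral>\<^sup>+x. (\<Prod>k\<in>UNIV. ennreal (normal_density (m $ k) s (x $ k))) \<partial>lborel)"
    by (simp add: gaussian_def emeasure_density prod_ennreal)
  also have "\<dots> = 1"
    using assms by (subst nn_integral_prod_vec) (auto simp: nn_integral_eq_integral)
  finally show "emeasure (gaussian m s) (space (gaussian m s)) = 1" by simp
qed

lemma nn_integral_gaussian:
  assumes [measurable]: "f \<in> borel_measurable borel"
  shows "(\<integral>\<^sup>+x. f x \<partial>gaussian m s) = (\<integral>\<^sup>+x. ennreal (\<Prod>k\<in>UNIV. normal_density (m $ k) s (x $ k)) * f x \<partial>lborel)"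
  by (simp add: gaussian_def nn_integral_density)

lemma gaussian_eq_distr: "gaussian m s = distr (gaussian 0 s) borel (\<lambda>x. m + x)"
proof (rule measure_eqI)
  fix B assume "B \<in> sets (gaussian m s)"
  then have [measurable]: "B \<in> sets borel" by simp
  have "emeasure (gaussian m s) B = (\<integral>\<^sup>+x. ennreal (\<Prod>k\<in>UNIV. normal_density (m $ k) s (x $ k)) * indicator B x \<partial>lborel)"
    by (simp add: gaussian_def emeasure_density)
  also have "\<dots> = (\<integral>\<^sup>+x. ennreal (\<Prod>k\<in>UNIV. normal_density (m $ k) s ((m + x) $ k)) * indicator B (m + x) \<partial>lborel)"
    by (subst lborel_distr_plus[of m, symmetric], subst nn_integral_distr) auto
  also have "\<dots> = (\<integral>\<^sup>+x. indicator B (m + x) \<partial>gaussian 0 s)"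
    by (simp add: nn_integral_gaussian normal_density_def)
  also have "\<dots> = emeasure (distr (gaussian 0 s) borel (\<lambda>x. m + x)) B"
    by (subst nn_integral_distr[symmetric, of "(+) m" _ borel "indicator B"])(auto)
  finally show "emeasure (gaussian m s) B = emeasure (distr (gaussian 0 s) borel (\<lambda>x. m + x)) B" .
qed simp

lemma lborel_distr_uminus_euclidean: "distr lborel borel uminus = (lborel :: 'a::euclidean_space measure)"
  by (subst lborel_affine[of "-1" 0])
     (auto simp: density_1 one_ennreal_def[symmetric])

lemma gaussian_symmetric: "distr (gaussian 0 s) borel uminus = (gaussian 0 s :: (real^'d::finite) measure)"
proof (rule measure_eqI)
  fix B assume "B \<in> sets (distr (gaussian 0 s) borel uminus :: (real^'d) measure)"
  then have [measurable]: "B \<in> sets borel" by simp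
  have "emeasure (gaussian 0 s) B = (\<integral>\<^sup>+x. ennreal (\<Prod>k\<in>UNIV. normal_density 0 s (x $ k)) * indicator B x \<partial>lborel)"
    by (simp add: gaussian_def emeasure_density)
  also have "\<dots> = (\<integral>\<^sup>+x. ennreal (\<Prod>k\<in>UNIV. normal_density 0 s ((- x) $ k)) * indicator B (- x) \<partial>lborel)"
    by (subst lborel_distr_uminus_euclidean[symmetric], subst nn_integral_distr) auto
  also have "\<dots> = (\<integral>\<^sup>+x. indicator B (- x) \<partial>gaussian 0 s)"
    by (simp add: nn_integral_gaussian normal_density_def)
  also have "\<dots> = emeasure (distr (gaussian 0 s) borel uminus) B"
    by (subst nn_integral_distr[symmetric, of "uminus" _ borel "indicator B"])(auto)
  finally show "emeasure (distr (gaussian 0 s) borel uminus) B = emeasure (gaussian 0 s) B" by simp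
qed simp

text \<open>The density is a product over the coordinates: all factors but one integrate to \<open>1\<close>, and the remaining one gives a moment of
the real normal distribution.\<close>

lemma gaussian_coordinate_moment:
  assumes s: "s > 0"
  shows "(\<integral>\<^sup>+x. ennreal ((x $ k) ^ (2 * p)) \<partial>(gaussian 0 s :: (real^'d::finite) measure))
    = ennreal (fact (2 * p) / (2 ^ p * fact p) * s ^ (2 * p))"
proof -
  define h :: "'d \<Rightarrow> real \<Rightarrow> ennreal" where
    "h j x = (if j = k then ennreal (normal_density 0 s x * x ^ (2 * p)) else ennreal (normal_density 0 s x))" for j x
  have [measurable]: "h j \<in> borel_measurable borel" for j
    by (cases "j = k") (simp_all add: h_def[abs_def])
  have "(\<Prod>j\<in>UNIV. h j (x $ j)) = ennreal (\<Prod>k\<in>UNIV. normal_density 0 s (x $ k)) * ennreal ((x $ k) ^ (2 * p))" for x :: "real^'d"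
  proof -
    have "(\<Prod>j\<in>UNIV. h j (x $ j)) = h k (x $ k) * (\<Prod>j\<in>UNIV - {k}. h j (x $ j))"
      by (subst prod.remove[of _ k]) auto
    also have "(\<Prod>j\<in>UNIV - {k}. h j (x $ j)) = (\<Prod>j\<in>UNIV - {k}. ennreal (normal_density 0 s (x $ j)))"
      by (rule prod.cong) (auto simp: h_def)
    also have "h k (x $ k) * (\<Prod>j\<in>UNIV - {k}. ennreal (normal_density 0 s (x $ j))) =
        ennreal (normal_density 0 s (x $ k)) * ennreal ((x $ k) ^ (2 * p)) *
        ennreal (\<Prod>j\<in>UNIV - {k}. normal_density 0 s (x $ j))"
      by (simp add: h_def prod_ennreal ennreal_mult')
    also have "\<dots> = ennreal (normal_density 0 s (x $ k) * (\<Prod>j\<in>UNIV - {k}. normal_density 0 s (x $ j))) * ennreal ((x $ k) ^ (2 * p))"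
      by (simp add: ennreal_mult' mult_ac)
    also have "normal_density 0 s (x $ k) * (\<Prod>j\<in>UNIV - {k}. normal_density 0 s (x $ j)) = (\<Prod>j\<in>UNIV. normal_density 0 s (x $ j))"
      by (subst prod.remove[of UNIV k]) auto
    finally show ?thesis .
  qed
  then have "(\<integral>\<^sup>+x. ennreal ((x $ k) ^ (2 * p)) \<partial>(gaussian 0 s :: (real^'d) measure)) = (\<integral>\<^sup>+x. (\<Prod>j\<in>UNIV. h j (x $ j)) \<partial>(lborel :: (real^'d) measure))"
    by (simp add: nn_integral_gaussian)
  also have "\<dots> = (\<Prod>j\<in>UNIV. \<integral>\<^sup>+x. h j x \<partial>lborel)"
    by (rule nn_integral_prod_vec) simp
  also have "\<dots> = (\<integral>\<^sup>+x. h k x \<partial>lborel) * (\<Prod>j\<in>UNIV - {k}. \<integral>\<^sup>+x. h j x \<partial>lborel)"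
    by (subst prod.remove[of _ k]) auto
  also have "(\<Prod>j\<in>UNIV - {k}. \<integral>\<^sup>+x. h j x \<partial>lborel) = 1"
    using s by (intro prod.neutral) (auto simp: h_def nn_integral_eq_integral)
  also have "(\<integral>\<^sup>+x. h k x \<partial>lborel) = ennreal (fact (2 * p) / ((2 / s\<^sup>2) ^ p * fact p))"
    using normal_moment_even[OF s, of 0 p] s
    by (auto simp: h_def has_bochner_integral_iff nn_integral_eq_integral)
  also have "fact (2 * p) / ((2 / s\<^sup>2) ^ p * fact p) = fact (2 * p) / (2 ^ p * fact p) * s ^ (2 * p)"
    using s by (simp add: power_divide power_mult)
  finally show ?thesis by simp
qed

text \<open>A crude bound for the moment of order \<open>2 p\<close> of the norm of a standard Gaussian vector: the norm is at most
\<open>sqrt d\<close> times the largest coordinate, and the power of the largest coordinate is at most the sum of all these powers.\<close>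

definition moment_const :: "'d::finite itself \<Rightarrow> nat \<Rightarrow> real" where
  "moment_const D p = real CARD('d) ^ Suc p * (fact (2 * p) / (2 ^ p * fact p))"

lemma moment_const_nonneg: "moment_const D p \<ge> 0"
  by (simp add: moment_const_def)

lemma norm_power_le_sum:
  fixes x :: "real^'d::finite"
  shows "norm x ^ (2 * p) \<le> real CARD('d) ^ p * (\<Sum>k\<in>UNIV. (x $ k) ^ (2 * p))"
proof -
  have fin: "finite (range (\<lambda>k. (x $ k)\<^sup>2))" by simp
  then have "Max (range (\<lambda>k. (x $ k)\<^sup>2)) \<in> range (\<lambda>k. (x $ k)\<^sup>2)" by (rule Max_in) auto
  then obtain k where k: "Max (range (\<lambda>k. (x $ k)\<^sup>2)) = (x $ k)\<^sup>2" by (rule rangeE)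
  have le: "(x $ j)\<^sup>2 \<le> (x $ k)\<^sup>2" for j
    unfolding k[symmetric] by (rule Max_ge[OF fin]) (rule rangeI)
  have "(norm x)\<^sup>2 = (\<Sum>j\<in>UNIV. (x $ j)\<^sup>2)"
    unfolding power2_norm_eq_inner inner_vec_def by (simp add: power2_eq_square)
  also have "\<dots> \<le> real CARD('d) * (x $ k)\<^sup>2"
    using sum_bounded_above[of UNIV "\<lambda>j. (x $ j)\<^sup>2" "(x $ k)\<^sup>2"] le by simp
  finally have "((norm x)\<^sup>2) ^ p \<le> (real CARD('d) * (x $ k)\<^sup>2) ^ p"
    by (rule power_mono) simp
  then have "norm x ^ (2 * p) \<le> real CARD('d) ^ p * (x $ k) ^ (2 * p)"
    by (simp only: power_mult power_mult_distrib)
  also have "\<dots> \<le> real CARD('d) ^ p * (\<Sum>k\<in>UNIV. (x $ k) ^ (2 * p))"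
  proof (rule mult_left_mono)
    show "(x $ k) ^ (2 * p) \<le> (\<Sum>k\<in>UNIV. (x $ k) ^ (2 * p))"
      by (rule member_le_sum) (auto simp only: power_mult zero_le_power zero_le_power2 finite)
  qed simp
  finally show ?thesis .
qed

lemma gaussian_norm_moment_nn:
  assumes s: "s > 0"
  shows "(\<integral>\<^sup>+x. ennreal (norm x ^ (2 * p)) \<partial>(gaussian 0 s :: (real^'d::finite) measure))
    \<le> ennreal (moment_const TYPE('d) p * s ^ (2 * p))"
proof -
  have pos: "0 \<le> (y::real) ^ (2 * p)" for y by (simp add: power_mult)
  have "(\<integral>\<^sup>+x. ennreal (norm x ^ (2 * p)) \<partial>(gaussian 0 s :: (real^'d) measure)) \<le>
     (\<integral>\<^sup>+x. ennreal (real CARD('d) ^ p) * (\<Sum>k\<in>UNIV. ennreal ((x $ k) ^ (2 * p))) \<partial>(gaussian 0 s :: (real^'d) measure))"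
    by (intro nn_integral_mono)
      (auto simp: sum_ennreal pos ennreal_mult[symmetric] sum_nonneg intro!: ennreal_leI norm_power_le_sum)
  also have "\<dots> = ennreal (real CARD('d) ^ p) * (\<Sum>k\<in>(UNIV::'d set). ennreal (fact (2 * p) / (2 ^ p * fact p) * s ^ (2 * p)))"
    by (subst nn_integral_cmult, simp, subst nn_integral_sum, simp, simp only: gaussian_coordinate_moment[OF s])
  also have "\<dots> = ennreal (moment_const TYPE('d) p * s ^ (2 * p))"
    using s by (simp add: moment_const_def ennreal_of_nat_eq_real_of_nat ennreal_mult[symmetric] ac_simps)
  finally show ?thesis .
qed

lemma integrable_gaussian_norm_power:
  assumes s: "s > 0"
  shows "integrable (gaussian 0 s :: (real^'d::finite) measure) (\<lambda>x. norm x ^ (2 * p))"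
  using gaussian_norm_moment_nn[OF s, of p, where 'd='d]
  by (intro integrableI_nonneg) (auto intro: order.strict_trans1)

lemma gaussian_norm_moment:
  assumes s: "s > 0"
  shows "(\<integral>x. norm x ^ (2 * p) \<partial>(gaussian 0 s :: (real^'d::finite) measure)) \<le> moment_const TYPE('d) p * s ^ (2 * p)"
  using gaussian_norm_moment_nn[OF s, of p, where 'd='d] s
  by (subst (asm) nn_integral_eq_integral[OF integrable_gaussian_norm_power])
     (auto simp: moment_const_nonneg)

lemma integrable_gaussian_quadratic:
  assumes s: "s > 0" and [measurable]: "f \<in> borel_measurable borel"
    and f: "\<And>x. \<bar>f x\<bar> \<le> a + b * norm x ^ 2"
  shows "integrable (gaussian 0 s :: (real^'d::finite) measure) (f :: real^'d \<Rightarrow> real)"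
proof -
  interpret prob_space "gaussian 0 s :: (real^'d) measure" by (rule prob_space_gaussian[OF s])
  have "integrable (gaussian 0 s :: (real^'d) measure) (\<lambda>x. a + b * norm x ^ 2)"
    using integrable_gaussian_norm_power[OF s, of 1, where 'd='d] by (intro Bochner_Integration.integrable_add integrable_mult_right) auto
  then show ?thesis
    by (rule Bochner_Integration.integrable_bound) (auto intro!: AE_I2 order.trans[OF f])
qed

lemma integral_gaussian_uminus:
  fixes f :: "real^'d::finite \<Rightarrow> real"
  assumes [measurable]: "f \<in> borel_measurable borel"
  shows "(\<integral>x. f (- x) \<partial>gaussian 0 s) = (\<integral>x. f x \<partial>gaussian 0 s)"
  by (subst (2) gaussian_symmetric[symmetric], subst integral_distr) auto

lemma integral_gaussian_inner_zero: "(\<integral>x. x \<bullet> v \<partial>(gaussian 0 s :: (real^'d::finite) measure)) = 0"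
  using integral_gaussian_uminus[of "\<lambda>x. x \<bullet> v" s] by simp

text \<open>The exponential is the ratio of the densities centred at \<open>v\<close> and at \<open>0\<close> (the finite-dimensional
Cameron-Martin formula).\<close>

lemma nn_integral_gaussian_shift:
  fixes k :: "real^'d::finite \<Rightarrow> ennreal"
  assumes s: "s > 0" and [measurable]: "k \<in> borel_measurable borel"
  shows "(\<integral>\<^sup>+x. k (v + x) \<partial>gaussian 0 s) =
    (\<integral>\<^sup>+x. ennreal (exp ((x \<bullet> v) / s\<^sup>2 - (norm v)\<^sup>2 / (2 * s\<^sup>2))) * k x \<partial>gaussian 0 s)"
proof -
  have "(\<integral>\<^sup>+x. k (v + x) \<partial>gaussian 0 s) = (\<integral>\<^sup>+x. k x \<partial>gaussian v s)"
    by (subst gaussian_eq_distr, subst nn_integral_distr) auto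
  also have "\<dots> = (\<integral>\<^sup>+x. ennreal (\<Prod>k\<in>UNIV. normal_density (v $ k) s (x $ k)) * k x \<partial>lborel)"
    by (rule nn_integral_gaussian) simp
  also have "\<dots> = (\<integral>\<^sup>+x. ennreal (\<Prod>k\<in>UNIV. normal_density ((0::real^'d) $ k) s (x $ k)) *
     (ennreal (exp ((x \<bullet> v) / s\<^sup>2 - (norm v)\<^sup>2 / (2 * s\<^sup>2))) * k x) \<partial>lborel)"
  proof (rule nn_integral_cong)
    fix x :: "real^'d"
    have "- (norm (x - v))\<^sup>2 / (2 * s\<^sup>2) = - (norm x)\<^sup>2 / (2 * s\<^sup>2) + ((x \<bullet> v) / s\<^sup>2 - (norm v)\<^sup>2 / (2 * s\<^sup>2))"
      using s unfolding power2_norm_eq_inner inner_diff_left inner_diff_right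
      by (simp add: field_simps inner_commute)
    then have "(\<Prod>k\<in>UNIV. normal_density (v $ k) s (x $ k)) = 
       (\<Prod>k\<in>UNIV. normal_density ((0::real^'d) $ k) s (x $ k)) * exp ((x \<bullet> v) / s\<^sup>2 - (norm v)\<^sup>2 / (2 * s\<^sup>2))"
      unfolding gaussian_density_eq by (simp add: mult.assoc flip: exp_add)
    then show "ennreal (\<Prod>k\<in>UNIV. normal_density (v $ k) s (x $ k)) * k x = ennreal (\<Prod>k\<in>UNIV. normal_density ((0::real^'d) $ k) s (x $ k)) *
     (ennreal (exp ((x \<bullet> v) / s\<^sup>2 - (norm v)\<^sup>2 / (2 * s\<^sup>2))) * k x)"
      by (simp add: ennreal_mult' mult.assoc prod_nonneg)
  qed
  also have "\<dots> = (\<integral>\<^sup>+x. ennreal (exp ((x \<bullet> v) / s\<^sup>2 - (norm v)\<^sup>2 / (2 * s\<^sup>2))) * k x \<partial>gaussian 0 s)"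
    by (rule nn_integral_gaussian[symmetric]) simp
  finally show ?thesis .
qed


section \<open>Gaussian smoothing of a convex cost\<close>

lemma lipschitz_real_bound:
  fixes F :: "'a::real_normed_vector \<Rightarrow> real"
  assumes "K-lipschitz_on S F" "x \<in> S" "y \<in> S"
  shows "\<bar>F x - F y\<bar> \<le> K * norm (x - y)"
  using lipschitz_onD[OF assms] by (simp add: dist_norm)

lemma linear_le_quadratic: "(n::real) \<le> 1 + n\<^sup>2"
proof -
  have "0 \<le> (n - 1)\<^sup>2 + n\<^sup>2 + 1" by simp
  then show ?thesis by (simp add: power2_eq_square algebra_simps)
qed

lemma gaussian_lipschitz_integrable:
  fixes F :: "real^'d::finite \<Rightarrow> real"
  assumes s: "s > 0" and F: "K-lipschitz_on UNIV F"
  shows "integrable (gaussian 0 s) (\<lambda>x. F (m + x))" "integrable (gaussian 0 s) (\<lambda>x. F (m + x) * (x \<bullet> v))"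
proof -
  have K: "K \<ge> 0" using F by (rule lipschitz_on_nonneg)
  have [measurable]: "F \<in> borel_measurable borel"
    by (intro borel_measurable_continuous_onI lipschitz_on_continuous_on[OF F])
  have b: "\<bar>F (m + x)\<bar> \<le> \<bar>F m\<bar> + K * norm x" for x
    using lipschitz_real_bound[OF F, of "m + x" m] by simp
  show "integrable (gaussian 0 s) (\<lambda>x. F (m + x))"
  proof (rule integrable_gaussian_quadratic[OF s])
    fix x :: "real^'d"
    show "\<bar>F (m + x)\<bar> \<le> (\<bar>F m\<bar> + K) + K * norm x ^ 2"
      using b[of x] mult_left_mono[OF linear_le_quadratic[of "norm x"] K] by (simp add: algebra_simps)
  qed simp
  show "integrable (gaussian 0 s) (\<lambda>x. F (m + x) * (x \<bullet> v))"
  proof (rule integrable_gaussian_quadratic[OF s])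
    fix x :: "real^'d"
    have "\<bar>F (m + x) * (x \<bullet> v)\<bar> \<le> (\<bar>F m\<bar> + K * norm x) * (norm x * norm v)"
      unfolding abs_mult by (intro mult_mono b Cauchy_Schwarz_ineq2) (auto simp: K)
    also have "\<dots> = (\<bar>F m\<bar> * norm v) * norm x + (K * norm v) * norm x ^ 2"
      by (simp add: algebra_simps power2_eq_square)
    also have "\<dots> \<le> (\<bar>F m\<bar> * norm v) * (1 + (norm x)\<^sup>2) + (K * norm v) * norm x ^ 2"
      by (intro add_right_mono mult_left_mono linear_le_quadratic) auto
    finally show "\<bar>F (m + x) * (x \<bullet> v)\<bar> \<le> \<bar>F m\<bar> * norm v + (\<bar>F m\<bar> * norm v + K * norm v) * norm x ^ 2"
      by (simp add: algebra_simps)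
  qed simp
qed

text \<open>By Stein's identity the left-hand side is \<open>s\<^sup>2\<close> times the derivative at \<open>0\<close>, in direction \<open>v\<close>, of the convex
function that sends \<open>u\<close> to the mean of \<open>k (u + X)\<close>, and a convex function lies above its tangents.
Differentiation under the integral sign is avoided: shift by \<open>h v\<close>, bound the density ratio from below by
\<open>exp u \<ge> 1 + u\<close> (legitimate because \<open>k \<ge> 0\<close>), bound \<open>k (h v + x)\<close> from above by convexity, divide by \<open>h\<close>
and let \<open>h\<close> tend to \<open>0\<close>.\<close>

lemma gaussian_correlation_le_increment:
  fixes k :: "real^'d::finite \<Rightarrow> real"
  assumes s: "s > 0" and lip: "K-lipschitz_on UNIV k" and conv: "convex_on UNIV k" and pos: "\<And>x. 0 \<le> k x"
  shows "(\<integral>x. k x * (x \<bullet> v) \<partial>gaussian 0 s) \<le> s\<^sup>2 * ((\<integral>x. k (v + x) \<partial>gaussian 0 s) - (\<integral>x. k x \<partial>gaussian 0 s))"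
proof -
  let ?N = "gaussian 0 s :: (real^'d) measure"
  have [measurable]: "k \<in> borel_measurable borel"
    by (intro borel_measurable_continuous_onI lipschitz_on_continuous_on[OF lip])
  note int = gaussian_lipschitz_integrable[OF s lip]
  have int0: "integrable ?N k" "integrable ?N (\<lambda>x. k x * (x \<bullet> v))"
    using int(1)[of 0] int(2)[of 0 v] by auto
  define c where "c = (\<integral>x. k x * (x \<bullet> v) \<partial>?N)"
  define a where "a = (\<integral>x. k x \<partial>?N)"
  define b where "b = (\<integral>x. k (v + x) \<partial>?N)"
  define e where "e = (norm v)\<^sup>2 / (2 * s\<^sup>2) * a"
  have a: "a \<ge> 0" unfolding a_def by (simp add: pos)
  then have e: "e \<ge> 0" by (simp add: e_def)
  \<comment> \<open>The term \<open>h * e\<close> comes from the square of the shift in the exponent; it disappears in the limit.\<close>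
  have *: "c / s\<^sup>2 \<le> b - a + h * e" if h: "0 < h" "h \<le> 1" for h
  proof -
    let ?u = "\<lambda>x. (x \<bullet> (h *\<^sub>R v)) / s\<^sup>2 - (norm (h *\<^sub>R v))\<^sup>2 / (2 * s\<^sup>2)"
    have "(\<integral>\<^sup>+x. ennreal (exp (?u x) * k x) \<partial>?N) = (\<integral>\<^sup>+x. ennreal (k (h *\<^sub>R v + x)) \<partial>?N)"
      by (subst nn_integral_gaussian_shift[OF s, where k = "\<lambda>x. ennreal (k x)"]) (auto simp: ennreal_mult')
    also have "\<dots> = ennreal (\<integral>x. k (h *\<^sub>R v + x) \<partial>?N)"
      using int(1) by (intro nn_integral_eq_integral) (auto simp: pos)
    finally have nn: "(\<integral>\<^sup>+x. ennreal (exp (?u x) * k x) \<partial>?N) = ennreal (\<integral>x. k (h *\<^sub>R v + x) \<partial>?N)" .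
    have ie: "integrable ?N (\<lambda>x. exp (?u x) * k x)"
    proof (rule integrableI_nonneg)
      show "(\<integral>\<^sup>+x. ennreal (exp (?u x) * k x) \<partial>?N) < \<infinity>" unfolding nn by simp
    qed (auto simp: pos)
    have "(\<integral>x. exp (?u x) * k x \<partial>?N) = (\<integral>x. k (h *\<^sub>R v + x) \<partial>?N)"
      using nn nn_integral_eq_integral[OF ie] by (simp add: pos)
    moreover have "(\<integral>x. k x + h / s\<^sup>2 * (k x * (x \<bullet> v)) - h\<^sup>2 * ((norm v)\<^sup>2 / (2 * s\<^sup>2)) * k x \<partial>?N) \<le> (\<integral>x. exp (?u x) * k x \<partial>?N)"
    proof (rule integral_mono[OF _ ie])
      show "integrable ?N (\<lambda>x. k x + h / s\<^sup>2 * (k x * (x \<bullet> v)) - h\<^sup>2 * ((norm v)\<^sup>2 / (2 * s\<^sup>2)) * k x)"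
        using int0 by auto
      fix x
      have "(1 + ?u x) * k x \<le> exp (?u x) * k x"
        by (intro mult_right_mono exp_ge_add_one_self pos)
      moreover have "(1 + ?u x) * k x = k x + h / s\<^sup>2 * (k x * (x \<bullet> v)) - h\<^sup>2 * ((norm v)\<^sup>2 / (2 * s\<^sup>2)) * k x"
        by (simp add: algebra_simps power_mult_distrib)
      ultimately show "k x + h / s\<^sup>2 * (k x * (x \<bullet> v)) - h\<^sup>2 * ((norm v)\<^sup>2 / (2 * s\<^sup>2)) * k x \<le> exp (?u x) * k x" by simp
    qed
    moreover have "(\<integral>x. k x + h / s\<^sup>2 * (k x * (x \<bullet> v)) - h\<^sup>2 * ((norm v)\<^sup>2 / (2 * s\<^sup>2)) * k x \<partial>?N) = a + h / s\<^sup>2 * c - h\<^sup>2 * e"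
      using int0 by (simp add: a_def c_def e_def)
    moreover have "(\<integral>x. k (h *\<^sub>R v + x) \<partial>?N) \<le> (\<integral>x. (1 - h) * k x + h * k (v + x) \<partial>?N)"
    proof (rule integral_mono[OF int(1)])
      show "integrable ?N (\<lambda>x. (1 - h) * k x + h * k (v + x))" using int0 int(1) by auto
      fix x
      have "k ((1 - h) *\<^sub>R x + h *\<^sub>R (v + x)) \<le> (1 - h) * k x + h * k (v + x)"
        using conv h by (intro convex_onD) auto
      then show "k (h *\<^sub>R v + x) \<le> (1 - h) * k x + h * k (v + x)" by (simp add: algebra_simps)
    qed
    moreover have "(\<integral>x. (1 - h) * k x + h * k (v + x) \<partial>?N) = (1 - h) * a + h * b"
      using int0 int(1) by (simp add: a_def b_def)
    ultimately have "h * (c / s\<^sup>2) \<le> h * (b - a + h * e)"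
      by (simp add: algebra_simps power2_eq_square)
    then show ?thesis using h by (simp only: mult_le_cancel_left_pos)
  qed
  have "c / s\<^sup>2 \<le> b - a + d" if d: "d > 0" for d
  proof -
    define h where "h = min 1 (d / (e + 1))"
    have "h > 0" "h \<le> 1" using d e by (auto simp: h_def)
    moreover have "h * e \<le> d"
    proof -
      have "h * e \<le> d / (e + 1) * e" using e by (intro mult_right_mono) (auto simp: h_def)
      also have "\<dots> \<le> d" using e d by (simp add: field_simps)
      finally show ?thesis .
    qed
    ultimately show ?thesis using *[of h] by linarith
  qed
  then have "c / s\<^sup>2 \<le> b - a" by (rule field_le_epsilon)
  then show ?thesis unfolding a_def[symmetric] b_def[symmetric] c_def[symmetric]
    using s by (simp add: field_simps)
qed

text \<open>The extension is the infimal convolution of \<open>f\<close> on \<open>C\<close> with \<open>K\<close> times the norm. It coincides with \<open>f\<close> on \<open>C\<close> by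
the Lipschitz condition, it inherits the lower bound of \<open>f\<close>, and it is convex because a convex combination of
minimizers lies in \<open>C\<close>.\<close>

lemma lipschitz_convex_extension:
  fixes f :: "'a::euclidean_space \<Rightarrow> real"
  assumes C: "compact C" "convex C" "C \<noteq> {}" and conv: "convex_on C f" and lip: "K-lipschitz_on C f"
    and low: "\<And>x. x \<in> C \<Longrightarrow> m \<le> f x"
  obtains F where "convex_on UNIV F" "K-lipschitz_on UNIV F" "\<And>x. x \<in> C \<Longrightarrow> F x = f x" "\<And>x. m \<le> F x"
proof -
  have K: "K \<ge> 0" using lip by (rule lipschitz_on_nonneg)
  have "\<exists>z\<in>C. \<forall>w\<in>C. f z + K * dist x z \<le> f w + K * dist x w" for x
    by (rule continuous_attains_inf) (use C in \<open>auto intro!: continuous_intros lipschitz_on_continuous_on[OF lip]\<close>)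
  then obtain z where z: "\<And>x. z x \<in> C" "\<And>x w. w \<in> C \<Longrightarrow> f (z x) + K * dist x (z x) \<le> f w + K * dist x w"
    by metis
  define F where "F x = f (z x) + K * dist x (z x)" for x
  have F: "F x \<le> f w + K * dist x w" if "w \<in> C" for x w using z(2)[OF that] by (simp add: F_def)
  have eq: "F x = f x" if "x \<in> C" for x
  proof (rule antisym)
    show "F x \<le> f x" using F[OF that, of x] by simp
    show "f x \<le> F x"
      using lipschitz_real_bound[OF lip that z(1)[of x]] by (simp add: F_def dist_norm)
  qed
  have le: "F x \<le> F y + K * dist x y" for x y
  proof -
    have "F x \<le> f (z y) + K * dist x (z y)" by (rule F[OF z(1)])
    also have "K * dist x (z y) \<le> K * (dist x y + dist y (z y))"
      by (intro mult_left_mono dist_triangle K)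
    finally show ?thesis by (simp add: F_def algebra_simps)
  qed
  have "K-lipschitz_on UNIV F"
  proof (rule lipschitz_onI)
    fix x y show "dist (F x) (F y) \<le> K * dist x y"
      using le[of x y] le[of y x] by (simp add: dist_real_def dist_commute)
  qed (rule K)
  moreover have "convex_on UNIV F"
  proof (rule convex_onI)
    fix t :: real and x y :: 'a assume t: "0 < t" "t < 1"
    let ?p = "(1 - t) *\<^sub>R x + t *\<^sub>R y" and ?w = "(1 - t) *\<^sub>R z x + t *\<^sub>R z y"
    have w: "?w \<in> C" using C(2) z(1) t by (intro convexD_alt) auto
    have 1: "F ?p \<le> f ?w + K * dist ?p ?w" by (rule F[OF w])
    have 2: "f ?w \<le> (1 - t) * f (z x) + t * f (z y)"
      using conv t z(1) by (intro convex_onD) auto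
    have 3: "dist ?p ?w \<le> (1 - t) * dist x (z x) + t * dist y (z y)"
    proof -
      have "?p - ?w = (1 - t) *\<^sub>R (x - z x) + t *\<^sub>R (y - z y)" by (simp add: algebra_simps)
      then show ?thesis unfolding dist_norm
        using norm_triangle_ineq[of "(1 - t) *\<^sub>R (x - z x)" "t *\<^sub>R (y - z y)"] t by simp
    qed
    have "(1 - t) * F x + t * F y = (1 - t) * f (z x) + t * f (z y) + K * ((1 - t) * dist x (z x) + t * dist y (z y))"
      by (simp add: F_def algebra_simps)
    then show "F ?p \<le> (1 - t) * F x + t * F y"
      using 1 2 mult_left_mono[OF 3 K] by linarith
  qed simp
  moreover have "m \<le> F x" for x using low[OF z(1)] K by (simp add: F_def add_increasing2)
  ultimately show ?thesis using eq that by blast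
qed

text \<open>The properties of a cost, as a function of the player's own action, that the regret analysis uses. Feasible actions have
norm at most \<open>R\<close>; the additional margin \<open>1\<close> leaves room for a second-order expansion at each of them. The last clause is
a derivative-free form of the Lipschitz continuity of the gradient.\<close>

definition regular_cost :: "real \<Rightarrow> real \<Rightarrow> real \<Rightarrow> real \<Rightarrow> ('a::euclidean_space \<Rightarrow> real) \<Rightarrow> bool" where
  "regular_cost R B K Q f \<longleftrightarrow>
     convex_on UNIV f \<and> K-lipschitz_on (cball 0 (R + 1)) f \<and>
     (\<forall>x\<in>cball 0 (R + 1). \<bar>f x\<bar> \<le> B) \<and>
     (\<forall>y\<in>cball 0 R. \<forall>x. norm x \<le> 1 \<longrightarrow> f (y + x) + f (y - x) \<le> 2 * f y + Q * (norm x)\<^sup>2)"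

text \<open>The Lipschitz continuity of the extension makes its Gaussian integrals finite, and its lower bound reduces it to a
nonnegative convex function by adding a constant. The second-difference bound survives the extension: for steps
longer than \<open>1\<close> the Lipschitz bound, linear in the step, is dominated by the quadratic one.\<close>

lemma regular_cost_extension:
  fixes f :: "'a::euclidean_space \<Rightarrow> real"
  assumes reg: "regular_cost R B K Q f" and R: "R \<ge> 0" and Q: "Q \<ge> 0"
  obtains F where "convex_on UNIV F" "K-lipschitz_on UNIV F" "\<And>x. x \<in> cball 0 R \<Longrightarrow> F x = f x" "\<And>x. - B \<le> F x"
    "\<And>x y. y \<in> cball 0 R \<Longrightarrow> F (y + x) + F (y - x) \<le> 2 * f y + (Q + 2 * K) * (norm x)\<^sup>2"
proof -
  let ?C = "cball (0::'a) (R + 1)"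
  have lip: "K-lipschitz_on ?C f" and cv: "convex_on UNIV f" and B: "\<And>x. x \<in> ?C \<Longrightarrow> \<bar>f x\<bar> \<le> B"
    and sec: "\<And>y x. y \<in> cball 0 R \<Longrightarrow> norm x \<le> 1 \<Longrightarrow> f (y + x) + f (y - x) \<le> 2 * f y + Q * (norm x)\<^sup>2"
    using reg by (auto simp: regular_cost_def)
  have cvC: "convex_on ?C f" using cv by (rule convex_on_subset) auto
  obtain F where F: "convex_on UNIV F" "K-lipschitz_on UNIV F" "\<And>x. x \<in> ?C \<Longrightarrow> F x = f x" "\<And>x. - B \<le> F x"
    by (rule lipschitz_convex_extension[of ?C f K "- B"])
       (use R lip B cvC in \<open>auto simp: abs_le_iff minus_le_iff\<close>)
  have K: "K \<ge> 0" using lip by (rule lipschitz_on_nonneg)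
  have "F (y + x) + F (y - x) \<le> 2 * f y + (Q + 2 * K) * (norm x)\<^sup>2" if y: "y \<in> cball 0 R" for x y
  proof (cases "norm x \<le> 1")
    case True
    have "norm (y + x) \<le> R + 1" "norm (y - x) \<le> R + 1"
      using True y norm_triangle_ineq[of y x] norm_triangle_ineq4[of y x] by auto
    then have "F (y + x) + F (y - x) \<le> 2 * f y + Q * (norm x)\<^sup>2"
      using sec[OF y True] F(3)[of "y + x"] F(3)[of "y - x"] by simp
    also have "\<dots> \<le> 2 * f y + (Q + 2 * K) * (norm x)\<^sup>2" using K by (intro add_left_mono mult_right_mono) auto
    finally show ?thesis .
  next
    case False
    then have n: "norm x \<le> (norm x)\<^sup>2" using mult_right_mono[of 1 "norm x" "norm x"] by (simp add: power2_eq_square)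
    have "F y = f y" using y by (intro F(3)) auto
    then have "F (y + x) + F (y - x) \<le> 2 * f y + 2 * K * norm x"
      using lipschitz_real_bound[OF F(2), of "y + x" y] lipschitz_real_bound[OF F(2), of "y - x" y] by simp
    also have "2 * K * norm x \<le> (Q + 2 * K) * (norm x)\<^sup>2"
      using K Q n by (intro mult_mono) auto
    finally show ?thesis by simp
  qed
  moreover have "F x = f x" if "x \<in> cball 0 R" for x using that by (intro F(3)) auto
  ultimately show ?thesis using F that by blast
qed

text \<open>The first summand accounts for the curvature of the cost under smoothing, the second one for samples that leave the action set.\<close>

definition estimate_const :: "'d::finite itself \<Rightarrow> nat \<Rightarrow> real \<Rightarrow> real \<Rightarrow> real \<Rightarrow> real" where
  "estimate_const D p R K Q = (Q + 2 * K) * moment_const D 1 + (1 + 2 * R) * K * moment_const D (Suc p)"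

lemma estimate_const_nonneg:
  "0 \<le> R \<Longrightarrow> 0 \<le> K \<Longrightarrow> 0 \<le> Q \<Longrightarrow> 0 \<le> estimate_const D p R K Q"
  by (auto simp: estimate_const_def moment_const_nonneg intro!: add_nonneg_nonneg mult_nonneg_nonneg)

text \<open>The excess of the expected payoff at the projected sample over the cost at \<open>y\<close> is controlled by the mean of the
payoff-based gradient estimate in direction \<open>\<mu> - y\<close>. For the extension \<open>F\<close> of \<open>f\<close>, without projection,
this is \<open>gaussian_correlation_le_increment\<close> for the increment from \<open>\<mu>\<close> to \<open>y\<close>, together with the symmetry of the Gaussian, which
turns the second-difference bound at \<open>y\<close> into an error of order \<open>s\<^sup>2\<close>. Replacing \<open>F\<close> by the payoff at the
projected sample matters only if the sample lies outside \<open>Y\<close>, hence at a distance more than \<open>\<rho>\<close> from \<open>\<mu>\<close>.\<close>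

lemma payoff_gradient_estimate:
  fixes f :: "real^'d::finite \<Rightarrow> real"
  assumes reg: "regular_cost R B K Q f" and R: "R \<ge> 0" and Q: "Q \<ge> 0" and s: "s > 0" and \<rho>: "\<rho> > 0"
    and Y: "closed Y" "convex Y" "Y \<subseteq> cball 0 R" and \<mu>: "cball \<mu> \<rho> \<subseteq> Y" and y: "y \<in> Y"
  shows "(\<integral>x. f (closest_point Y (\<mu> + x)) \<partial>gaussian 0 s) - f y \<le>
     (\<integral>x. f (closest_point Y (\<mu> + x)) * (x \<bullet> (\<mu> - y)) \<partial>gaussian 0 s) / s\<^sup>2 +
     estimate_const TYPE('d) p R K Q * (s\<^sup>2 + (s / \<rho>) ^ (2 * p) * (1 + s\<^sup>2 / \<rho>))"
proof -
  let ?N = "gaussian 0 s :: (real^'d) measure"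
  interpret N: prob_space ?N by (rule prob_space_gaussian[OF s])
  obtain F where F: "convex_on UNIV F" "K-lipschitz_on UNIV F" "\<And>x. x \<in> cball 0 R \<Longrightarrow> F x = f x" "\<And>x. - B \<le> F x"
    "\<And>x y. y \<in> cball 0 R \<Longrightarrow> F (y + x) + F (y - x) \<le> 2 * f y + (Q + 2 * K) * (norm x)\<^sup>2"
    using regular_cost_extension[OF reg R Q] by blast
  have K: "K \<ge> 0" using F(2) by (rule lipschitz_on_nonneg)
  have [measurable]: "F \<in> borel_measurable borel"
    by (intro borel_measurable_continuous_onI lipschitz_on_continuous_on[OF F(2)])
  have Yne: "Y \<noteq> {}" using y by auto
  have \<mu>Y: "\<mu> \<in> Y" using \<mu> \<rho> by (auto simp: subset_iff)
  let ?c = "\<lambda>x. closest_point Y (\<mu> + x)"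
  have cY: "?c x \<in> Y" for x by (rule closest_point_in_set[OF Y(1) Yne])
  have fF: "f (?c x) = F (?c x)" for x using F(3) cY Y(3) by (metis subsetD)
  have [measurable]: "(\<lambda>x. closest_point Y (\<mu> + x)) \<in> borel_measurable borel"
    by (intro borel_measurable_continuous_onI continuous_on_compose2[OF continuous_on_closest_point[OF Y(2,1) Yne]])
       (auto intro!: continuous_intros)
  let ?M1 = "moment_const TYPE('d) 1" and ?Mp = "moment_const TYPE('d) (Suc p)"
  let ?I = "\<integral>x. norm x ^ (2 * Suc p) \<partial>?N"
  have Ip: "?I \<le> ?Mp * s ^ (2 * Suc p)" by (rule gaussian_norm_moment[OF s])
  have iI: "integrable ?N (\<lambda>x. norm x ^ (2 * Suc p))" by (rule integrable_gaussian_norm_power[OF s])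
  let ?q1 = "\<lambda>x :: real^'d. norm x ^ (2 * Suc p) / \<rho> ^ (2 * p + 1)"
  let ?q2 = "\<lambda>x :: real^'d. norm x ^ (2 * Suc p) / \<rho> ^ (2 * p)"
  let ?m1 = "?Mp * s ^ (2 * Suc p) / \<rho> ^ (2 * p + 1)" and ?m2 = "?Mp * s ^ (2 * Suc p) / \<rho> ^ (2 * p)"
  let ?EF = "\<lambda>z. \<integral>x. F (z + x) \<partial>?N" and ?G = "\<integral>x. f (?c x) * (x \<bullet> (\<mu> - y)) \<partial>?N"
  \<comment> \<open>Markov's inequality in pointwise form: outside the ball of radius \<open>\<rho>\<close> any power of \<open>norm x / \<rho>\<close> is at least \<open>1\<close>.\<close>
  have close: "\<bar>f (?c x) - F (\<mu> + x)\<bar> \<le> K * ?q1 x"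
    and close2: "\<bar>f (?c x) - F (\<mu> + x)\<bar> * norm x \<le> K * ?q2 x" for x
  proof -
    have "\<bar>f (?c x) - F (\<mu> + x)\<bar> \<le> K * ?q1 x \<and>
       \<bar>f (?c x) - F (\<mu> + x)\<bar> * norm x \<le> K * ?q2 x"
    proof (cases "norm x \<le> \<rho>")
      case True
      then have "\<mu> + x \<in> Y" using \<mu> by (auto simp: subset_iff dist_norm)
      then show ?thesis unfolding fF using K \<rho> by (simp add: closest_point_self)
    next
      case False
      have "\<bar>f (?c x) - F (\<mu> + x)\<bar> \<le> K * dist (\<mu> + x) (?c x)"
        unfolding fF using lipschitz_real_bound[OF F(2), of "?c x" "\<mu> + x"] by (simp add: dist_norm norm_minus_commute)
      also have "\<dots> \<le> K * dist (\<mu> + x) \<mu>"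
        by (intro mult_left_mono closest_point_le Y \<mu>Y K)
      finally have 1: "\<bar>f (?c x) - F (\<mu> + x)\<bar> \<le> K * norm x" by (simp add: dist_norm)
      have q: "\<rho> ^ n \<le> norm x ^ n" for n using False \<rho> by (intro power_mono) auto
      have "norm x \<le> ?q1 x"
        using mult_left_mono[OF q[of "2 * p + 1"], of "norm x"] \<rho> by (simp add: field_simps)
      moreover have "norm x * norm x \<le> ?q2 x"
        using mult_left_mono[OF q[of "2 * p"], of "norm x * norm x"] \<rho> by (simp add: field_simps)
      ultimately show ?thesis
        using 1 mult_right_mono[OF 1, of "norm x"] mult_left_mono[OF _ K] unfolding mult.assoc
        by (blast intro: order.trans norm_ge_zero)
    qed
    then show "\<bar>f (?c x) - F (\<mu> + x)\<bar> \<le> K * ?q1 x"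
      "\<bar>f (?c x) - F (\<mu> + x)\<bar> * norm x \<le> K * ?q2 x" by auto
  qed
  note iF = gaussian_lipschitz_integrable[OF s F(2)]
  have clip: "\<bar>f (?c x)\<bar> \<le> B" for x
    using reg cY[of x] Y(3) by (auto simp: regular_cost_def subset_iff intro!: order.trans[of _ R "R + 1"])
  have B0: "0 \<le> B" using clip[of 0] by linarith
  have if1: "integrable ?N (\<lambda>x. f (?c x))"
  proof (rule N.integrable_const_bound[of _ B])
    show "(\<lambda>x. f (?c x)) \<in> borel_measurable ?N" by (simp add: fF)
  qed (use clip in auto)
  have if2: "integrable ?N (\<lambda>x. f (?c x) * (x \<bullet> (\<mu> - y)))"
  proof -
    have "integrable ?N (\<lambda>x. norm x * norm (\<mu> - y) * B)"
      using integrable_gaussian_quadratic[OF s, of norm 1 1] linear_le_quadratic by auto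
    then show ?thesis
    proof (rule Bochner_Integration.integrable_bound)
      show "AE x in ?N. norm (f (?c x) * (x \<bullet> (\<mu> - y))) \<le> norm (norm x * norm (\<mu> - y) * B)"
      proof (rule AE_I2)
        fix x
        have "\<bar>x \<bullet> (\<mu> - y)\<bar> * \<bar>f (?c x)\<bar> \<le> (norm x * norm (\<mu> - y)) * B"
          by (intro mult_mono Cauchy_Schwarz_ineq2 clip) auto
        then show "norm (f (?c x) * (x \<bullet> (\<mu> - y))) \<le> norm (norm x * norm (\<mu> - y) * B)"
          using B0 by (simp add: abs_mult mult.commute)
      qed
    qed (simp add: fF)
  qed
  have A: "(\<integral>x. f (?c x) \<partial>?N) \<le> ?EF \<mu> + K * ?m1"
  proof -
    have "(\<integral>x. f (?c x) \<partial>?N) \<le> (\<integral>x. F (\<mu> + x) + K * ?q1 x \<partial>?N)"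
    proof (intro integral_mono if1)
      show "integrable ?N (\<lambda>x. F (\<mu> + x) + K * ?q1 x)" using iF(1) iI by simp
      show "f (?c x) \<le> F (\<mu> + x) + K * ?q1 x" for x using close[of x] by linarith
    qed
    also have "\<dots> = ?EF \<mu> + K * (?I / \<rho> ^ (2 * p + 1))" using iF(1) iI by simp
    also have "\<dots> \<le> ?EF \<mu> + K * ?m1"
      using Ip \<rho> K by (intro add_left_mono mult_left_mono divide_right_mono) auto
    finally show ?thesis .
  qed
  have D: "norm (\<mu> - y) \<le> 2 * R"
  proof -
    have "norm \<mu> \<le> R" "norm y \<le> R" using \<mu>Y y Y(3) by auto
    then show ?thesis using norm_triangle_ineq4[of \<mu> y] by linarith
  qed
  have Bb: "(\<integral>x. F (\<mu> + x) * (x \<bullet> (\<mu> - y)) \<partial>?N) \<le> ?G + 2 * R * (K * ?m2)"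
  proof -
    have "(\<integral>x. F (\<mu> + x) * (x \<bullet> (\<mu> - y)) \<partial>?N) \<le> (\<integral>x. f (?c x) * (x \<bullet> (\<mu> - y)) + 2 * R * (K * ?q2 x) \<partial>?N)"
    proof (intro integral_mono iF)
      show "integrable ?N (\<lambda>x. f (?c x) * (x \<bullet> (\<mu> - y)) + 2 * R * (K * ?q2 x))" using if2 iI by simp
      fix x
      have "\<bar>F (\<mu> + x) * (x \<bullet> (\<mu> - y)) - f (?c x) * (x \<bullet> (\<mu> - y))\<bar> = \<bar>f (?c x) - F (\<mu> + x)\<bar> * \<bar>x \<bullet> (\<mu> - y)\<bar>"
        by (simp add: abs_mult[symmetric] left_diff_distrib[symmetric] abs_minus_commute)
      also have "\<dots> \<le> \<bar>f (?c x) - F (\<mu> + x)\<bar> * (norm x * (2 * R))"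
        by (intro mult_left_mono order.trans[OF Cauchy_Schwarz_ineq2] D) auto
      also have "\<dots> \<le> 2 * R * (K * ?q2 x)"
        using mult_left_mono[OF close2[of x], of "2 * R"] R by (simp add: mult_ac)
      finally show "F (\<mu> + x) * (x \<bullet> (\<mu> - y)) \<le> f (?c x) * (x \<bullet> (\<mu> - y)) + 2 * R * (K * ?q2 x)"
        by linarith
    qed
    also have "\<dots> = ?G + 2 * R * (K * (?I / \<rho> ^ (2 * p)))" using if2 iI by simp
    also have "\<dots> \<le> ?G + 2 * R * (K * ?m2)"
      using Ip \<rho> K R by (intro add_left_mono mult_left_mono divide_right_mono) auto
    finally show ?thesis .
  qed
  have S: "(\<integral>x. F (\<mu> + x) * (x \<bullet> (y - \<mu>)) \<partial>?N) \<le> s\<^sup>2 * (?EF y - ?EF \<mu>)"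
  proof -
    let ?k = "\<lambda>x. F (\<mu> + x) + B"
    have "K-lipschitz_on UNIV ?k"
    proof (rule lipschitz_onI)
      fix x z show "dist (?k x) (?k z) \<le> K * dist x z"
        using lipschitz_onD[OF F(2), of "\<mu> + x" "\<mu> + z"] by simp
    qed (rule K)
    moreover have "convex_on UNIV ?k"
    proof (rule convex_onI)
      fix t :: real and x y :: "real^'d" assume t: "0 < t" "t < 1"
      have "F ((1 - t) *\<^sub>R (\<mu> + x) + t *\<^sub>R (\<mu> + y)) \<le> (1 - t) * F (\<mu> + x) + t * F (\<mu> + y)"
        using F(1) t by (intro convex_onD) auto
      then show "?k ((1 - t) *\<^sub>R x + t *\<^sub>R y) \<le> (1 - t) * ?k x + t * ?k y"
        by (simp add: algebra_simps)
    qed simp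
    moreover have "0 \<le> ?k x" for x using F(4)[of "\<mu> + x"] by simp
    ultimately have "(\<integral>x. ?k x * (x \<bullet> (y - \<mu>)) \<partial>?N) \<le> s\<^sup>2 * ((\<integral>x. ?k (y - \<mu> + x) \<partial>?N) - (\<integral>x. ?k x \<partial>?N))"
      by (rule gaussian_correlation_le_increment[OF s])
    moreover have "(\<integral>x. ?k x * (x \<bullet> (y - \<mu>)) \<partial>?N) = (\<integral>x. F (\<mu> + x) * (x \<bullet> (y - \<mu>)) \<partial>?N)"
    proof -
      have i: "integrable ?N (\<lambda>x. x \<bullet> (y - \<mu>))"
        using iF(2) gaussian_lipschitz_integrable(2)[OF s lipschitz_on_constant[of UNIV "1::real"], where v = "y - \<mu>"] by simp
      have "(\<integral>x. ?k x * (x \<bullet> (y - \<mu>)) \<partial>?N) = (\<integral>x. F (\<mu> + x) * (x \<bullet> (y - \<mu>)) + B * (x \<bullet> (y - \<mu>)) \<partial>?N)"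
        by (simp add: algebra_simps)
      also have "\<dots> = (\<integral>x. F (\<mu> + x) * (x \<bullet> (y - \<mu>)) \<partial>?N)"
        using iF(2) i by (simp add: integral_gaussian_inner_zero)
      finally show ?thesis .
    qed
    moreover have "(\<integral>x. ?k (y - \<mu> + x) \<partial>?N) = ?EF y + B"
      using iF(1)[of y] N.prob_space by (simp add: algebra_simps)
    moreover have "(\<integral>x. ?k x \<partial>?N) = ?EF \<mu> + B"
      using iF(1)[of \<mu>] N.prob_space by simp
    ultimately show ?thesis by simp
  qed
  have yR: "y \<in> cball 0 R" using y Y(3) by auto
  have U: "?EF y \<le> f y + (Q + 2 * K) * (?M1 * s\<^sup>2)"
  proof -
    have i2: "integrable ?N (\<lambda>x. (norm x)\<^sup>2)" using integrable_gaussian_norm_power[OF s, of 1, where 'd='d] by simp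
    have iFm: "integrable ?N (\<lambda>x. F (y - x))"
    proof -
      have "K-lipschitz_on UNIV (\<lambda>x. F (- x))"
      proof (rule lipschitz_onI)
        fix x z show "dist (F (- x)) (F (- z)) \<le> K * dist x z"
          using lipschitz_onD[OF F(2), of "- x" "- z"] by (simp add: dist_norm norm_minus_commute)
      qed (rule K)
      from gaussian_lipschitz_integrable(1)[OF s this, of "- y"] show ?thesis by simp
    qed
    have "2 * ?EF y = ?EF y + (\<integral>x. F (y - x) \<partial>?N)"
      using integral_gaussian_uminus[of "\<lambda>x. F (y + x)" s] by simp
    also have "\<dots> = (\<integral>x. F (y + x) + F (y - x) \<partial>?N)" using iF(1) iFm by simp
    also have "\<dots> \<le> (\<integral>x. 2 * f y + (Q + 2 * K) * (norm x)\<^sup>2 \<partial>?N)"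
      using iF(1) iFm i2 F(5)[OF yR] by (intro integral_mono) auto
    also have "\<dots> = 2 * f y + (Q + 2 * K) * (\<integral>x. (norm x)\<^sup>2 \<partial>?N)"
      using i2 N.prob_space by simp
    also have "(\<integral>x. (norm x)\<^sup>2 \<partial>?N) \<le> ?M1 * s\<^sup>2"
      using gaussian_norm_moment[OF s, of 1, where 'd='d] by simp
    finally have "2 * ?EF y \<le> 2 * f y + (Q + 2 * K) * (?M1 * s\<^sup>2)"
      using Q K by (simp add: mult_left_mono)
    moreover have "(Q + 2 * K) * (?M1 * s\<^sup>2) \<ge> 0" using Q K by (simp add: moment_const_nonneg)
    ultimately show ?thesis by linarith
  qed
  let ?r = "(s / \<rho>) ^ (2 * p)"
  have e1: "?m1 = ?Mp * (?r * (s\<^sup>2 / \<rho>))"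
    using \<rho> by (simp add: power_divide power2_eq_square field_simps)
  have e2: "?m2 = s\<^sup>2 * (?Mp * ?r)"
    using \<rho> by (simp add: power_divide power2_eq_square field_simps)
  have neg: "(\<integral>x. F (\<mu> + x) * (x \<bullet> (y - \<mu>)) \<partial>?N) = - (\<integral>x. F (\<mu> + x) * (x \<bullet> (\<mu> - y)) \<partial>?N)"
    unfolding integral_minus[symmetric] by (intro Bochner_Integration.integral_cong) (auto simp: algebra_simps inner_diff_right)
  have "s\<^sup>2 * (?EF \<mu> - ?EF y) \<le> ?G + 2 * R * (K * (s\<^sup>2 * (?Mp * ?r)))"
    using S Bb unfolding neg e2 by (simp add: algebra_simps)
  then have "?EF \<mu> - ?EF y \<le> ?G / s\<^sup>2 + 2 * R * (K * (?Mp * ?r))"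
    using s by (simp add: field_simps)
  with A U have "(\<integral>x. f (?c x) \<partial>?N) - f y \<le> ?G / s\<^sup>2 + ((Q + 2 * K) * (?M1 * s\<^sup>2) + K * (?Mp * (?r * (s\<^sup>2 / \<rho>))) + 2 * R * (K * (?Mp * ?r)))"
    unfolding e1 by linarith
  also have "(Q + 2 * K) * (?M1 * s\<^sup>2) + K * (?Mp * (?r * (s\<^sup>2 / \<rho>))) + 2 * R * (K * (?Mp * ?r)) \<le>
     estimate_const TYPE('d) p R K Q * (s\<^sup>2 + ?r * (1 + s\<^sup>2 / \<rho>))"
  proof -
    define P S where "P = K * ?Mp" and "S = (Q + 2 * K) * ?M1"
    have PS: "P \<ge> 0" "S \<ge> 0" using K Q by (auto simp: P_def S_def moment_const_nonneg)
    have r: "?r \<ge> 0" "s\<^sup>2 / \<rho> \<ge> 0" using s \<rho> by auto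
    have "estimate_const TYPE('d) p R K Q * (s\<^sup>2 + ?r * (1 + s\<^sup>2 / \<rho>)) - (S * s\<^sup>2 + P * (?r * (s\<^sup>2 / \<rho>)) + 2 * R * (P * ?r)) =
      S * (?r * (1 + s\<^sup>2 / \<rho>)) + (1 + 2 * R) * P * s\<^sup>2 + P * ?r + 2 * R * P * (?r * (s\<^sup>2 / \<rho>))"
      unfolding estimate_const_def P_def S_def by (simp add: algebra_simps add_divide_distrib)
    also have "\<dots> \<ge> 0" using PS r R by (intro add_nonneg_nonneg mult_nonneg_nonneg) auto
    finally show ?thesis unfolding P_def S_def by (simp add: mult_ac)
  qed
  finally show ?thesis by simp
qed


section \<open>Sampling conditionally on the past\<close>

lemma
  shows space_generated [simp]: "space (generated P XX) = space P"
    and sets_generated: "sets (generated P XX) = sigma_sets (space P) {X -` B \<inter> space P |X B. X \<in> XX \<and> B \<in> sets borel}"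
  by (simp_all add: generated_def space_measure_of_conv sets_measure_of_conv) (auto simp: sets_measure_of_conv)

lemma measurable_generated: "X \<in> XX \<Longrightarrow> X \<in> borel_measurable (generated P XX)"
  by (rule measurableI) (auto simp: sets_generated intro!: sigma_sets.Basic)

lemma subalgebra_generated:
  assumes "\<And>X. X \<in> XX \<Longrightarrow> X \<in> borel_measurable P"
  shows "subalgebra P (generated P XX)"
proof -
  have "sigma_sets (space P) {X -` B \<inter> space P |X B. X \<in> XX \<and> B \<in> sets borel} \<subseteq> sets P"
    by (rule sets.sigma_sets_subset) (auto intro: measurable_sets assms)
  then show ?thesis by (simp add: subalgebra_def sets_generated)
qed

lemma subalgebra_generated_mono: "XX \<subseteq> YY \<Longrightarrow> subalgebra (generated P YY) (generated P XX)"
  by (auto simp: subalgebra_def sets_generated intro!: sigma_sets_mono')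

lemma shifted_indicator_measurable:
  fixes B :: "(real^'d::finite) set"
  assumes [measurable]: "B \<in> sets borel"
  shows "(\<lambda>x. indicator B (c + x) :: ennreal) \<in> borel_measurable (gaussian 0 s)"
  by measurable

text \<open>In other words, the centred sample is independent of the information \<open>F\<close>. Both sides are determined by their values
on rectangles, and on a rectangle the conditional law of \<open>X\<close> gives the value; to be able to use it, the laws are
first compared before centring.\<close>

lemma cond_gaussian_product_law:
  fixes X m :: "'w \<Rightarrow> real^'d::finite"
  assumes P: "prob_space P" and sub: "subalgebra P F" and cg: "cond_gaussian P F X m s"
    and m[measurable]: "m \<in> borel_measurable F" and s: "s > 0"
  shows "distr P (F \<Otimes>\<^sub>M borel) (\<lambda>w. (w, X w - m w)) = restr_to_subalg P F \<Otimes>\<^sub>M gaussian 0 s"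
proof -
  interpret prob_space P by (rule P)
  let ?L = "restr_to_subalg P F" and ?G = "gaussian 0 s :: (real^'d) measure"
  interpret L: prob_space ?L by (rule prob_space_restr_to_subalg[OF sub P])
  interpret G: prob_space ?G by (rule prob_space_gaussian[OF s])
  interpret LG: pair_prob_space ?L ?G ..
  interpret FS: finite_measure_subalgebra P F by standard (rule sub)
  have [measurable_cong]: "sets ?L = sets F" by (rule sets_restr_to_subalg[OF sub])
  have spF: "space F = space P" using sub by (simp add: subalgebra_def)
  have X[measurable]: "X \<in> borel_measurable P" using cg by (simp add: cond_gaussian_def)
  have id[measurable]: "(\<lambda>w. w) \<in> measurable P F" using sub by (rule measurable_from_subalg) simp
  have mP[measurable]: "m \<in> borel_measurable P" by (rule measurable_from_subalg[OF sub m])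
  let ?Q1 = "distr P (F \<Otimes>\<^sub>M borel) (\<lambda>w. (w, X w))"
  let ?Q2 = "distr (?L \<Otimes>\<^sub>M ?G) (F \<Otimes>\<^sub>M borel) (\<lambda>(w, x). (w, m w + x))"
  let ?E = "{a \<times> b |a b. a \<in> sets F \<and> b \<in> sets (borel :: (real^'d) measure)}"
  have Q2m[measurable]: "(\<lambda>(w, x). (w, m w + x)) \<in> measurable (?L \<Otimes>\<^sub>M ?G) (F \<Otimes>\<^sub>M borel)" by measurable
  have Q: "?Q1 = ?Q2"
  proof (rule measure_eqI_generator_eq[where \<Omega> = "space F \<times> UNIV" and E = ?E and A = "\<lambda>_. space F \<times> UNIV"])
    show "Int_stable ?E" by (rule Int_stable_pair_measure_generator)
    show "?E \<subseteq> Pow (space F \<times> UNIV)" using sets.sets_into_space[of _ F] by auto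
    fix Z assume "Z \<in> ?E"
    then obtain A B where Z: "Z = A \<times> B" and A[measurable]: "A \<in> sets F" and B[measurable]: "B \<in> sets borel" by auto
    have A'[measurable]: "A \<in> sets P" using A sub by (auto simp: subalgebra_def)
    let ?g = "\<lambda>w. measure (gaussian (m w) s) B"
    have Zs: "Z \<in> sets (F \<Otimes>\<^sub>M borel)" unfolding Z by (rule pair_measureI[OF A B])
    have g_eq: "emeasure (gaussian (m w) s) B = (\<integral>\<^sup>+x. indicator B (m w + x) \<partial>?G)" for w
      by (subst gaussian_eq_distr, subst nn_integral_distr[symmetric, of "(+) (m w)" _ borel "indicator B"]) auto
    have g_real: "ennreal (?g w) = emeasure (gaussian (m w) s) B" for w
      by (simp add: finite_measure.emeasure_eq_measure[OF prob_space.axioms(1)[OF prob_space_gaussian[OF s]]])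
    have gF[measurable]: "?g \<in> borel_measurable F"
    proof -
      have "(\<lambda>w. \<integral>\<^sup>+x. indicator B (m w + x) \<partial>?G) \<in> borel_measurable F" by measurable
      then have "(\<lambda>w. enn2real (emeasure (gaussian (m w) s) B)) \<in> borel_measurable F"
        unfolding g_eq by measurable
      then show ?thesis by (simp add: measure_def)
    qed
    have gP: "?g \<in> borel_measurable P" by (rule measurable_from_subalg[OF sub gF])
    have "emeasure ?Q1 Z = emeasure P {w \<in> space P. w \<in> A \<and> X w \<in> B}"
      unfolding Z by (subst emeasure_distr) (auto intro!: arg_cong2[where f = emeasure])
    also have "\<dots> = ennreal (\<integral>w\<in>A. indicator B (X w) \<partial>P)"
    proof -
      have "(\<integral>w\<in>A. indicator B (X w) \<partial>P) = (\<integral>w. indicator {w \<in> space P. w \<in> A \<and> X w \<in> B} w \<partial>P)"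
        unfolding set_lebesgue_integral_def by (intro Bochner_Integration.integral_cong) (auto simp: indicator_def)
      also have "\<dots> = measure P {w \<in> space P. w \<in> A \<and> X w \<in> B}" by simp
      finally show ?thesis by (simp add: emeasure_eq_measure)
    qed
    also have "(\<integral>w\<in>A. indicator B (X w) \<partial>P) = (\<integral>w\<in>A. real_cond_exp P F (\<lambda>v. indicator B (X v)) w \<partial>P)"
      by (rule FS.real_cond_exp_intA[OF _ A]) (auto intro!: integrable_const_bound[of _ 1])
    also have "\<dots> = (\<integral>w\<in>A. ?g w \<partial>P)"
    proof (rule set_lebesgue_integral_cong_AE)
      have "AE w in P. real_cond_exp P F (\<lambda>v. indicator B (X v)) w = ?g w"
        using cg B by (simp add: cond_gaussian_def)
      then show "AE w\<in>A in P. real_cond_exp P F (\<lambda>v. indicator B (X v)) w = ?g w" by auto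
    qed (use gP in auto)
    also have "ennreal \<dots> = (\<integral>\<^sup>+w. indicator A w * ennreal (?g w) \<partial>P)"
    proof -
      have "integrable P (\<lambda>w. indicator A w * ?g w)"
        using gP by (intro integrable_const_bound[of _ 1])
          (auto simp: indicator_def prob_space.prob_le_1[OF prob_space_gaussian[OF s]])
      then show ?thesis
        unfolding set_lebesgue_integral_def real_scaleR_def
        by (subst nn_integral_eq_integral[symmetric]) (auto simp: ennreal_mult' indicator_def intro!: nn_integral_cong)
    qed
    also have "\<dots> = (\<integral>\<^sup>+w. indicator A w * ennreal (?g w) \<partial>?L)"
      by (rule nn_integral_subalgebra2[symmetric, OF sub]) measurable
    finally have lhs: "emeasure ?Q1 Z = (\<integral>\<^sup>+w. indicator A w * ennreal (?g w) \<partial>?L)" .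
    have "(\<integral>\<^sup>+w. indicator A w * ennreal (?g w) \<partial>?L) = (\<integral>\<^sup>+w. \<integral>\<^sup>+x. indicator Z (w, m w + x) \<partial>?G \<partial>?L)"
    proof (rule nn_integral_cong)
      fix w
      show "indicator A w * ennreal (?g w) = (\<integral>\<^sup>+x. indicator Z (w, m w + x) \<partial>?G)"
        unfolding g_real g_eq Z indicator_times fst_conv snd_conv
        by (rule nn_integral_cmult[OF shifted_indicator_measurable[OF B], symmetric])
    qed
    also have "\<dots> = (\<integral>\<^sup>+z. indicator Z ((\<lambda>(w, x). (w, m w + x)) z) \<partial>(?L \<Otimes>\<^sub>M ?G))"
      using G.nn_integral_fst[OF measurable_compose[OF Q2m borel_measurable_indicator[OF Zs]]] by simp
    also have "\<dots> = emeasure ?Q2 Z"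
      by (subst nn_integral_distr[OF Q2m, symmetric]) (simp_all add: Zs borel_measurable_indicator[OF Zs])
    finally show "emeasure ?Q1 Z = emeasure ?Q2 Z" unfolding lhs .
  next
    show "sets ?Q1 = sigma_sets (space F \<times> UNIV) ?E" "sets ?Q2 = sigma_sets (space F \<times> UNIV) ?E"
      by (simp_all add: sets_pair_measure)
    show "range (\<lambda>_::nat. space F \<times> UNIV) \<subseteq> ?E"
    proof -
      have "space F \<times> UNIV \<in> ?E"
        by (rule CollectI, rule exI[of _ "space F"], rule exI[of _ UNIV]) simp
      then show ?thesis by auto
    qed
    show "(\<Union>i::nat. space F \<times> UNIV) = space F \<times> UNIV" by simp
    have Q1: "prob_space ?Q1" by (rule prob_space_distr) measurable
    show "emeasure ?Q1 (space F \<times> UNIV) \<noteq> \<infinity>"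
      using finite_measure.emeasure_finite[OF prob_space.axioms(1)[OF Q1]] by simp
  qed
  let ?T = "\<lambda>(w, x). (w, x - m w)"
  have T[measurable]: "?T \<in> measurable (F \<Otimes>\<^sub>M borel) (F \<Otimes>\<^sub>M borel)" by measurable
  have "distr P (F \<Otimes>\<^sub>M borel) (\<lambda>w. (w, X w - m w)) = distr ?Q1 (F \<Otimes>\<^sub>M borel) ?T"
    by (subst distr_distr) (auto simp: comp_def)
  also have "\<dots> = distr ?Q2 (F \<Otimes>\<^sub>M borel) ?T" unfolding Q ..
  also have "\<dots> = distr (?L \<Otimes>\<^sub>M ?G) (F \<Otimes>\<^sub>M borel) (\<lambda>z. z)"
    by (subst distr_distr) (auto simp: comp_def case_prod_unfold)
  also have "\<dots> = ?L \<Otimes>\<^sub>M ?G"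
    by (rule distr_id2) (rule sets_pair_measure_cong[OF sets_restr_to_subalg[OF sub] sets_gaussian, symmetric])
  finally show ?thesis .
qed

text \<open>Given the information, the expectation of a function of the sample is computed by integrating over the noise with everything
that is known frozen. This is what allows the opponents to be arbitrary.\<close>

lemma cond_gaussian_expectation:
  fixes X m :: "'w \<Rightarrow> real^'d::finite" and h :: "'w \<times> (real^'d) \<Rightarrow> real"
  assumes P: "prob_space P" and sub: "subalgebra P F" and cg: "cond_gaussian P F X m s"
    and m: "m \<in> borel_measurable F" and s: "s > 0"
    and h[measurable]: "h \<in> borel_measurable (F \<Otimes>\<^sub>M borel)" and int: "integrable P (\<lambda>w. h (w, X w - m w))"
  shows "(\<integral>w. h (w, X w - m w) \<partial>P) = (\<integral>w. \<integral>x. h (w, x) \<partial>gaussian 0 s \<partial>P)"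
    and "integrable P (\<lambda>w. \<integral>x. h (w, x) \<partial>gaussian 0 s)"
proof -
  interpret prob_space P by (rule P)
  let ?L = "restr_to_subalg P F" and ?G = "gaussian 0 s :: (real^'d) measure"
  interpret L: prob_space ?L by (rule prob_space_restr_to_subalg[OF sub P])
  interpret G: prob_space ?G by (rule prob_space_gaussian[OF s])
  interpret LG: pair_prob_space ?L ?G ..
  have [measurable]: "X \<in> borel_measurable P" using cg by (simp add: cond_gaussian_def)
  have [measurable]: "(\<lambda>w. w) \<in> measurable P F" using sub by (rule measurable_from_subalg) simp
  have [measurable]: "m \<in> borel_measurable P" by (rule measurable_from_subalg[OF sub m])
  have T: "(\<lambda>w. (w, X w - m w)) \<in> measurable P (F \<Otimes>\<^sub>M borel)" by measurable
  note law = cond_gaussian_product_law[OF P sub cg m s]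
  have i: "integrable (?L \<Otimes>\<^sub>M ?G) h"
    unfolding law[symmetric] using int by (subst integrable_distr_eq[OF T]) auto
  have "(\<integral>w. h (w, X w - m w) \<partial>P) = integral\<^sup>L (?L \<Otimes>\<^sub>M ?G) h"
    unfolding law[symmetric] by (subst integral_distr[OF T]) auto
  also have "\<dots> = (\<integral>w. \<integral>x. h (w, x) \<partial>?G \<partial>?L)"
    using LG.integral_fst'[OF i] by simp
  also have "\<dots> = (\<integral>w. \<integral>x. h (w, x) \<partial>?G \<partial>P)"
    by (rule integral_subalgebra2[OF sub]) measurable
  finally show "(\<integral>w. h (w, X w - m w) \<partial>P) = (\<integral>w. \<integral>x. h (w, x) \<partial>gaussian 0 s \<partial>P)" .
  show "integrable P (\<lambda>w. \<integral>x. h (w, x) \<partial>gaussian 0 s)"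
    by (rule integrable_from_subalg[OF sub LG.integrable_fst'[OF i]])
qed

lemma cond_gaussian_increment_law:
  fixes X m :: "'w \<Rightarrow> real^'d::finite"
  assumes P: "prob_space P" and sub: "subalgebra P F" and cg: "cond_gaussian P F X m s"
    and m: "m \<in> borel_measurable F" and s: "s > 0"
  shows "distr P borel (\<lambda>w. X w - m w) = gaussian 0 s"
proof -
  let ?L = "restr_to_subalg P F" and ?G = "gaussian 0 s :: (real^'d) measure"
  interpret L: prob_space ?L by (rule prob_space_restr_to_subalg[OF sub P])
  interpret G: prob_space ?G by (rule prob_space_gaussian[OF s])
  have [measurable]: "X \<in> borel_measurable P" using cg by (simp add: cond_gaussian_def)
  have [measurable]: "(\<lambda>w. w) \<in> measurable P F" using sub by (rule measurable_from_subalg) simp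
  have [measurable]: "m \<in> borel_measurable P" by (rule measurable_from_subalg[OF sub m])
  have sndm[measurable]: "snd \<in> borel_measurable (?L \<Otimes>\<^sub>M ?G)"
    by (subst measurable_cong_sets[OF refl sets_gaussian[symmetric], of _ 0 s]) (rule measurable_snd)
  have "distr P borel (\<lambda>w. X w - m w) = distr (distr P (F \<Otimes>\<^sub>M borel) (\<lambda>w. (w, X w - m w))) borel snd"
    by (subst distr_distr) (auto simp: comp_def)
  also have "\<dots> = distr (?L \<Otimes>\<^sub>M ?G) borel snd"
    unfolding cond_gaussian_product_law[OF assms] ..
  also have "\<dots> = ?G"
  proof (rule measure_eqI)
    fix B assume "B \<in> sets (distr (?L \<Otimes>\<^sub>M ?G) borel snd)"
    then have [measurable]: "B \<in> sets borel" by simp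
    have "emeasure (distr (?L \<Otimes>\<^sub>M ?G) borel snd) B = emeasure (?L \<Otimes>\<^sub>M ?G) (space ?L \<times> B)"
      by (subst emeasure_distr) (auto intro!: arg_cong2[where f = emeasure] simp: space_pair_measure)
    also have "\<dots> = emeasure ?L (space ?L) * emeasure ?G B"
      by (rule G.emeasure_pair_measure_Times) auto
    finally show "emeasure (distr (?L \<Otimes>\<^sub>M ?G) borel snd) B = emeasure ?G B"
      by (simp add: L.emeasure_space_1)
  qed simp
  finally show ?thesis .
qed

lemma cond_gaussian_second_moment:
  fixes X m :: "'w \<Rightarrow> real^'d::finite"
  assumes P: "prob_space P" and sub: "subalgebra P F" and cg: "cond_gaussian P F X m s"
    and m: "m \<in> borel_measurable F" and s: "s > 0"
  shows "integrable P (\<lambda>w. (norm (X w - m w))\<^sup>2)"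
    and "(\<integral>w. (norm (X w - m w))\<^sup>2 \<partial>P) \<le> moment_const TYPE('d) 1 * s\<^sup>2"
proof -
  have [measurable]: "X \<in> borel_measurable P" using cg by (simp add: cond_gaussian_def)
  have [measurable]: "m \<in> borel_measurable P" by (rule measurable_from_subalg[OF sub m])
  have T: "(\<lambda>w. X w - m w) \<in> borel_measurable P" by measurable
  note law = cond_gaussian_increment_law[OF assms]
  have "integrable (distr P borel (\<lambda>w. X w - m w)) (\<lambda>x. norm x ^ (2 * 1))"
    unfolding law by (rule integrable_gaussian_norm_power[OF s])
  then show "integrable P (\<lambda>w. (norm (X w - m w))\<^sup>2)"
    by (subst (asm) integrable_distr_eq[OF T]) auto
  have "(\<integral>x. norm x ^ (2 * 1) \<partial>distr P borel (\<lambda>w. X w - m w)) \<le> moment_const TYPE('d) 1 * s ^ (2 * 1)"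
    unfolding law by (rule gaussian_norm_moment[OF s])
  then show "(\<integral>w. (norm (X w - m w))\<^sup>2 \<partial>P) \<le> moment_const TYPE('d) 1 * s\<^sup>2"
    by (subst (asm) integral_distr[OF T]) auto
qed


section \<open>Joint actions and shrunken action sets\<close>

lemma deviate_nth [simp]: "deviate a i x $ j = (if j = i then x else a $ j)"
  by (simp add: deviate_def)

lemma deviate_deviate [simp]: "deviate (deviate a i x) i y = deviate a i y"
  by (simp add: vec_eq_iff)

lemma deviate_self [simp]: "deviate a i (a $ i) = a"
  by (simp add: vec_eq_iff)

lemma borel_measurable_profile:
  fixes f :: "'w \<Rightarrow> real^'d::finite^'n::finite"
  assumes [measurable]: "\<And>j. (\<lambda>w. f w $ j) \<in> borel_measurable M"
  shows "f \<in> borel_measurable M"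
proof (subst borel_measurable_euclidean_space, intro ballI)
  fix b :: "real^'d^'n" assume "b \<in> Basis"
  then obtain j c where b: "b = axis j c" by (auto simp: Basis_vec_def)
  show "(\<lambda>w. f w \<bullet> b) \<in> borel_measurable M" unfolding b inner_axis by measurable
qed

text \<open>The description by balls, unlike the one by the distance to the boundary, shows at once that the shrunken set is convex. If the
ball around a point of \<open>Y\<close> contained a point outside \<open>Y\<close>, then the segment between the two points would meet the boundary too early.\<close>

lemma mem_shrink_iff:
  fixes Y :: "(real^'d::finite) set"
  assumes Y: "compact Y" and \<rho>: "\<rho> > 0"
  shows "x \<in> shrink \<rho> Y \<longleftrightarrow> cball x \<rho> \<subseteq> Y"
proof
  assume x: "x \<in> shrink \<rho> Y"
  then have xY: "x \<in> Y" and d: "\<rho> \<le> infdist x (frontier Y)" by (auto simp: shrink_def)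
  show "cball x \<rho> \<subseteq> Y"
  proof (rule subsetI, rule ccontr)
    fix z assume z: "z \<in> cball x \<rho>" "z \<notin> Y"
    have "closed_segment x z \<inter> frontier Y \<noteq> {}"
      using xY z(2) by (intro connected_Int_frontier) auto
    then obtain p where p: "p \<in> closed_segment x z" "p \<in> frontier Y" by auto
    have "p \<in> Y" using p(2) Y frontier_subset_closed compact_imp_closed by blast
    then have "p \<noteq> z" using z(2) by auto
    then have "dist x p < dist x z"
      using p(1) by (metis dist_commute dist_in_closed_segment dist_nz in_segment(2) between_mem_segment between less_add_same_cancel1)
    moreover have "infdist x (frontier Y) \<le> dist x p" using p(2) by (rule infdist_le)
    ultimately show False using d z(1) by auto
  qed
next
  assume c: "cball x \<rho> \<subseteq> Y"
  have xY: "x \<in> Y" using c \<rho> by auto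
  have ne: "frontier Y \<noteq> {}"
    using xY Y by (intro frontier_not_empty) (auto dest: compact_imp_bounded)
  have "\<rho> \<le> dist x p" if p: "p \<in> frontier Y" for p
  proof (rule ccontr)
    assume "\<not> \<rho> \<le> dist x p"
    then have "p \<in> ball x \<rho>" by simp
    moreover have "ball x \<rho> \<subseteq> interior Y" using c by (intro interior_maximal) auto
    ultimately show False using p by (auto simp: frontier_def)
  qed
  then have "\<rho> \<le> infdist x (frontier Y)"
    using ne by (auto simp: infdist_def intro!: cINF_greatest)
  then show "x \<in> shrink \<rho> Y" using xY by (simp add: shrink_def)
qed

lemma closed_shrink: "closed Y \<Longrightarrow> closed (shrink \<rho> Y)"
proof -
  assume Y: "closed Y"
  have "shrink \<rho> Y = Y \<inter> {x. \<rho> \<le> infdist x (frontier Y)}" by (auto simp: shrink_def)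
  moreover have "closed {x. \<rho> \<le> infdist x (frontier Y)}"
    by (intro closed_Collect_le continuous_intros)
  ultimately show ?thesis using Y by auto
qed

lemma convex_shrink:
  fixes Y :: "(real^'d::finite) set"
  assumes Y: "compact Y" "convex Y" and \<rho>: "\<rho> > 0"
  shows "convex (shrink \<rho> Y)"
proof (rule convexI)
  fix x y :: "real^'d" and u v :: real
  assume x: "x \<in> shrink \<rho> Y" and y: "y \<in> shrink \<rho> Y" and uv: "0 \<le> u" "0 \<le> v" "u + v = 1"
  have "cball (u *\<^sub>R x + v *\<^sub>R y) \<rho> \<subseteq> Y"
  proof
    fix z assume z: "z \<in> cball (u *\<^sub>R x + v *\<^sub>R y) \<rho>"
    define e where "e = z - (u *\<^sub>R x + v *\<^sub>R y)"
    have e: "norm e \<le> \<rho>" using z by (simp add: e_def dist_norm norm_minus_commute)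
    have "x + e \<in> Y" "y + e \<in> Y"
      using x y e unfolding mem_shrink_iff[OF Y(1) \<rho>] by (auto simp: subset_iff dist_norm)
    then have "u *\<^sub>R (x + e) + v *\<^sub>R (y + e) \<in> Y" using Y(2) uv by (auto simp: convex_def)
    moreover have "u *\<^sub>R (x + e) + v *\<^sub>R (y + e) = z"
    proof -
      have "u *\<^sub>R (x + e) + v *\<^sub>R (y + e) = u *\<^sub>R x + v *\<^sub>R y + (u + v) *\<^sub>R e" by (simp add: algebra_simps)
      then show ?thesis using uv by (simp add: e_def)
    qed
    ultimately show "z \<in> Y" by simp
  qed
  then show "u *\<^sub>R x + v *\<^sub>R y \<in> shrink \<rho> Y" unfolding mem_shrink_iff[OF Y(1) \<rho>] .
qed

section \<open>One step of the algorithm\<close>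

text \<open>The loss of one step: the second moment of the noisy gradient, the bias caused by the regularization, and the bias of the
gradient estimate. The radius \<open>\<rho>\<close> is the one used in the previous step, since this is the distance
that the current mean keeps from the boundary.\<close>

definition step_error :: "'d::finite itself \<Rightarrow> nat \<Rightarrow> real \<Rightarrow> real \<Rightarrow> real \<Rightarrow> real \<Rightarrow> real \<Rightarrow> real \<Rightarrow> real \<Rightarrow> real \<Rightarrow> real" where
  "step_error D p R B K Q \<gamma> \<sigma> \<rho> \<epsilon> =
     \<gamma> * (B\<^sup>2 * moment_const D 1 / \<sigma>\<^sup>2 + \<epsilon>\<^sup>2 * R\<^sup>2) + 2 * R\<^sup>2 * \<epsilon> +
     estimate_const D p R K Q * (\<sigma>\<^sup>2 + (\<sigma> / \<rho>) ^ (2 * p) * (1 + \<sigma>\<^sup>2 / \<rho>))"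

text \<open>A player \<open>i\<close> who runs the algorithm against arbitrary feasible opponents. The information \<open>F t\<close> contains the samples of the player before
time \<open>t\<close> and the actions of the others up to and including time \<open>t\<close>; this covers the unilateral and the collective scenario alike.\<close>

locale bandit_run = prob_space P
  for P :: "'w measure" +
  fixes F :: "nat \<Rightarrow> 'w measure" and A :: "('d::finite, 'n::finite) action_sets" and J :: "('d, 'n) costs"
    and \<gamma> \<sigma> \<rho> \<epsilon> :: "nat \<Rightarrow> real" and i :: 'n and \<mu>0 :: "real^'d"
    and \<xi> \<mu> :: "nat \<Rightarrow> 'w \<Rightarrow> real^'d" and a :: "nat \<Rightarrow> 'w \<Rightarrow> ('d, 'n) profile"
    and R B K Q :: real
  assumes F_sub: "subalgebra P (F t)"
    and F_mono: "subalgebra (F (Suc t)) (F t)"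
    and \<xi>_meas: "\<xi> t \<in> borel_measurable (F (Suc t))"
    and others_meas: "j \<noteq> i \<Longrightarrow> (\<lambda>w. a t w $ j) \<in> borel_measurable (F t)"
    and feasible: "w \<in> space P \<Longrightarrow> a t w $ j \<in> A j"
    and alg: "follows_algorithm P A J \<gamma> \<sigma> \<rho> \<epsilon> i \<mu>0 F \<xi> \<mu> a"
    and A_convex: "convex (A i)" and A_compact: "compact (A i)"
    and A_bounded: "A i \<subseteq> cball 0 R" and R_nonneg: "R \<ge> 0" and Q_nonneg: "Q \<ge> 0"
    and J_cont: "continuous_on UNIV (J i)"
    and J_regular: "(\<And>j. b $ j \<in> A j) \<Longrightarrow> regular_cost R B K Q (\<lambda>x. J i (deviate b i x))"
    and pos: "\<gamma> t > 0" "\<sigma> t > 0" "\<rho> t > 0" "\<epsilon> t > 0"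
    and shrink_nonempty: "shrink (\<rho> t) (A i) \<noteq> {}"
begin

abbreviation "mean_cost t \<equiv> \<integral>w. J i (a t w) \<partial>P"
abbreviation "mean_deviation t y \<equiv> \<integral>w. J i (deviate (a t w) i y) \<partial>P"
abbreviation "mean_distance t u \<equiv> \<integral>w. (norm (\<mu> t w - u))\<^sup>2 \<partial>P"
abbreviation "mean_gradient t u \<equiv> \<integral>w. J i (a t w) * ((\<xi> t w - \<mu> t w) \<bullet> (\<mu> t w - u)) \<partial>P"

lemma A_closed: "closed (A i)" using A_compact by (rule compact_imp_closed)

lemma A_nonempty: "A i \<noteq> {}" using shrink_nonempty by (auto simp: shrink_def)

lemma action_eq: "w \<in> space P \<Longrightarrow> a t w $ i = closest_point (A i) (\<xi> t w)"
  using alg by (simp add: follows_algorithm_def)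

lemma mean_Suc: "w \<in> space P \<Longrightarrow> \<mu> (Suc t) w =
    closest_point (shrink (\<rho> t) (A i)) (\<mu> t w - \<gamma> t *\<^sub>R ((J i (a t w) / (\<sigma> t)\<^sup>2) *\<^sub>R (\<xi> t w - \<mu> t w) + \<epsilon> t *\<^sub>R \<mu> t w))"
  using alg by (simp add: follows_algorithm_def Let_def)

lemma sample: "cond_gaussian P (F t) (\<xi> t) (\<mu> t) (\<sigma> t)"
  using alg by (simp add: follows_algorithm_def)

lemma space_F: "space (F t) = space P" using F_sub by (simp add: subalgebra_def)

lemma measurable_closest_point:
  assumes "closed S" "convex S" "S \<noteq> {}"
  shows "closest_point S \<in> borel_measurable (borel :: (real^'d) measure)"
  by (intro borel_measurable_continuous_onI continuous_on_closest_point assms)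

lemma measurable_J: "J i \<in> borel_measurable borel"
  by (intro borel_measurable_continuous_onI J_cont)

lemma action_meas_Suc: "a t \<in> borel_measurable (F (Suc t))"
proof (rule borel_measurable_profile)
  fix j
  show "(\<lambda>w. a t w $ j) \<in> borel_measurable (F (Suc t))"
  proof (cases "j = i")
    case True
    have "(\<lambda>w. closest_point (A i) (\<xi> t w)) \<in> borel_measurable (F (Suc t))"
      by (rule measurable_compose[OF \<xi>_meas measurable_closest_point[OF A_closed A_convex A_nonempty]])
    then show ?thesis unfolding True
      by (subst measurable_cong[where g = "\<lambda>w. closest_point (A i) (\<xi> t w)"]) (auto simp: space_F action_eq)
  next
    case False
    then show ?thesis by (rule measurable_from_subalg[OF F_mono others_meas])
  qed
qed

text \<open>The mean is a function of the past, so that it can be frozen together with the opponents' actions when the expectation over the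
current sample is taken.\<close>

lemma mean_meas: "\<mu> t \<in> borel_measurable (F t)"
proof (induction t)
  case 0
  have "\<mu> 0 w = \<mu>0" if "w \<in> space P" for w
    using alg that by (simp add: follows_algorithm_def)
  then show ?case by (subst measurable_cong[where g = "\<lambda>w. \<mu>0"]) (auto simp: space_F)
next
  case (Suc t)
  have [measurable]: "\<mu> t \<in> borel_measurable (F (Suc t))" by (rule measurable_from_subalg[OF F_mono Suc])
  note [measurable] = \<xi>_meas[of t] action_meas_Suc[of t] measurable_J
  have "(\<lambda>w. closest_point (shrink (\<rho> t) (A i)) (\<mu> t w - \<gamma> t *\<^sub>R ((J i (a t w) / (\<sigma> t)\<^sup>2) *\<^sub>R (\<xi> t w - \<mu> t w) + \<epsilon> t *\<^sub>R \<mu> t w)))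
      \<in> borel_measurable (F (Suc t))"
    by (rule measurable_compose[OF _ measurable_closest_point[OF closed_shrink[OF A_closed] convex_shrink[OF A_compact A_convex pos(3)] shrink_nonempty]])
       measurable
  then show ?case
    by (subst measurable_cong[where g = "\<lambda>w. closest_point (shrink (\<rho> t) (A i)) (\<mu> t w - \<gamma> t *\<^sub>R ((J i (a t w) / (\<sigma> t)\<^sup>2) *\<^sub>R (\<xi> t w - \<mu> t w) + \<epsilon> t *\<^sub>R \<mu> t w))"])
       (auto simp: space_F mean_Suc)
qed

lemma measurable_P: "f \<in> borel_measurable (F t) \<Longrightarrow> f \<in> borel_measurable P"
  by (rule measurable_from_subalg[OF F_sub])

lemma measurable_processes [measurable]: "\<mu> t \<in> borel_measurable P" "\<xi> t \<in> borel_measurable P" "a t \<in> borel_measurable P"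
  using mean_meas \<xi>_meas action_meas_Suc by (auto intro: measurable_P)

lemma mean_in_shrink:
  assumes "w \<in> space P"
  shows "\<mu> (Suc t) w \<in> shrink (\<rho> t) (A i)"
  unfolding mean_Suc[OF assms] by (rule closest_point_in_set[OF closed_shrink[OF A_closed] shrink_nonempty])

lemma mean_ball: "w \<in> space P \<Longrightarrow> cball (\<mu> (Suc t) w) (\<rho> t) \<subseteq> A i"
  using mean_in_shrink mem_shrink_iff[OF A_compact pos(3)] by blast

lemma mean_bounded: "w \<in> space P \<Longrightarrow> norm (\<mu> (Suc t) w) \<le> R"
  using mean_in_shrink[of w t] A_bounded by (auto simp: shrink_def)

lemma norm_le_R: "y \<in> A i \<Longrightarrow> norm y \<le> R" using A_bounded by auto

lemma deviation_bounded:
  assumes "w \<in> space P" "y \<in> A i"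
  shows "\<bar>J i (deviate (a t w) i y)\<bar> \<le> B"
  using J_regular[of "a t w"] feasible[OF assms(1)] norm_le_R[OF assms(2)]
  by (auto simp: regular_cost_def)

lemma cost_bounded: "w \<in> space P \<Longrightarrow> \<bar>J i (a t w)\<bar> \<le> B"
  using deviation_bounded[of w "a t w $ i" t] feasible[of w t i] by simp

lemma B_nonneg: "0 \<le> B"
proof -
  obtain w where "w \<in> space P" using not_empty by auto
  from cost_bounded[OF this, of 0] show ?thesis by linarith
qed

lemma measurable_deviation [measurable]: "(\<lambda>w. J i (deviate (a t w) i y)) \<in> borel_measurable P"
proof -
  have "(\<lambda>w. deviate (a t w) i y) \<in> borel_measurable P"
  proof (rule borel_measurable_profile)
    fix j
    show "(\<lambda>w. deviate (a t w) i y $ j) \<in> borel_measurable P"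
      using measurable_P[OF others_meas, of j t] by (cases "j = i") simp_all
  qed
  then show ?thesis by (rule measurable_compose[OF _ measurable_J])
qed

lemma measurable_cost [measurable]: "(\<lambda>w. J i (a t w)) \<in> borel_measurable P"
  by (rule measurable_compose[OF measurable_processes(3) measurable_J])

lemma integrable_deviation: "y \<in> A i \<Longrightarrow> integrable P (\<lambda>w. J i (deviate (a t w) i y))"
  by (rule integrable_const_bound[of _ B]) (auto intro!: AE_I2 deviation_bounded)

lemma integrable_cost: "integrable P (\<lambda>w. J i (a t w))"
  by (rule integrable_const_bound[of _ B]) (auto intro!: AE_I2 cost_bounded)

lemma integrable_noise: "integrable P (\<lambda>w. (norm (\<xi> t w - \<mu> t w))\<^sup>2)"
  and noise_second_moment: "(\<integral>w. (norm (\<xi> t w - \<mu> t w))\<^sup>2 \<partial>P) \<le> moment_const TYPE('d) 1 * (\<sigma> t)\<^sup>2"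
  by (rule cond_gaussian_second_moment[OF prob_space_axioms F_sub sample mean_meas pos(2)])+

lemma integrable_payoff_gradient:
  assumes u: "u \<in> A i"
  shows "integrable P (\<lambda>w. J i (a (Suc t) w) * ((\<xi> (Suc t) w - \<mu> (Suc t) w) \<bullet> (\<mu> (Suc t) w - u)))"
proof (rule Bochner_Integration.integrable_bound)
  show "integrable P (\<lambda>w. B * ((1 + (norm (\<xi> (Suc t) w - \<mu> (Suc t) w))\<^sup>2) * (2 * R)))"
    using integrable_noise[of "Suc t"] by auto
  show "AE w in P. norm (J i (a (Suc t) w) * ((\<xi> (Suc t) w - \<mu> (Suc t) w) \<bullet> (\<mu> (Suc t) w - u)))
      \<le> norm (B * ((1 + (norm (\<xi> (Suc t) w - \<mu> (Suc t) w))\<^sup>2) * (2 * R)))"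
  proof (rule AE_I2)
    fix w assume w: "w \<in> space P"
    let ?X = "\<xi> (Suc t) w - \<mu> (Suc t) w"
    have "norm (\<mu> (Suc t) w - u) \<le> 2 * R"
      using norm_triangle_ineq4[of "\<mu> (Suc t) w" u] mean_bounded[OF w, of t] norm_le_R[OF u] by linarith
    then have "norm ?X * norm (\<mu> (Suc t) w - u) \<le> (1 + (norm ?X)\<^sup>2) * (2 * R)"
      using linear_le_quadratic[of "norm ?X"] by (intro mult_mono) auto
    then have "\<bar>?X \<bullet> (\<mu> (Suc t) w - u)\<bar> \<le> (1 + (norm ?X)\<^sup>2) * (2 * R)"
      using Cauchy_Schwarz_ineq2[of ?X "\<mu> (Suc t) w - u"] by linarith
    then have "\<bar>J i (a (Suc t) w)\<bar> * \<bar>?X \<bullet> (\<mu> (Suc t) w - u)\<bar> \<le> B * ((1 + (norm ?X)\<^sup>2) * (2 * R))"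
      by (intro mult_mono cost_bounded w B_nonneg) auto
    then show "norm (J i (a (Suc t) w) * (?X \<bullet> (\<mu> (Suc t) w - u))) \<le> norm (B * ((1 + (norm ?X)\<^sup>2) * (2 * R)))"
      unfolding real_norm_def abs_mult[of "J i (a (Suc t) w)"] by linarith
  qed
qed measurable

text \<open>The estimate for a frozen cost, integrated over the information available at time \<open>Suc t\<close>.\<close>

lemma expected_payoff_gradient:
  assumes u: "u \<in> A i"
  shows "mean_cost (Suc t) - mean_deviation (Suc t) u \<le>
     mean_gradient (Suc t) u / (\<sigma> (Suc t))\<^sup>2 +
     estimate_const TYPE('d) p R K Q * ((\<sigma> (Suc t))\<^sup>2 + (\<sigma> (Suc t) / \<rho> t) ^ (2 * p) * (1 + (\<sigma> (Suc t))\<^sup>2 / \<rho> t))"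
proof -
  define T where "T = Suc t"
  let ?G = "gaussian 0 (\<sigma> T) :: (real^'d) measure"
  define h1 where "h1 z = J i (deviate (a T (fst z)) i (closest_point (A i) (\<mu> T (fst z) + snd z)))" for z
  define h2 where "h2 z = h1 z * (snd z \<bullet> (\<mu> T (fst z) - u))" for z
  note [measurable] = mean_meas[of T] measurable_closest_point[OF A_closed A_convex A_nonempty]
  have "(\<lambda>z. deviate (a T (fst z)) i (closest_point (A i) (\<mu> T (fst z) + snd z))) \<in> borel_measurable (F T \<Otimes>\<^sub>M borel)"
  proof (rule borel_measurable_profile)
    fix j
    show "(\<lambda>z. deviate (a T (fst z)) i (closest_point (A i) (\<mu> T (fst z) + snd z)) $ j) \<in> borel_measurable (F T \<Otimes>\<^sub>M borel)"
    proof (cases "j = i")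
      case True then show ?thesis by simp
    next
      case False
      with others_meas[OF False, of T] show ?thesis by simp
    qed
  qed
  then have h1[measurable]: "h1 \<in> borel_measurable (F T \<Otimes>\<^sub>M borel)"
    unfolding h1_def[abs_def] by (rule measurable_compose[OF _ measurable_J])
  have h2[measurable]: "h2 \<in> borel_measurable (F T \<Otimes>\<^sub>M borel)" unfolding h2_def[abs_def] by measurable
  have e1: "h1 (w, \<xi> T w - \<mu> T w) = J i (a T w)" if "w \<in> space P" for w
  proof -
    have "deviate (a T w) i (closest_point (A i) (\<xi> T w)) = a T w"
      using action_eq[OF that, of T, symmetric] by simp
    then show ?thesis by (simp add: h1_def)
  qed
  have e2: "h2 (w, \<xi> T w - \<mu> T w) = J i (a T w) * ((\<xi> T w - \<mu> T w) \<bullet> (\<mu> T w - u))" if "w \<in> space P" for w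
    unfolding h2_def using e1[OF that] by simp
  have i1: "integrable P (\<lambda>w. h1 (w, \<xi> T w - \<mu> T w))"
    using integrable_cost[of T] by (subst Bochner_Integration.integrable_cong[OF refl e1]) auto
  have i2: "integrable P (\<lambda>w. h2 (w, \<xi> T w - \<mu> T w))"
    using integrable_payoff_gradient[OF u, of t] by (subst Bochner_Integration.integrable_cong[OF refl e2]) (auto simp: T_def)
  note c1 = cond_gaussian_expectation[OF prob_space_axioms F_sub sample mean_meas pos(2) h1 i1]
  note c2 = cond_gaussian_expectation[OF prob_space_axioms F_sub sample mean_meas pos(2) h2 i2]
  have E1: "(\<integral>w. \<integral>x. h1 (w, x) \<partial>?G \<partial>P) = mean_cost T"
    unfolding c1(1)[symmetric] by (rule Bochner_Integration.integral_cong) (auto simp: e1)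
  have E2: "(\<integral>w. \<integral>x. h2 (w, x) \<partial>?G \<partial>P) = mean_gradient T u"
    unfolding c2(1)[symmetric] by (rule Bochner_Integration.integral_cong) (auto simp: e2)
  let ?C = "estimate_const TYPE('d) p R K Q * ((\<sigma> T)\<^sup>2 + (\<sigma> T / \<rho> t) ^ (2 * p) * (1 + (\<sigma> T)\<^sup>2 / \<rho> t))"
  have "(\<integral>w. (\<integral>x. h1 (w, x) \<partial>?G) - J i (deviate (a T w) i u) \<partial>P) \<le> (\<integral>w. (\<integral>x. h2 (w, x) \<partial>?G) / (\<sigma> T)\<^sup>2 + ?C \<partial>P)"
  proof (rule integral_mono)
    show "integrable P (\<lambda>w. (\<integral>x. h1 (w, x) \<partial>?G) - J i (deviate (a T w) i u))"
      using c1(2) integrable_deviation[OF u] by auto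
    show "integrable P (\<lambda>w. (\<integral>x. h2 (w, x) \<partial>?G) / (\<sigma> T)\<^sup>2 + ?C)"
      using c2(2) by auto
    fix w assume w: "w \<in> space P"
    have reg: "regular_cost R B K Q (\<lambda>x. J i (deviate (a T w) i x))"
      by (rule J_regular) (rule feasible[OF w])
    show "(\<integral>x. h1 (w, x) \<partial>?G) - J i (deviate (a T w) i u) \<le> (\<integral>x. h2 (w, x) \<partial>?G) / (\<sigma> T)\<^sup>2 + ?C"
      using payoff_gradient_estimate[OF reg R_nonneg Q_nonneg pos(2) pos(3) A_closed A_convex A_bounded mean_ball[OF w, of t] u, of T p]
      by (simp add: h1_def h2_def T_def)
  qed
  also have "(\<integral>w. (\<integral>x. h1 (w, x) \<partial>?G) - J i (deviate (a T w) i u) \<partial>P) = mean_cost T - mean_deviation T u"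
    using c1(2) integrable_deviation[OF u, of T] by (simp add: E1)
  also have "(\<integral>w. (\<integral>x. h2 (w, x) \<partial>?G) / (\<sigma> T)\<^sup>2 + ?C \<partial>P) = mean_gradient T u / (\<sigma> T)\<^sup>2 + ?C"
    using c2(2) prob_space by (simp add: E2)
  finally show ?thesis unfolding T_def .
qed

lemma integrable_mean_distance: "integrable P (\<lambda>w. (norm (\<mu> (Suc t) w - u))\<^sup>2)"
proof (rule integrable_const_bound[of _ "(R + norm u)\<^sup>2"])
  show "AE w in P. norm ((norm (\<mu> (Suc t) w - u))\<^sup>2) \<le> (R + norm u)\<^sup>2"
  proof (rule AE_I2)
    fix w assume w: "w \<in> space P"
    have "norm (\<mu> (Suc t) w - u) \<le> R + norm u"
      using norm_triangle_ineq4[of "\<mu> (Suc t) w" u] mean_bounded[OF w, of t] by linarith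
    then show "norm ((norm (\<mu> (Suc t) w - u))\<^sup>2) \<le> (R + norm u)\<^sup>2" by (simp add: power_mono)
  qed
qed measurable

text \<open>The basic inequality of projected gradient descent: projecting does not increase the distance to \<open>u\<close>, so expanding the
square of the distance after the step bounds the inner product of the step direction with \<open>\<mu> - u\<close>.\<close>

lemma descent_pointwise:
  assumes w: "w \<in> space P" and u: "u \<in> shrink (\<rho> (Suc t)) (A i)"
  defines "T \<equiv> Suc t"
  shows "J i (a T w) * ((\<xi> T w - \<mu> T w) \<bullet> (\<mu> T w - u)) / (\<sigma> T)\<^sup>2 \<le>
    ((norm (\<mu> T w - u))\<^sup>2 - (norm (\<mu> (Suc T) w - u))\<^sup>2) / (2 * \<gamma> T) +
    \<gamma> T * (B\<^sup>2 * (norm (\<xi> T w - \<mu> T w))\<^sup>2 / (\<sigma> T)^4 + (\<epsilon> T)\<^sup>2 * R\<^sup>2) + 2 * R\<^sup>2 * \<epsilon> T"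
proof -
  define X where "X = \<xi> T w - \<mu> T w"
  define m where "m = (J i (a T w) / (\<sigma> T)\<^sup>2) *\<^sub>R X"
  define g where "g = m + \<epsilon> T *\<^sub>R \<mu> T w"
  define d where "d = \<mu> T w - u"
  have uA: "norm u \<le> R" using u A_bounded by (auto simp: shrink_def)
  have mR: "norm (\<mu> T w) \<le> R" unfolding T_def by (rule mean_bounded[OF w])
  have d: "norm d \<le> 2 * R" unfolding d_def using norm_triangle_ineq4[of "\<mu> T w" u] uA mR by linarith
  let ?S = "shrink (\<rho> T) (A i)"
  have S: "convex ?S" "closed ?S" "?S \<noteq> {}"
    using convex_shrink[OF A_compact A_convex pos(3)] closed_shrink[OF A_closed] shrink_nonempty by auto
  have uS: "u \<in> ?S" using u by (simp add: T_def)
  have "dist (closest_point ?S (\<mu> T w - \<gamma> T *\<^sub>R g)) (closest_point ?S u) \<le> dist (\<mu> T w - \<gamma> T *\<^sub>R g) u"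
    by (rule closest_point_lipschitz[OF S])
  then have "norm (\<mu> (Suc T) w - u) \<le> norm (d - \<gamma> T *\<^sub>R g)"
    using mean_Suc[OF w, of T] closest_point_self[OF uS]
    by (simp add: dist_norm g_def m_def X_def d_def algebra_simps)
  then have "(norm (\<mu> (Suc T) w - u))\<^sup>2 \<le> (norm (d - \<gamma> T *\<^sub>R g))\<^sup>2" by (rule power_mono) simp
  also have "\<dots> = (norm d)\<^sup>2 - 2 * \<gamma> T * (g \<bullet> d) + (\<gamma> T)\<^sup>2 * (norm g)\<^sup>2"
    unfolding power2_norm_eq_inner by (simp add: inner_diff_left inner_diff_right inner_commute power2_eq_square)
  finally have "2 * \<gamma> T * (g \<bullet> d) \<le> (norm d)\<^sup>2 - (norm (\<mu> (Suc T) w - u))\<^sup>2 + (\<gamma> T)\<^sup>2 * (norm g)\<^sup>2" by linarith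
  then have "g \<bullet> d \<le> ((norm d)\<^sup>2 - (norm (\<mu> (Suc T) w - u))\<^sup>2 + (\<gamma> T)\<^sup>2 * (norm g)\<^sup>2) / (2 * \<gamma> T)"
    using pos(1)[of T] by (simp add: pos_le_divide_eq mult_ac)
  also have "\<dots> = ((norm d)\<^sup>2 - (norm (\<mu> (Suc T) w - u))\<^sup>2) / (2 * \<gamma> T) + \<gamma> T * ((norm g)\<^sup>2 / 2)"
    using pos(1)[of T] by (simp add: field_simps power2_eq_square)
  finally have gd: "g \<bullet> d \<le> ((norm d)\<^sup>2 - (norm (\<mu> (Suc T) w - u))\<^sup>2) / (2 * \<gamma> T) + \<gamma> T * ((norm g)\<^sup>2 / 2)" .
  have ng: "(norm g)\<^sup>2 / 2 \<le> B\<^sup>2 * (norm X)\<^sup>2 / (\<sigma> T)^4 + (\<epsilon> T)\<^sup>2 * R\<^sup>2"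
  proof -
    have "norm g \<le> norm m + norm (\<epsilon> T *\<^sub>R \<mu> T w)" unfolding g_def by (rule norm_triangle_ineq)
    then have "(norm g)\<^sup>2 \<le> (norm m + norm (\<epsilon> T *\<^sub>R \<mu> T w))\<^sup>2" by (rule power_mono) simp
    also have "\<dots> \<le> 2 * (norm m)\<^sup>2 + 2 * (norm (\<epsilon> T *\<^sub>R \<mu> T w))\<^sup>2"
      using zero_le_power2[of "norm m - norm (\<epsilon> T *\<^sub>R \<mu> T w)"] by (simp add: power2_sum power2_diff)
    also have "(norm m)\<^sup>2 = (J i (a T w))\<^sup>2 * (norm X)\<^sup>2 / (\<sigma> T)^4"
      by (simp add: m_def power_mult_distrib power_divide power_mult[symmetric])
    also have "(J i (a T w))\<^sup>2 * (norm X)\<^sup>2 / (\<sigma> T)^4 \<le> B\<^sup>2 * (norm X)\<^sup>2 / (\<sigma> T)^4"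
      using cost_bounded[OF w, of T] by (intro divide_right_mono mult_right_mono) (auto simp: abs_le_square_iff[symmetric] B_nonneg)
    also have "(norm (\<epsilon> T *\<^sub>R \<mu> T w))\<^sup>2 \<le> (\<epsilon> T)\<^sup>2 * R\<^sup>2"
      using mR by (simp add: power_mult_distrib mult_left_mono power_mono)
    finally show ?thesis by linarith
  qed
  have ed: "- (2 * R\<^sup>2 * \<epsilon> T) \<le> (\<epsilon> T *\<^sub>R \<mu> T w) \<bullet> d"
  proof -
    have "norm (\<epsilon> T *\<^sub>R \<mu> T w) * norm d \<le> (\<epsilon> T * R) * (2 * R)"
      using pos(4)[of T] mR d R_nonneg by (intro mult_mono) (auto intro: mult_left_mono)
    then show ?thesis
      using Cauchy_Schwarz_ineq2[of "\<epsilon> T *\<^sub>R \<mu> T w" d] by (simp add: power2_eq_square algebra_simps abs_le_iff)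
  qed
  have "m \<bullet> d = g \<bullet> d - (\<epsilon> T *\<^sub>R \<mu> T w) \<bullet> d" by (simp add: g_def inner_add_left)
  with gd ed mult_left_mono[OF ng, of "\<gamma> T"] pos(1)[of T]
  have "m \<bullet> d \<le> ((norm d)\<^sup>2 - (norm (\<mu> (Suc T) w - u))\<^sup>2) / (2 * \<gamma> T) +
     \<gamma> T * (B\<^sup>2 * (norm X)\<^sup>2 / (\<sigma> T)^4 + (\<epsilon> T)\<^sup>2 * R\<^sup>2) + 2 * R\<^sup>2 * \<epsilon> T" by linarith
  then show ?thesis by (simp add: m_def X_def d_def)
qed

lemma expected_descent_step:
  assumes u: "u \<in> shrink (\<rho> (Suc t)) (A i)"
  shows "mean_cost (Suc t) - mean_deviation (Suc t) u \<le>
    (mean_distance (Suc t) u - mean_distance (Suc (Suc t)) u) / (2 * \<gamma> (Suc t)) +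
    step_error TYPE('d) p R B K Q (\<gamma> (Suc t)) (\<sigma> (Suc t)) (\<rho> t) (\<epsilon> (Suc t))"
proof -
  define T where "T = Suc t"
  have uA: "u \<in> A i" using u by (simp add: shrink_def)
  note iD = integrable_mean_distance[of t u] integrable_mean_distance[of T u] integrable_noise[of T]
  let ?d = "\<lambda>t. mean_distance t u" and ?N = "\<integral>w. (norm (\<xi> T w - \<mu> T w))\<^sup>2 \<partial>P"
  have "mean_gradient T u / (\<sigma> T)\<^sup>2 =
      (\<integral>w. J i (a T w) * ((\<xi> T w - \<mu> T w) \<bullet> (\<mu> T w - u)) / (\<sigma> T)\<^sup>2 \<partial>P)" by simp
  also have "\<dots> \<le> (\<integral>w. ((norm (\<mu> T w - u))\<^sup>2 - (norm (\<mu> (Suc T) w - u))\<^sup>2) / (2 * \<gamma> T) +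
     (\<gamma> T * (B\<^sup>2 * (norm (\<xi> T w - \<mu> T w))\<^sup>2 / (\<sigma> T)^4 + (\<epsilon> T)\<^sup>2 * R\<^sup>2) + 2 * R\<^sup>2 * \<epsilon> T) \<partial>P)"
    using integrable_payoff_gradient[OF uA, of t] iD descent_pointwise[OF _ u]
    by (intro integral_mono) (auto simp: T_def add.assoc)
  also have "\<dots> = (?d T - ?d (Suc T)) / (2 * \<gamma> T) + (\<gamma> T * (B\<^sup>2 * ?N / (\<sigma> T)^4 + (\<epsilon> T)\<^sup>2 * R\<^sup>2) + 2 * R\<^sup>2 * \<epsilon> T)"
    using iD prob_space unfolding T_def[symmetric] by simp
  also have "B\<^sup>2 * ?N / (\<sigma> T)^4 \<le> B\<^sup>2 * moment_const TYPE('d) 1 / (\<sigma> T)\<^sup>2"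
  proof -
    have "B\<^sup>2 * ?N / (\<sigma> T)^4 \<le> B\<^sup>2 * (moment_const TYPE('d) 1 * (\<sigma> T)\<^sup>2) / (\<sigma> T)^4"
      by (intro divide_right_mono mult_left_mono noise_second_moment) auto
    also have "\<dots> = B\<^sup>2 * moment_const TYPE('d) 1 / (\<sigma> T)\<^sup>2"
      using pos(2)[of T] by (simp add: field_simps power2_eq_square power4_eq_xxxx)
    finally show ?thesis .
  qed
  finally have "mean_gradient T u / (\<sigma> T)\<^sup>2 \<le>
     (?d T - ?d (Suc T)) / (2 * \<gamma> T) + (\<gamma> T * (B\<^sup>2 * moment_const TYPE('d) 1 / (\<sigma> T)\<^sup>2 + (\<epsilon> T)\<^sup>2 * R\<^sup>2) + 2 * R\<^sup>2 * \<epsilon> T)"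
    using pos(1)[of T] by simp
  with expected_payoff_gradient[OF uA, of t p] show ?thesis
    unfolding step_error_def T_def by linarith
qed

lemma expected_deviation_lipschitz:
  assumes y: "y \<in> A i" and u: "u \<in> A i"
  shows "mean_deviation t u \<le> mean_deviation t y + K * norm (u - y)"
proof -
  have "mean_deviation t u \<le> (\<integral>w. J i (deviate (a t w) i y) + K * norm (u - y) \<partial>P)"
  proof (rule integral_mono)
    fix w assume w: "w \<in> space P"
    have "K-lipschitz_on (cball 0 (R + 1)) (\<lambda>x. J i (deviate (a t w) i x))"
      using J_regular[of "a t w"] feasible[OF w] by (simp add: regular_cost_def)
    from lipschitz_real_bound[OF this, of u y] norm_le_R[OF u] norm_le_R[OF y]
    show "J i (deviate (a t w) i u) \<le> J i (deviate (a t w) i y) + K * norm (u - y)" by simp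
  qed (use integrable_deviation[OF u, of t] integrable_deviation[OF y, of t] in auto)
  also have "\<dots> = mean_deviation t y + K * norm (u - y)"
    using integrable_deviation[OF y, of t] prob_space by simp
  finally show ?thesis .
qed

text \<open>The price of letting the comparator move between two steps.\<close>

lemma mean_distance_shift:
  assumes u: "u \<in> A i" and v: "v \<in> A i"
  shows "mean_distance (Suc t) v \<le> mean_distance (Suc t) u + 4 * R * norm (u - v)"
proof -
  have "mean_distance (Suc t) v \<le> (\<integral>w. (norm (\<mu> (Suc t) w - u))\<^sup>2 + 4 * R * norm (u - v) \<partial>P)"
  proof (rule integral_mono)
    fix w assume w: "w \<in> space P"
    let ?a = "norm (\<mu> (Suc t) w - v)" and ?b = "norm (\<mu> (Suc t) w - u)"
    have "?a \<le> 2 * R" "?b \<le> 2 * R"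
      using norm_triangle_ineq4[of "\<mu> (Suc t) w" v] norm_triangle_ineq4[of "\<mu> (Suc t) w" u]
        mean_bounded[OF w, of t] norm_le_R[OF u] norm_le_R[OF v] by linarith+
    moreover have "?a - ?b \<le> norm (u - v)"
      using norm_triangle_ineq2[of "\<mu> (Suc t) w - v" "\<mu> (Suc t) w - u"] by simp
    ultimately have "(?a - ?b) * (?a + ?b) \<le> norm (u - v) * (4 * R)"
      by (intro mult_mono) auto
    then show "?a\<^sup>2 \<le> ?b\<^sup>2 + 4 * R * norm (u - v)" by (simp add: power2_eq_square algebra_simps)
  qed (use integrable_mean_distance[of t] in auto)
  also have "\<dots> = mean_distance (Suc t) u + 4 * R * norm (u - v)"
    using integrable_mean_distance[of t u] prob_space by simp
  finally show ?thesis .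
qed

lemma mean_distance_bounded:
  assumes u: "u \<in> A i"
  shows "mean_distance (Suc t) u \<le> 4 * R\<^sup>2"
proof -
  have "mean_distance (Suc t) u \<le> (\<integral>w. 4 * R\<^sup>2 \<partial>P)"
  proof (rule integral_mono)
    fix w assume w: "w \<in> space P"
    have "norm (\<mu> (Suc t) w - u) \<le> 2 * R"
      using norm_triangle_ineq4[of "\<mu> (Suc t) w" u] mean_bounded[OF w, of t] norm_le_R[OF u] by linarith
    then have "(norm (\<mu> (Suc t) w - u))\<^sup>2 \<le> (2 * R)\<^sup>2" by (rule power_mono) simp
    then show "(norm (\<mu> (Suc t) w - u))\<^sup>2 \<le> 4 * R\<^sup>2" by (simp add: power_mult_distrib)
  qed (use integrable_mean_distance[of t] in auto)
  then show ?thesis using prob_space by simp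
qed

end


section \<open>Summing the steps\<close>

context bandit_run
begin

text \<open>The comparator at time \<open>t\<close> is \<open>y + \<kappa> t *\<^sub>R v\<close>; it has to belong to the shrunken set of time \<open>t\<close> and approaches \<open>y\<close> as the shrinkage
vanishes. The sum telescopes although the weights \<open>1 / \<gamma> t\<close> increase, because the potential is bounded; the
last weight is all that remains.\<close>

lemma cumulative_regret:
  assumes y: "y \<in> A i" and v: "norm v \<le> 2 * R" and t0: "1 \<le> t0"
    and dec: "\<And>t. t0 \<le> t \<Longrightarrow> \<kappa> (Suc t) \<le> \<kappa> t" and l: "\<And>t. t0 \<le> t \<Longrightarrow> 0 \<le> \<kappa> t" "\<And>t. t0 \<le> t \<Longrightarrow> \<kappa> t \<le> 1"
    and comp: "\<And>t. t0 \<le> t \<Longrightarrow> y + \<kappa> t *\<^sub>R v \<in> shrink (\<rho> t) (A i)"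
    and \<gamma>_dec: "\<And>t. t0 \<le> t \<Longrightarrow> \<gamma> (Suc t) \<le> \<gamma> t" and T: "t0 \<le> T"
  shows "(\<Sum>t=t0..T. mean_cost t - mean_deviation t y) \<le>
     6 * R\<^sup>2 / \<gamma> T + (\<Sum>t=t0..T. K * norm v * \<kappa> t + step_error TYPE('d) p R B K Q (\<gamma> t) (\<sigma> t) (\<rho> (t - 1)) (\<epsilon> t))"
proof -
  let ?se = "\<lambda>t. step_error TYPE('d) p R B K Q (\<gamma> t) (\<sigma> t) (\<rho> (t - 1)) (\<epsilon> t)"
  define r where "r t = mean_cost t - mean_deviation t y" for t
  define err where "err t = K * norm v * \<kappa> t + ?se t" for t
  define u where "u t = y + \<kappa> t *\<^sub>R v" for t
  \<comment> \<open>The second summand pays in advance for all later moves of the comparator.\<close>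
  define \<Phi> where "\<Phi> t = mean_distance t (u t) + 4 * R * norm v * \<kappa> t" for t
  have uA: "u t \<in> A i" if "t0 \<le> t" for t using comp[OF that] by (simp add: u_def shrink_def)
  have increment: "r t \<le> err t + (\<Phi> t - \<Phi> (Suc t)) / (2 * \<gamma> t)" if t: "t0 \<le> t" for t
  proof -
    obtain t' where t': "t = Suc t'" using t t0 by (cases t) auto
    let ?d = "mean_distance t (u t)" and ?d' = "mean_distance (Suc t) (u t)"
    have "mean_cost t - mean_deviation t (u t) \<le> (?d - ?d') / (2 * \<gamma> t) + ?se t"
      using expected_descent_step[of "u t" t' p] comp[OF t] by (simp add: u_def t')
    moreover have "mean_deviation t (u t) \<le> mean_deviation t y + K * norm v * \<kappa> t"
      using expected_deviation_lipschitz[OF y uA[OF t], of t] l(1)[OF t] by (simp add: u_def mult_ac)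
    moreover have "(?d - ?d') / (2 * \<gamma> t) \<le> (\<Phi> t - \<Phi> (Suc t)) / (2 * \<gamma> t)"
    proof (rule divide_right_mono)
      have "u t - u (Suc t) = (\<kappa> t - \<kappa> (Suc t)) *\<^sub>R v" by (simp add: u_def algebra_simps)
      then have "norm (u t - u (Suc t)) = (\<kappa> t - \<kappa> (Suc t)) * norm v" using dec[OF t] by simp
      with mean_distance_shift[OF uA[OF t] uA[of "Suc t"], of t] t
      show "?d - ?d' \<le> \<Phi> t - \<Phi> (Suc t)" by (simp add: \<Phi>_def algebra_simps)
    qed (use pos(1)[of t] in simp)
    ultimately show ?thesis unfolding r_def err_def by linarith
  qed
  \<comment> \<open>\<open>12 = 4 + 8\<close>: squared diameter of the ball of radius \<open>R\<close>, and \<open>4 R\<close> times the bound \<open>2 R\<close> for \<open>v\<close>.\<close>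
  have \<Phi>_le: "\<Phi> t \<le> 12 * R\<^sup>2" if t: "t0 \<le> t" for t
  proof -
    obtain t' where t': "t = Suc t'" using t t0 by (cases t) auto
    have "4 * R * norm v * \<kappa> t \<le> 4 * R * (2 * R) * 1"
      using v l(1)[OF t] l(2)[OF t] R_nonneg by (intro mult_mono) auto
    then show ?thesis
      using mean_distance_bounded[OF uA[OF t], of t'] by (simp add: \<Phi>_def t' power2_eq_square)
  qed
  have \<Phi>_nonneg: "0 \<le> \<Phi> t" if t: "t0 \<le> t" for t
    unfolding \<Phi>_def using l(1)[OF t] R_nonneg by (intro add_nonneg_nonneg mult_nonneg_nonneg) auto
  have "(\<Sum>t=t0..T. r t) \<le> (12 * R\<^sup>2 - \<Phi> (Suc T)) / (2 * \<gamma> T) + (\<Sum>t=t0..T. err t)"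
    using T
  proof (induction T rule: dec_induct)
    case base
    have "(\<Phi> t0 - \<Phi> (Suc t0)) / (2 * \<gamma> t0) \<le> (12 * R\<^sup>2 - \<Phi> (Suc t0)) / (2 * \<gamma> t0)"
      using pos(1)[of t0] \<Phi>_le[of t0] by (intro divide_right_mono) auto
    with increment[of t0] show ?case by simp
  next
    case (step n)
    note IH = step.IH
    have "(12 * R\<^sup>2 - \<Phi> (Suc n)) / (2 * \<gamma> n) \<le> (12 * R\<^sup>2 - \<Phi> (Suc n)) / (2 * \<gamma> (Suc n))"
      using pos(1)[of "Suc n"] pos(1)[of n] \<gamma>_dec[of n] \<Phi>_le[of "Suc n"] step(1) by (intro divide_left_mono) auto
    moreover have "(12 * R\<^sup>2 - \<Phi> (Suc n)) / (2 * \<gamma> (Suc n)) + (\<Phi> (Suc n) - \<Phi> (Suc (Suc n))) / (2 * \<gamma> (Suc n))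
        = (12 * R\<^sup>2 - \<Phi> (Suc (Suc n))) / (2 * \<gamma> (Suc n))"
      by (simp add: add_divide_distrib[symmetric])
    ultimately show ?case using IH step(1) increment[of "Suc n"] by simp
  qed
  also have "(12 * R\<^sup>2 - \<Phi> (Suc T)) / (2 * \<gamma> T) \<le> 6 * R\<^sup>2 / \<gamma> T"
    using \<Phi>_nonneg[of "Suc T"] T pos(1)[of T] by (simp add: field_simps)
  finally show ?thesis by (simp add: r_def err_def)
qed

lemma expected_gap_le: "y \<in> A i \<Longrightarrow> mean_cost t - mean_deviation t y \<le> 2 * B"
proof -
  assume y: "y \<in> A i"
  have "mean_cost t - mean_deviation t y = (\<integral>w. J i (a t w) - J i (deviate (a t w) i y) \<partial>P)"
    using integrable_cost integrable_deviation[OF y] by simp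
  also have "\<dots> \<le> (\<integral>w. 2 * B \<partial>P)"
  proof (rule integral_mono)
    fix w assume w: "w \<in> space P"
    show "J i (a t w) - J i (deviate (a t w) i y) \<le> 2 * B"
      using cost_bounded[OF w, of t] deviation_bounded[OF w y, of t] by linarith
  qed (use integrable_cost integrable_deviation[OF y] in auto)
  finally show ?thesis using prob_space by simp
qed

lemma expected_average_regret_eq:
  assumes y: "y \<in> A i"
  shows "expected_average_regret P J i a y T =
    (\<Sum>t=1..T. mean_cost t - mean_deviation t y) / real T"
  using integrable_cost integrable_deviation[OF y]
  by (simp add: expected_average_regret_def regret_def sum_subtractf)

end

section \<open>Rates for power-law parameters\<close>

lemma sum_powr_le:
  assumes q: "0 < q" "q < 1" and T: "1 \<le> T"
  shows "(\<Sum>t=1..T. real t powr (- q)) \<le> real T powr (1 - q) / (1 - q)"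
  using T
proof (induction T rule: dec_induct)
  case base
  show ?case using q by (simp add: field_simps)
next
  case (step n)
  have "\<exists>z. real n < z \<and> z < real (Suc n) \<and>
      real (Suc n) powr (1 - q) - real n powr (1 - q) = (real (Suc n) - real n) * ((1 - q) * z powr (1 - q - 1))"
    using step(1) by (intro MVT2) (auto intro!: derivative_eq_intros)
  then obtain z where z: "real n < z" "z < real (Suc n)"
    "real (Suc n) powr (1 - q) - real n powr (1 - q) = (1 - q) * z powr (- q)" by auto
  have "real (Suc n) powr (- q) \<le> z powr (- q)"
    using z(1,2) step(1) q by (intro powr_mono2') auto
  then have "(1 - q) * real (Suc n) powr (- q) \<le> real (Suc n) powr (1 - q) - real n powr (1 - q)"
    unfolding z(3) using q by (intro mult_left_mono) auto
  then have "real (Suc n) powr (- q) \<le> real (Suc n) powr (1 - q) / (1 - q) - real n powr (1 - q) / (1 - q)"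
    unfolding diff_divide_distrib[symmetric] using q by (simp add: pos_le_divide_eq mult.commute)
  with step(3) show ?case by simp
qed

lemma power_sequenceE:
  assumes "power_sequence q f"
  obtains c where "c > 0" "\<And>t. 1 \<le> t \<Longrightarrow> f t = c * real t powr (- q)" "\<And>t. f t > 0"
  using assms by (auto simp: power_sequence_def)

lemma powr_neg_antimono: "1 \<le> t \<Longrightarrow> t \<le> u \<Longrightarrow> 0 \<le> q \<Longrightarrow> real u powr (- q) \<le> real t powr (- q)"
  by (intro powr_mono2') auto

lemma powr_neg_le_one: "1 \<le> t \<Longrightarrow> 0 \<le> q \<Longrightarrow> real t powr (- q) \<le> 1"
  using powr_neg_antimono[of 1 t q] by simp

text \<open>The exponent \<open>p\<close> in Markov's inequality is chosen so large that \<open>(\<sigma> / \<rho>) ^ (2 p)\<close>, of order \<open>t\<close> to the power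
\<open>- 2 p (s - r)\<close>, is dominated by \<open>\<sigma>\<^sup>2\<close>. The bound starts at \<open>t = 2\<close> because it involves \<open>\<rho> (t - 1)\<close>, and \<open>\<rho> 0\<close> does not follow the power law.\<close>

lemma step_error_rate:
  assumes par: "parameters (g, s, r, e) \<gamma> \<sigma> \<rho> \<epsilon>"
    and x: "0 < g" "0 < s" "0 < r" "0 < e" "r < s" and nonneg: "0 \<le> R" "0 \<le> K" "0 \<le> Q"
  obtains p C where "0 \<le> C" "\<And>t. 2 \<le> t \<Longrightarrow> step_error D p R B K Q (\<gamma> t) (\<sigma> t) (\<rho> (t - 1)) (\<epsilon> t) \<le>
     C * (real t powr (- (g - 2 * s)) + real t powr (- (2 * s)) + real t powr (- e))"
proof -
  obtain c\<gamma> where \<gamma>: "c\<gamma> > 0" "\<And>t. 1 \<le> t \<Longrightarrow> \<gamma> t = c\<gamma> * real t powr (- g)"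
    using par by (auto simp: parameters_def elim: power_sequenceE)
  obtain c\<sigma> where \<sigma>: "c\<sigma> > 0" "\<And>t. 1 \<le> t \<Longrightarrow> \<sigma> t = c\<sigma> * real t powr (- s)"
    using par by (auto simp: parameters_def elim: power_sequenceE)
  obtain c\<rho> where \<rho>: "c\<rho> > 0" "\<And>t. 1 \<le> t \<Longrightarrow> \<rho> t = c\<rho> * real t powr (- r)"
    using par by (auto simp: parameters_def elim: power_sequenceE)
  obtain c\<epsilon> where \<epsilon>: "c\<epsilon> > 0" "\<And>t. 1 \<le> t \<Longrightarrow> \<epsilon> t = c\<epsilon> * real t powr (- e)"
    using par by (auto simp: parameters_def elim: power_sequenceE)
  obtain p :: nat where p: "2 * s / (2 * (s - r)) \<le> real p" using real_arch_simple by blast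
  have p': "2 * s \<le> (s - r) * real (2 * p)" using p x by (simp add: field_simps)
  define E where "E = estimate_const D p R K Q"
  have E: "0 \<le> E" unfolding E_def using nonneg by (rule estimate_const_nonneg)
  define M where "M = moment_const D 1"
  have M: "0 \<le> M" by (simp add: M_def moment_const_nonneg)
  define k where "k = (c\<sigma> / c\<rho>) ^ (2 * p) * (1 + c\<sigma>\<^sup>2 / c\<rho>)"
  have k: "0 \<le> k" using \<sigma> \<rho> by (simp add: k_def)
  define C1 where "C1 = c\<gamma> * (B\<^sup>2 * M) / c\<sigma>\<^sup>2"
  define C2 where "C2 = c\<gamma> * c\<epsilon>\<^sup>2 * R\<^sup>2 + 2 * R\<^sup>2 * c\<epsilon>"
  define C3 where "C3 = E * (c\<sigma>\<^sup>2 + k)"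
  have C: "0 \<le> C1" "0 \<le> C2" "0 \<le> C3"
    using \<gamma>(1) \<sigma>(1) \<epsilon>(1) M E k by (auto simp: C1_def C2_def C3_def)
  have "step_error D p R B K Q (\<gamma> t) (\<sigma> t) (\<rho> (t - 1)) (\<epsilon> t) \<le>
     (C1 + C2 + C3) * (real t powr (- (g - 2 * s)) + real t powr (- (2 * s)) + real t powr (- e))" if t: "2 \<le> t" for t
  proof -
    have t1: "1 \<le> t" "1 \<le> t - 1" using t by auto
    let ?x = "real t"
    have x0: "?x > 0" using t by simp
    have sq: "(?x powr (- q))\<^sup>2 = ?x powr (- (2 * q))" for q
      by (simp add: power2_eq_square powr_add[symmetric])
    have \<sigma>2: "(\<sigma> t)\<^sup>2 = c\<sigma>\<^sup>2 * ?x powr (- (2 * s))"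
      using \<sigma>(2)[OF t1(1)] by (simp add: power_mult_distrib sq)
    have a: "\<gamma> t * (B\<^sup>2 * M / (\<sigma> t)\<^sup>2) = C1 * ?x powr (- (g - 2 * s))"
      unfolding \<sigma>2 \<gamma>(2)[OF t1(1)] C1_def using x0 \<sigma>(1)
      by (simp add: field_simps powr_diff powr_minus powr_add[symmetric])
    have b: "\<gamma> t * ((\<epsilon> t)\<^sup>2 * R\<^sup>2) + 2 * R\<^sup>2 * \<epsilon> t \<le> C2 * ?x powr (- e)"
    proof -
      have "\<gamma> t \<le> c\<gamma>" using \<gamma> t1(1) x powr_neg_le_one[of t g] by simp
      moreover have "(\<epsilon> t)\<^sup>2 \<le> c\<epsilon>\<^sup>2 * ?x powr (- e)"
      proof -
        have "(\<epsilon> t)\<^sup>2 = c\<epsilon>\<^sup>2 * (?x powr (- e) * ?x powr (- e))" using \<epsilon>(2)[OF t1(1)] by (simp add: power2_eq_square)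
        also have "\<dots> \<le> c\<epsilon>\<^sup>2 * (?x powr (- e) * 1)"
          using powr_neg_le_one[of t e] t1 x by (intro mult_left_mono) auto
        finally show ?thesis by simp
      qed
      ultimately have "\<gamma> t * ((\<epsilon> t)\<^sup>2 * R\<^sup>2) \<le> c\<gamma> * ((c\<epsilon>\<^sup>2 * ?x powr (- e)) * R\<^sup>2)"
        using \<gamma>(1) by (intro mult_mono mult_right_mono) auto
      then show ?thesis using \<epsilon>(2)[OF t1(1)] by (simp add: C2_def algebra_simps)
    qed
    have c: "(\<sigma> t)\<^sup>2 + (\<sigma> t / \<rho> (t - 1)) ^ (2 * p) * (1 + (\<sigma> t)\<^sup>2 / \<rho> (t - 1)) \<le> (c\<sigma>\<^sup>2 + k) * ?x powr (- (2 * s))"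
    proof -
      have \<rho>t: "c\<rho> * ?x powr (- r) \<le> \<rho> (t - 1)"
        unfolding \<rho>(2)[OF t1(2)] using \<rho>(1) x t1 powr_neg_antimono[of "t - 1" t r] by (intro mult_left_mono) auto
      have \<rho>p: "0 < c\<rho> * ?x powr (- r)" using \<rho>(1) x0 by simp
      have "\<sigma> t / \<rho> (t - 1) \<le> \<sigma> t / (c\<rho> * ?x powr (- r))"
        using \<rho>t \<rho>p \<sigma>(1) \<sigma>(2)[OF t1(1)] by (intro divide_left_mono) auto
      also have "\<dots> = c\<sigma> / c\<rho> * ?x powr (- (s - r))"
        unfolding \<sigma>(2)[OF t1(1)] using x0 by (simp add: powr_diff powr_minus field_simps)
      finally have "(\<sigma> t / \<rho> (t - 1)) ^ (2 * p) \<le> (c\<sigma> / c\<rho> * ?x powr (- (s - r))) ^ (2 * p)"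
        using \<rho>t \<rho>p \<sigma>(1) \<sigma>(2)[OF t1(1)] by (intro power_mono) auto
      also have "\<dots> = (c\<sigma> / c\<rho>) ^ (2 * p) * ?x powr (- ((s - r) * real (2 * p)))"
      proof -
        have "(?x powr (- (s - r))) ^ (2 * p) = (?x powr (- (s - r))) powr real (2 * p)"
          using x0 by (intro powr_realpow[symmetric]) simp
        also have "\<dots> = ?x powr (- ((s - r) * real (2 * p)))"
          unfolding powr_powr by (simp only: mult_minus_left)
        finally show ?thesis unfolding power_mult_distrib by (simp only:)
      qed
      also have "\<dots> \<le> (c\<sigma> / c\<rho>) ^ (2 * p) * ?x powr (- (2 * s))"
        using p' t1 \<sigma>(1) \<rho>(1) by (intro mult_left_mono powr_mono) auto
      finally have 1: "(\<sigma> t / \<rho> (t - 1)) ^ (2 * p) \<le> (c\<sigma> / c\<rho>) ^ (2 * p) * ?x powr (- (2 * s))" .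
      have "(\<sigma> t)\<^sup>2 / \<rho> (t - 1) \<le> (\<sigma> t)\<^sup>2 / (c\<rho> * ?x powr (- r))"
        using \<rho>t \<rho>p by (intro divide_left_mono) auto
      also have "\<dots> = c\<sigma>\<^sup>2 / c\<rho> * ?x powr (- (2 * s - r))"
        unfolding \<sigma>2 using x0 by (simp add: powr_diff powr_minus field_simps)
      also have "\<dots> \<le> c\<sigma>\<^sup>2 / c\<rho> * 1"
        using powr_neg_le_one[of t "2 * s - r"] t1 x \<rho>(1) by (intro mult_left_mono) auto
      finally have 2: "1 + (\<sigma> t)\<^sup>2 / \<rho> (t - 1) \<le> 1 + c\<sigma>\<^sup>2 / c\<rho>" by simp
      have "(\<sigma> t / \<rho> (t - 1)) ^ (2 * p) * (1 + (\<sigma> t)\<^sup>2 / \<rho> (t - 1)) \<le>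
          ((c\<sigma> / c\<rho>) ^ (2 * p) * ?x powr (- (2 * s))) * (1 + c\<sigma>\<^sup>2 / c\<rho>)"
        using 1 2 \<rho>t \<rho>p \<sigma>(1) \<rho>(1) by (intro mult_mono) (auto intro!: add_nonneg_nonneg)
      then show ?thesis unfolding \<sigma>2 k_def by (simp add: algebra_simps)
    qed
    have "step_error D p R B K Q (\<gamma> t) (\<sigma> t) (\<rho> (t - 1)) (\<epsilon> t) \<le>
       C1 * ?x powr (- (g - 2 * s)) + C2 * ?x powr (- e) + C3 * ?x powr (- (2 * s))"
    proof -
      let ?W = "(\<sigma> t)\<^sup>2 + (\<sigma> t / \<rho> (t - 1)) ^ (2 * p) * (1 + (\<sigma> t)\<^sup>2 / \<rho> (t - 1))"
      have "step_error D p R B K Q (\<gamma> t) (\<sigma> t) (\<rho> (t - 1)) (\<epsilon> t) =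
          \<gamma> t * (B\<^sup>2 * M / (\<sigma> t)\<^sup>2) + (\<gamma> t * ((\<epsilon> t)\<^sup>2 * R\<^sup>2) + 2 * R\<^sup>2 * \<epsilon> t) + E * ?W"
        unfolding step_error_def E_def M_def by (simp only: distrib_left add.assoc)
      moreover have "E * ?W \<le> C3 * ?x powr (- (2 * s))"
        unfolding C3_def mult.assoc by (rule mult_left_mono[OF c E])
      ultimately show ?thesis using a b by linarith
    qed
    also have "\<dots> \<le> (C1 + C2 + C3) * (real t powr (- (g - 2 * s)) + real t powr (- (2 * s)) + real t powr (- e))"
    proof -
      have h: "0 \<le> ?x powr q" for q by simp
      have "0 \<le> C1 * ?x powr (- (2 * s)) + C1 * ?x powr (- e) + C2 * ?x powr (- (g - 2 * s)) + C2 * ?x powr (- (2 * s))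
          + C3 * ?x powr (- (g - 2 * s)) + C3 * ?x powr (- e)"
        using C h by (intro add_nonneg_nonneg mult_nonneg_nonneg)
      then show ?thesis by (simp only: distrib_left distrib_right)
    qed
    finally show ?thesis .
  qed
  then show ?thesis using C by (intro that[of "C1 + C2 + C3" p]) auto
qed

lemma power_sequence_tendsto_0:
  assumes "power_sequence q f" "0 < q"
  shows "f \<longlonglongrightarrow> 0"
proof -
  obtain c where c: "\<And>t. 1 \<le> t \<Longrightarrow> f t = c * real t powr (- q)" using assms(1) by (auto elim: power_sequenceE)
  have "(\<lambda>t. c * real t powr (- q)) \<longlonglongrightarrow> c * 0"
    using assms(2) by (intro tendsto_mult tendsto_const tendsto_neg_powr filterlim_real_sequentially) auto
  moreover have "\<forall>\<^sub>F t in sequentially. c * real t powr (- q) = f t"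
    using eventually_ge_at_top[of 1] by eventually_elim (simp add: c)
  ultimately show ?thesis by (auto intro: Lim_transform_eventually)
qed

text \<open>Moving from \<open>y\<close> towards the centre of an inscribed ball of radius \<open>d\<close> by the fraction \<open>\<rho> / d\<close> of the way yields the centre of a ball of
radius \<open>\<rho>\<close> inside \<open>Y\<close>, namely the image of the inscribed ball under a homothety with centre \<open>y\<close>.\<close>

lemma pushed_point_in_shrink:
  fixes Y :: "(real^'d::finite) set"
  assumes Y: "compact Y" "convex Y" and y: "y \<in> Y" and c: "cball x0 d \<subseteq> Y" and d: "0 < d"
    and \<rho>: "0 < \<rho>" "\<rho> \<le> d"
  shows "y + (\<rho> / d) *\<^sub>R (x0 - y) \<in> shrink \<rho> Y"
  unfolding mem_shrink_iff[OF Y(1) \<rho>(1)]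
proof
  fix z assume z: "z \<in> cball (y + (\<rho> / d) *\<^sub>R (x0 - y)) \<rho>"
  define l where "l = \<rho> / d"
  have l: "0 < l" "l \<le> 1" using \<rho> d by (auto simp: l_def)
  define e where "e = z - (y + l *\<^sub>R (x0 - y))"
  have e: "norm e \<le> l * d" using z d by (simp add: e_def l_def dist_norm norm_minus_commute)
  have "norm ((1 / l) *\<^sub>R e) \<le> d" using e l by (simp add: field_simps)
  then have "x0 + (1 / l) *\<^sub>R e \<in> Y" using c by (auto simp: subset_iff dist_norm)
  then have "(1 - l) *\<^sub>R y + l *\<^sub>R (x0 + (1 / l) *\<^sub>R e) \<in> Y" using Y(2) y l by (intro convexD_alt) auto
  moreover have "(1 - l) *\<^sub>R y + l *\<^sub>R (x0 + (1 / l) *\<^sub>R e) = z"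
    using l by (simp add: e_def algebra_simps)
  ultimately show "z \<in> Y" by simp
qed

text \<open>The constant depends on the game, the parameters and the reference point, but not on the run. For an interior reference
point the inscribed ball is centred at \<open>y\<close> itself, so that the comparator does not move and no term with \<open>\<rho>\<close> appears. The steps before \<open>t0\<close>, when
the shrunken set may still be too small, contribute a constant.\<close>

proposition bandit_regret_rate:
  fixes A :: "('d::finite, 'n::finite) action_sets" and J :: "('d, 'n) costs"
  assumes par: "parameters (g, s, r, e) \<gamma> \<sigma> \<rho> \<epsilon>"
    and x: "0 < g" "g < 1" "0 < s" "0 < r" "r < 1" "0 < e" "e < 1" "r < s" "0 < g - 2 * s"
    and A: "compact (A i)" "convex (A i)" "interior (A i) \<noteq> {}" "A i \<subseteq> cball 0 R"
    and nonneg: "0 \<le> R" "0 \<le> K" "0 \<le> Q" "0 \<le> B"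
    and y: "y \<in> A i" "\<not> bd \<Longrightarrow> y \<in> interior (A i)"
  shows "\<exists>C. \<forall>(P :: 'w measure) F \<mu>0 \<xi> \<mu> a. bandit_run P F A J \<gamma> \<sigma> \<rho> \<epsilon> i \<mu>0 \<xi> \<mu> a R B K Q \<longrightarrow>
    (\<forall>T\<ge>1. expected_average_regret P J i a y T \<le> C * regret_terms bd (g, s, r, e) T)"
proof -
  let ?se = "\<lambda>p t. step_error TYPE('d) p R B K Q (\<gamma> t) (\<sigma> t) (\<rho> (t - 1)) (\<epsilon> t)"
  obtain c\<gamma> where \<gamma>: "c\<gamma> > 0" "\<And>t. 1 \<le> t \<Longrightarrow> \<gamma> t = c\<gamma> * real t powr (- g)"
    using par by (auto simp: parameters_def elim: power_sequenceE)
  obtain c\<rho> where \<rho>: "c\<rho> > 0" "\<And>t. 1 \<le> t \<Longrightarrow> \<rho> t = c\<rho> * real t powr (- r)" "\<And>t. \<rho> t > 0"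
    using par by (auto simp: parameters_def elim: power_sequenceE)
  obtain p C0 where C0: "0 \<le> C0" "\<And>t. 2 \<le> t \<Longrightarrow> ?se p t \<le>
     C0 * (real t powr (- (g - 2 * s)) + real t powr (- (2 * s)) + real t powr (- e))"
    using step_error_rate[OF par x(1,3,4,6,8) nonneg(1-3)] by blast
  have \<rho>0: "\<rho> \<longlonglongrightarrow> 0"
    using par x(4) by (auto simp: parameters_def intro: power_sequence_tendsto_0)
  obtain x0 d where x0: "0 < d" "cball x0 d \<subseteq> A i" "\<not> bd \<Longrightarrow> x0 = y"
  proof (cases bd)
    case True
    obtain x0 where "x0 \<in> interior (A i)" using A(3) by auto
    then show ?thesis using that True by (auto simp: mem_interior_cball)
  next
    case False
    then show ?thesis using y(2) that by (auto simp: mem_interior_cball)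
  qed
  define v where "v = x0 - y"
  define l where "l t = \<rho> t / d" for t
  have x0A: "x0 \<in> A i" using x0(1,2) by auto
  have v: "norm v \<le> 2 * R"
  proof -
    have "norm x0 \<le> R" "norm y \<le> R" using x0A y(1) A(4) by auto
    then show ?thesis using norm_triangle_ineq4[of x0 y] by (simp add: v_def)
  qed
  have "\<forall>\<^sub>F t in sequentially. \<rho> t < d" by (rule order_tendstoD(2)[OF \<rho>0 x0(1)])
  then obtain t1 where t1: "\<And>t. t1 \<le> t \<Longrightarrow> \<rho> t < d" by (auto simp: eventually_sequentially)
  define t0 where "t0 = max 2 t1"
  have t0: "2 \<le> t0" "\<And>t. t0 \<le> t \<Longrightarrow> \<rho> t < d" using t1 by (auto simp: t0_def)
  define D0 where "D0 = 2 * B * real t0 + 6 * R\<^sup>2 / c\<gamma>"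
  define D1 where "D1 = C0 / (1 - (g - 2 * s))"
  define D2 where "D2 = C0 / (1 - 2 * s)"
  define D3 where "D3 = C0 / (1 - e)"
  define D4 where "D4 = K * norm v * (c\<rho> / d) / (1 - r)"
  have D: "0 \<le> D0" "0 \<le> D1" "0 \<le> D2" "0 \<le> D3" "0 \<le> D4"
    using nonneg \<gamma>(1) C0(1) x \<rho>(1) x0(1) by (auto simp: D0_def D1_def D2_def D3_def D4_def)
  let ?C = "D0 + D1 + D2 + D3 + D4"
  have main: "expected_average_regret P J i a y T \<le> ?C * regret_terms bd (g, s, r, e) T"
    if run: "bandit_run P F A J \<gamma> \<sigma> \<rho> \<epsilon> i \<mu>0 \<xi> \<mu> a R B K Q" and T: "1 \<le> T"
    for P :: "'w measure" and F \<mu>0 \<xi> \<mu> a T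
  proof -
    interpret bandit_run P F A J \<gamma> \<sigma> \<rho> \<epsilon> i \<mu>0 \<xi> \<mu> a R B K Q by (rule run)
    define gap where "gap t = (\<integral>w. J i (a t w) \<partial>P) - (\<integral>w. J i (deviate (a t w) i y) \<partial>P)" for t
    define h where "h t = K * norm v * l t + C0 * (real t powr (- (g - 2 * s)) + real t powr (- (2 * s)) + real t powr (- e))" for t
    have l0: "0 \<le> l t" for t using \<rho>(3)[of t] x0(1) by (simp add: l_def)
    have h0: "0 \<le> h t" for t using C0(1) nonneg l0[of t] by (simp add: h_def)
    have gT: "0 \<le> 6 * R\<^sup>2 / \<gamma> T" using pos(1)[of T] by simp
    have tail: "(\<Sum>t=t0..T. gap t) \<le> 6 * R\<^sup>2 / \<gamma> T + (\<Sum>t=1..T. h t)"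
    proof (cases "t0 \<le> T")
      case True
      have "(\<Sum>t=t0..T. gap t) \<le> 6 * R\<^sup>2 / \<gamma> T + (\<Sum>t=t0..T. K * norm v * l t + ?se p t)"
        unfolding gap_def
      proof (rule cumulative_regret[OF y(1) v])
        fix t assume t: "t0 \<le> t"
        then have t': "1 \<le> t" using t0 by simp
        show "l (Suc t) \<le> l t" unfolding l_def using t' \<rho>(1) x x0(1)
          by (intro divide_right_mono) (auto simp: \<rho>(2) intro!: mult_left_mono powr_neg_antimono[of t "Suc t", simplified])
        show "0 \<le> l t" by (rule l0)
        show "l t \<le> 1" using t0(2)[OF t] x0(1) by (simp add: l_def)
        show "y + l t *\<^sub>R v \<in> shrink (\<rho> t) (A i)"
          unfolding l_def v_def using t0(2)[OF t] \<rho>(3)[of t] x0 A y by (intro pushed_point_in_shrink) auto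
        show "\<gamma> (Suc t) \<le> \<gamma> t"
          using t' \<gamma> x powr_neg_antimono[of t "Suc t" g] by simp
      qed (use t0 True in auto)
      also have "(\<Sum>t=t0..T. K * norm v * l t + ?se p t) \<le> (\<Sum>t=t0..T. h t)"
        using t0(1) C0(2) by (intro sum_mono) (auto simp: h_def)
      also have "\<dots> \<le> (\<Sum>t=1..T. h t)" using t0(1) h0 by (intro sum_mono2) auto
      finally show ?thesis by simp
    next
      case False
      then show ?thesis using gT h0 by (simp add: sum_nonneg)
    qed
    have "(\<Sum>t=1..T. gap t) \<le> 2 * B * real t0 + (\<Sum>t=t0..T. gap t)"
    proof -
      have "{1..T} = {1..<t0} \<inter> {1..T} \<union> {t0..T}" using t0(1) by auto
      then have "(\<Sum>t=1..T. gap t) = (\<Sum>t\<in>{1..<t0} \<inter> {1..T}. gap t) + (\<Sum>t=t0..T. gap t)"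
        by (metis (no_types, lifting) sum.union_disjoint finite_Int finite_atLeastLessThan finite_atLeastAtMost disjoint_iff IntD1 atLeastLessThan_iff atLeastAtMost_iff not_less)
      also have "(\<Sum>t\<in>{1..<t0} \<inter> {1..T}. gap t) \<le> (\<Sum>t\<in>{1..<t0} \<inter> {1..T}. 2 * B)"
        unfolding gap_def by (intro sum_mono expected_gap_le y)
      also have "\<dots> \<le> (\<Sum>t\<in>{0..<t0}. 2 * B)" using nonneg by (intro sum_mono2) auto
      also have "\<dots> = 2 * B * real t0" by simp
      finally show ?thesis by simp
    qed
    with tail have total: "(\<Sum>t=1..T. gap t) \<le> 2 * B * real t0 + 6 * R\<^sup>2 / \<gamma> T + (\<Sum>t=1..T. h t)" by linarith
    let ?x = "real T"
    have x1: "1 \<le> ?x" using T by simp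
    have a0: "2 * B * real t0 + 6 * R\<^sup>2 / \<gamma> T \<le> D0 * ?x powr g"
    proof -
      have "2 * B * real t0 * 1 \<le> 2 * B * real t0 * ?x powr g"
        using x1 x(1) nonneg by (intro mult_left_mono ge_one_powr_ge_zero) auto
      moreover have "6 * R\<^sup>2 / \<gamma> T = 6 * R\<^sup>2 / c\<gamma> * ?x powr g"
        unfolding \<gamma>(2)[OF T] by (simp add: powr_minus field_simps)
      ultimately show ?thesis by (simp add: D0_def algebra_simps)
    qed
    have a1: "(\<Sum>t=1..T. h t) \<le> (if bd then D4 * ?x powr (1 - r) else 0) + (D1 * ?x powr (1 - (g - 2 * s)) + D2 * ?x powr (1 - 2 * s) + D3 * ?x powr (1 - e))"
    proof -
      have hsum: "(\<Sum>t=1..T. h t) = (\<Sum>t=1..T. K * norm v * l t) + (C0 * (\<Sum>t=1..T. real t powr (- (g - 2 * s))) + C0 * (\<Sum>t=1..T. real t powr (- (2 * s))) + C0 * (\<Sum>t=1..T. real t powr (- e)))"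
        unfolding h_def by (simp add: sum.distrib sum_distrib_left distrib_left)
      have b: "C0 * (\<Sum>t=1..T. real t powr (- q)) \<le> C0 / (1 - q) * ?x powr (1 - q)" if "0 < q" "q < 1" for q
        using mult_left_mono[OF sum_powr_le[OF that T] C0(1)] by simp
      have "(\<Sum>t=1..T. K * norm v * l t) \<le> (if bd then D4 * ?x powr (1 - r) else 0)"
      proof (cases bd)
        case True
        have "(\<Sum>t=1..T. K * norm v * l t) = K * norm v * (c\<rho> / d) * (\<Sum>t=1..T. real t powr (- r))"
          unfolding sum_distrib_left by (rule sum.cong) (auto simp: l_def \<rho>(2))
        also have "\<dots> \<le> K * norm v * (c\<rho> / d) * (?x powr (1 - r) / (1 - r))"
          using nonneg \<rho>(1) x0(1) sum_powr_le[OF x(4,5) T] by (intro mult_left_mono) auto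
        finally show ?thesis using True by (simp add: D4_def)
      next
        case False
        then show ?thesis using x0(3) by (simp add: v_def)
      qed
      with b[of "g - 2 * s"] b[of "2 * s"] b[of e] x show ?thesis
        unfolding hsum D1_def D2_def D3_def by auto
    qed
    have dv: "?x powr (1 - q) / ?x = ?x powr (- q)" for q
      using x1 by (simp add: powr_diff powr_minus field_simps)
    have dg: "?x powr g / ?x = ?x powr (- (1 - g))" using dv[of "1 - g"] by simp
    have "expected_average_regret P J i a y T = (\<Sum>t=1..T. gap t) / ?x"
      unfolding gap_def by (rule expected_average_regret_eq[OF y(1)])
    also have "\<dots> \<le> (D0 * ?x powr g + ((if bd then D4 * ?x powr (1 - r) else 0) + (D1 * ?x powr (1 - (g - 2 * s)) + D2 * ?x powr (1 - 2 * s) + D3 * ?x powr (1 - e)))) / ?x"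
      using total a0 a1 x1 by (intro divide_right_mono) auto
    also have "\<dots> = D0 * ?x powr (- (1 - g)) + (if bd then D4 * ?x powr (- r) else 0) + D1 * ?x powr (- (g - 2 * s)) + D2 * ?x powr (- (2 * s)) + D3 * ?x powr (- e)"
      using dg dv[of r] dv[of "g - 2 * s"] dv[of "2 * s"] dv[of e]
      by (simp add: add_divide_distrib flip: times_divide_eq_right)
    also have "\<dots> \<le> ?C * ?x powr (- (1 - g)) + (if bd then ?C * ?x powr (- r) else 0) + ?C * ?x powr (- (g - 2 * s)) + ?C * ?x powr (- (2 * s)) + ?C * ?x powr (- e)"
      using D by (intro add_mono mult_right_mono) (auto intro!: mult_right_mono)
    also have "\<dots> = ?C * regret_terms bd (g, s, r, e) T"
      by (simp add: regret_terms_def distrib_left)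
    finally show ?thesis .
  qed
  show ?thesis by (rule exI[of _ ?C]) (use main in blast)
qed


section \<open>Regularity of the cost functions\<close>

lemma continuously_differentiable_lipschitz:
  fixes f :: "'a::real_normed_vector \<Rightarrow> 'b::real_normed_vector"
  assumes f: "continuously_differentiable f" and C: "compact C" "convex C"
  obtains L where "L-lipschitz_on C f"
proof -
  obtain f' where f': "\<And>x. (f has_derivative blinfun_apply (f' x)) (at x)" "continuous_on UNIV f'"
    using f by (auto simp: continuously_differentiable_def)
  have "compact (f' ` C)" using C(1) f'(2) by (intro compact_continuous_image) (auto intro: continuous_on_subset)
  then have "bounded (f' ` C)" by (rule compact_imp_bounded)
  then obtain L where L: "\<And>x. x \<in> C \<Longrightarrow> norm (f' x) \<le> L" unfolding bounded_iff by blast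
  have "(max L 0)-lipschitz_on C f"
  proof (rule lipschitz_onI)
    fix x y assume x: "x \<in> C" and y: "y \<in> C"
    have "norm (f x - f y) \<le> max L 0 * norm (x - y)"
    proof (rule differentiable_bound[OF C(2) _ _ x y])
      fix z assume z: "z \<in> C"
      show "(f has_derivative blinfun_apply (f' z)) (at z within C)"
        using f'(1) by (rule has_derivative_at_withinI)
      show "onorm (blinfun_apply (f' z)) \<le> max L 0" using L[OF z] by (simp add: norm_blinfun.rep_eq)
    qed
    then show "dist (f x) (f y) \<le> max L 0 * dist x y" by (simp add: dist_norm)
  qed simp
  then show ?thesis by (rule that)
qed

lemma continuously_differentiable_continuous:
  assumes "continuously_differentiable f" shows "continuous_on UNIV f"
proof -
  obtain f' where "\<And>x. (f has_derivative blinfun_apply (f' x)) (at x)"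
    using assms by (auto simp: continuously_differentiable_def)
  then have "isCont f x" for x by (rule has_derivative_continuous)
  then show ?thesis by (intro continuous_at_imp_continuous_on) blast
qed

lemma norm_axis_vec [simp]: "norm (axis i x :: 'a::real_inner^'n::finite) = norm x"
  by (simp add: norm_eq_sqrt_inner inner_axis_axis)

lemma deviate_diff: "deviate b i x - deviate b i y = axis i (x - y)"
  by (auto simp: vec_eq_iff axis_def)

lemma deviate_eq: "deviate b i x = deviate b i 0 + axis i x"
  by (auto simp: vec_eq_iff axis_def)

lemma gradient_exists:
  fixes \<phi> :: "'a::euclidean_space \<Rightarrow> real"
  assumes "(f has_derivative \<phi>) (at x)"
  obtains D where "GDERIV f x :> D"
proof -
  have "linear \<phi>" using assms by (rule has_derivative_linear)
  then have "\<phi> = (\<lambda>h. h \<bullet> adjoint \<phi> 1)" by (intro ext) (simp add: adjoint_works)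
  with assms have "GDERIV f x :> adjoint \<phi> 1" unfolding gderiv_def by (rule back_subst)
  then show ?thesis by (rule that)
qed

lemma gradient_unique:
  assumes "GDERIV f x :> D" "GDERIV f x :> E" shows "D = E"
proof -
  have "(\<lambda>h. h \<bullet> D) = (\<lambda>h. h \<bullet> E)"
    using assms unfolding gderiv_def by (rule has_derivative_unique)
  then show ?thesis by (metis vector_eq_ldot)
qed

text \<open>The pseudo-gradient is defined by a definite description; differentiability of the cost makes it a genuine gradient.\<close>

lemma slice_gradient:
  fixes J :: "('d::finite, 'n::finite) costs"
  assumes "continuously_differentiable (J i)"
  shows "GDERIV (\<lambda>x. J i (deviate b i x)) x :> pseudo_gradient J (deviate b i x) $ i"
proof -
  let ?f = "\<lambda>x. J i (deviate b i x)"
  obtain J' where J': "\<And>x. (J i has_derivative blinfun_apply (J' x)) (at x)"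
    using assms by (auto simp: continuously_differentiable_def)
  have "bounded_linear (axis i :: real^'d \<Rightarrow> real^'d^'n)"
  proof (rule bounded_linear_intro[of _ 1])
    show "axis i (x + y) = axis i x + (axis i y :: real^'d^'n)" for x y by (auto simp: vec_eq_iff axis_def)
    show "axis i (c *\<^sub>R x) = c *\<^sub>R (axis i x :: real^'d^'n)" for c x by (auto simp: vec_eq_iff axis_def)
  qed simp
  then have "((\<lambda>x. deviate b i 0 + axis i x) has_derivative (\<lambda>h. 0 + axis i h)) (at x)"
    by (intro has_derivative_add has_derivative_const bounded_linear_imp_has_derivative)
  then have "((\<lambda>x. deviate b i x) has_derivative (\<lambda>h. axis i h)) (at x)"
    unfolding deviate_eq[of b i, symmetric] by (simp only: add_0)
  then have "(?f has_derivative (\<lambda>h. blinfun_apply (J' (deviate b i x)) (axis i h))) (at x)"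
    by (rule has_derivative_compose) (rule J')
  then obtain D where D: "GDERIV ?f x :> D" by (rule gradient_exists)
  then have "(THE D. GDERIV ?f x :> D) = D" by (blast intro: gradient_unique)
  with D show ?thesis by (simp add: pseudo_gradient_def)
qed

text \<open>The mean value inequality for \<open>f\<close> minus its linear part at \<open>y\<close>, whose gradient on the segment is at most
\<open>L * norm (z - y)\<close>.\<close>

lemma first_order_remainder:
  fixes f :: "'a::euclidean_space \<Rightarrow> real"
  assumes g: "\<And>z. GDERIV f z :> g z" and lip: "L-lipschitz_on S g" and S: "convex S" and y: "y \<in> S" and z: "z \<in> S"
  shows "\<bar>f z - f y - (z - y) \<bullet> g y\<bar> \<le> L * (norm (z - y))\<^sup>2"
proof -
  have L: "0 \<le> L" using lip by (rule lipschitz_on_nonneg)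
  let ?h = "\<lambda>w. f w - w \<bullet> g y"
  have sub: "closed_segment y z \<subseteq> S" using S y z by (rule closed_segment_subset[rotated 2])
  have "norm (?h z - ?h y) \<le> (L * norm (z - y)) * norm (z - y)"
  proof (rule differentiable_bound[where S = "closed_segment y z" and f' = "\<lambda>w h. h \<bullet> (g w - g y)"])
    fix w assume w: "w \<in> closed_segment y z"
    have "(?h has_derivative (\<lambda>h. h \<bullet> g w - h \<bullet> g y)) (at w within closed_segment y z)"
    proof (rule has_derivative_diff)
      show "(f has_derivative (\<lambda>h. h \<bullet> g w)) (at w within closed_segment y z)"
        using g[of w] unfolding gderiv_def by (rule has_derivative_at_withinI)
      show "((\<lambda>w. w \<bullet> g y) has_derivative (\<lambda>h. h \<bullet> g y)) (at w within closed_segment y z)"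
        by (rule bounded_linear_imp_has_derivative[OF bounded_linear_inner_left])
    qed
    then show "(?h has_derivative (\<lambda>h. h \<bullet> (g w - g y))) (at w within closed_segment y z)"
      by (simp add: inner_diff_right)
    have "norm (g w - g y) \<le> L * norm (w - y)"
      using lipschitz_onD[OF lip, of w y] w sub y by (auto simp: dist_norm)
    also have "\<dots> \<le> L * norm (z - y)"
      using segment_bound(1)[OF w] L by (intro mult_left_mono) (auto simp: norm_minus_commute)
    finally have le: "norm (g w - g y) \<le> L * norm (z - y)" .
    show "onorm (\<lambda>h. h \<bullet> (g w - g y)) \<le> L * norm (z - y)"
    proof (rule onorm_bound)
      fix h
      have "\<bar>h \<bullet> (g w - g y)\<bar> \<le> norm h * (L * norm (z - y))"
        by (rule order.trans[OF Cauchy_Schwarz_ineq2 mult_left_mono[OF le]]) simp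
      then show "norm (h \<bullet> (g w - g y)) \<le> L * norm (z - y) * norm h" by (simp add: mult_ac)
    qed (simp add: L)
  qed auto
  moreover have "?h z - ?h y = f z - f y - (z - y) \<bullet> g y" by (simp add: inner_diff_left)
  ultimately show ?thesis by (simp add: power2_eq_square mult.assoc)
qed

lemma compact_convex_profile_ball:
  "compact {p :: real^'d::finite^'n::finite. \<forall>j. norm (p $ j) \<le> r}" "convex {p :: real^'d::finite^'n::finite. \<forall>j. norm (p $ j) \<le> r}"
proof -
  have "bounded {p :: real^'d^'n. \<forall>j. norm (p $ j) \<le> r}"
    unfolding bounded_iff
  proof (intro exI ballI)
    fix p :: "real^'d^'n" assume p: "p \<in> {p. \<forall>j. norm (p $ j) \<le> r}"
    have "norm p \<le> (\<Sum>j\<in>UNIV. norm (p $ j))" unfolding norm_vec_def by (rule L2_set_le_sum) simp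
    also have "\<dots> \<le> (\<Sum>j\<in>(UNIV::'n set). r)" using p by (intro sum_mono) auto
    finally show "norm p \<le> (\<Sum>j\<in>(UNIV::'n set). r)" .
  qed
  moreover have "closed {p :: real^'d^'n. \<forall>j. norm (p $ j) \<le> r}"
    by (intro closed_Collect_all closed_Collect_le continuous_intros)
  ultimately show "compact {p :: real^'d^'n. \<forall>j. norm (p $ j) \<le> r}" by (simp add: compact_eq_bounded_closed)
  show "convex {p :: real^'d^'n. \<forall>j. norm (p $ j) \<le> r}"
  proof (rule convexI)
    fix x y :: "real^'d^'n" and u v :: real
    assume x: "x \<in> {p. \<forall>j. norm (p $ j) \<le> r}" and y: "y \<in> {p. \<forall>j. norm (p $ j) \<le> r}" and uv: "0 \<le> u" "0 \<le> v" "u + v = 1"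
    show "u *\<^sub>R x + v *\<^sub>R y \<in> {p. \<forall>j. norm (p $ j) \<le> r}"
    proof (rule CollectI, rule allI)
      fix j
      have "u *\<^sub>R (x $ j) + v *\<^sub>R (y $ j) \<in> cball 0 r"
        using x y uv by (intro convexD[OF convex_cball]) auto
      then show "norm ((u *\<^sub>R x + v *\<^sub>R y) $ j) \<le> r" by simp
    qed
  qed
qed

text \<open>All bounds come from compactness of the set of joint actions whose components have norm at most \<open>R + 1\<close>, on which the cost and the pseudo-gradient
are Lipschitz. The constants do not depend on the actions \<open>b\<close> of the opponents.\<close>

lemma game_regular:
  fixes A :: "('d::finite, 'n::finite) action_sets" and J :: "('d, 'n) costs"
  assumes game: "convex_game A J" and smooth: "smooth_growth_game J"
  obtains R B K Q where "0 \<le> R" "0 \<le> B" "0 \<le> K" "0 \<le> Q" "\<And>j. A j \<subseteq> cball 0 R"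
    "\<And>b. (\<And>j. b $ j \<in> A j) \<Longrightarrow> regular_cost R B K Q (\<lambda>x. J i (deviate b i x))"
proof -
  have A: "compact (A j)" for j using game by (simp add: convex_game_def)
  have J: "continuously_differentiable (J i)" and cv: "convex_on UNIV (\<lambda>x. J i (deviate b i x))" for b
    using game by (auto simp: convex_game_def)
  have M: "continuously_differentiable (pseudo_gradient J)" using smooth by (simp add: smooth_growth_game_def)
  have "bounded (\<Union>j. A j)" using A by (intro bounded_UN) (auto intro: compact_imp_bounded)
  then obtain R where R: "0 < R" "\<And>x. x \<in> (\<Union>j. A j) \<Longrightarrow> norm x \<le> R" by (auto simp: bounded_pos)
  have AR: "A j \<subseteq> cball 0 R" for j
  proof
    fix x assume "x \<in> A j"
    then have "x \<in> (\<Union>j. A j)" by blast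
    then show "x \<in> cball 0 R" using R(2) by simp
  qed
  let ?C = "{p :: real^'d^'n. \<forall>j. norm (p $ j) \<le> R + 1}"
  note C = compact_convex_profile_ball[where r = "R + 1", where 'd='d and 'n='n]
  obtain K where K: "K-lipschitz_on ?C (J i)" by (rule continuously_differentiable_lipschitz[OF J C])
  obtain L where L: "L-lipschitz_on ?C (pseudo_gradient J)" by (rule continuously_differentiable_lipschitz[OF M C])
  have K0: "0 \<le> K" and L0: "0 \<le> L" using K L lipschitz_on_nonneg by auto
  have "compact (J i ` ?C)" using C(1) lipschitz_on_continuous_on[OF K] by (intro compact_continuous_image)
  then obtain B where B: "0 < B" "\<And>p. p \<in> ?C \<Longrightarrow> \<bar>J i p\<bar> \<le> B" by (auto dest!: compact_imp_bounded simp: bounded_pos)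
  have reg: "regular_cost R B K (2 * L) (\<lambda>x. J i (deviate b i x))" if b: "\<And>j. b $ j \<in> A j" for b
  proof -
    let ?f = "\<lambda>x. J i (deviate b i x)" and ?g = "\<lambda>x. pseudo_gradient J (deviate b i x) $ i"
    have dC: "deviate b i x \<in> ?C" if "x \<in> cball 0 (R + 1)" for x
    proof -
      have "norm (b $ j) \<le> R + 1" for j using b[of j] AR[of j] by auto
      then show ?thesis using that by auto
    qed
    have dd: "dist (deviate b i x) (deviate b i y) = dist x y" for x y
      by (simp add: dist_norm deviate_diff)
    have lf: "K-lipschitz_on (cball 0 (R + 1)) ?f"
    proof (rule lipschitz_onI)
      fix x y :: "real^'d" assume "x \<in> cball 0 (R + 1)" "y \<in> cball 0 (R + 1)"
      then show "dist (?f x) (?f y) \<le> K * dist x y"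
        using lipschitz_onD[OF K dC dC, of x y] by (simp only: dd)
    qed (rule K0)
    have lg: "L-lipschitz_on (cball 0 (R + 1)) ?g"
    proof (rule lipschitz_onI)
      fix x y :: "real^'d" assume xy: "x \<in> cball 0 (R + 1)" "y \<in> cball 0 (R + 1)"
      have "dist (?g x) (?g y) \<le> dist (pseudo_gradient J (deviate b i x)) (pseudo_gradient J (deviate b i y))"
        by (rule dist_vec_nth_le)
      also have "\<dots> \<le> L * dist x y"
        using lipschitz_onD[OF L dC dC, of x y] xy by (simp only: dd)
      finally show "dist (?g x) (?g y) \<le> L * dist x y" .
    qed (rule L0)
    have "?f (y + x) + ?f (y - x) \<le> 2 * ?f y + 2 * L * (norm x)\<^sup>2" if y: "y \<in> cball 0 R" and x: "norm x \<le> 1" for x y :: "real^'d"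
    proof -
      have m: "y \<in> cball 0 (R + 1)" "y + x \<in> cball 0 (R + 1)" "y - x \<in> cball 0 (R + 1)"
        using y x norm_triangle_ineq[of y x] norm_triangle_ineq4[of y x] by auto
      have minus_x: "y - x - y = - x" by simp
      note rem = first_order_remainder[OF slice_gradient[of J i b, OF J] lg convex_cball m(1)]
      have "\<bar>?f (y + x) - ?f y - x \<bullet> ?g y\<bar> \<le> L * (norm x)\<^sup>2"
        using rem[OF m(2)] by (simp only: add_diff_cancel_left')
      moreover have "\<bar>?f (y - x) - ?f y - (- x) \<bullet> ?g y\<bar> \<le> L * (norm x)\<^sup>2"
        using rem[OF m(3)] unfolding minus_x norm_minus_cancel .
      ultimately show ?thesis unfolding inner_minus_left by linarith
    qed
    moreover have "\<forall>x\<in>cball 0 (R + 1). \<bar>?f x\<bar> \<le> B" 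
      using B(2)[OF dC] by (intro ballI)
    ultimately show ?thesis unfolding regular_cost_def using cv lf by blast
  qed
  have "0 \<le> R" "0 \<le> B" "0 \<le> 2 * L" using R(1) B(1) L0 by auto
  from that[OF this(1,2) K0 this(3) AR reg] show ?thesis .
qed

section \<open>The two information structures\<close>

lemma unilateral_run_bandit_run:
  fixes A :: "('d::finite, 'n::finite) action_sets" and J :: "('d, 'n) costs"
  assumes P: "prob_space P" and run: "unilateral_run P A J \<gamma> \<sigma> \<rho> \<epsilon> i a"
    and game: "convex_game A J" and R: "0 \<le> R" "0 \<le> Q" "A i \<subseteq> cball 0 R"
    and reg: "\<And>b. (\<And>j. b $ j \<in> A j) \<Longrightarrow> regular_cost R B K Q (\<lambda>x. J i (deviate b i x))"
    and pos: "\<And>t. \<gamma> t > 0" "\<And>t. \<sigma> t > 0" "\<And>t. \<rho> t > 0" "\<And>t. \<epsilon> t > 0"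
    and shr: "shrinkage_ok \<rho> (A i)"
  obtains F \<mu>0 \<xi> \<mu> where "bandit_run P F A J \<gamma> \<sigma> \<rho> \<epsilon> i \<mu>0 \<xi> \<mu> a R B K Q"
proof -
  interpret prob_space P by (rule P)
  define G where "G \<xi> t = {\<xi> u |u. u < t} \<union> {\<lambda>w. a u w $ j |u j. u \<le> t \<and> j \<noteq> i}" for \<xi> :: "nat \<Rightarrow> 'a \<Rightarrow> real^'d" and t
  obtain \<mu>0 \<xi> \<mu> where alg: "follows_algorithm P A J \<gamma> \<sigma> \<rho> \<epsilon> i \<mu>0 (\<lambda>t. generated P (G \<xi> t)) \<xi> \<mu> a"
    and a: "\<And>j t. (\<lambda>w. a t w $ j) \<in> borel_measurable P" "\<And>j t w. w \<in> space P \<Longrightarrow> a t w $ j \<in> A j"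
    using run by (auto simp: unilateral_run_def G_def)
  have \<xi>: "\<xi> t \<in> borel_measurable P" for t using alg by (simp add: follows_algorithm_def cond_gaussian_def)
  have "bandit_run P (\<lambda>t. generated P (G \<xi> t)) A J \<gamma> \<sigma> \<rho> \<epsilon> i \<mu>0 \<xi> \<mu> a R B K Q"
  proof (intro bandit_run.intro bandit_run_axioms.intro)
    fix t
    show "subalgebra P (generated P (G \<xi> t))" by (rule subalgebra_generated) (auto simp: G_def a \<xi>)
    show "subalgebra (generated P (G \<xi> (Suc t))) (generated P (G \<xi> t))"
      unfolding G_def by (rule subalgebra_generated_mono, rule Un_mono) (blast intro: less_SucI le_SucI)+
    show "\<xi> t \<in> borel_measurable (generated P (G \<xi> (Suc t)))" by (rule measurable_generated) (auto simp: G_def)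
    show "(\<lambda>w. a t w $ j) \<in> borel_measurable (generated P (G \<xi> t))" if "j \<noteq> i" for j
      by (rule measurable_generated) (use that in \<open>auto simp: G_def\<close>)
    show "continuous_on UNIV (J i)" using game by (auto simp: convex_game_def intro: continuously_differentiable_continuous)
    show "shrink (\<rho> t) (A i) \<noteq> {}" 
      using shr unfolding shrinkage_ok_def by (metis interior_empty)
    show "convex (A i)" "compact (A i)" using game by (auto simp: convex_game_def)
    show "regular_cost R B K Q (\<lambda>x. J i (deviate b i x))" if "\<And>j. b $ j \<in> A j" for b
      using that by (rule reg)
  qed (assumption | rule P alg a(2) R pos)+
  then show ?thesis by (rule that)
qed

lemma collective_run_bandit_run:
  fixes A :: "('d::finite, 'n::finite) action_sets" and J :: "('d, 'n) costs"
  assumes P: "prob_space P" and run: "collective_run P A J \<gamma> \<sigma> \<rho> \<epsilon> a"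
    and game: "convex_game A J" and R: "0 \<le> R" "0 \<le> Q" "A i \<subseteq> cball 0 R"
    and reg: "\<And>b. (\<And>j. b $ j \<in> A j) \<Longrightarrow> regular_cost R B K Q (\<lambda>x. J i (deviate b i x))"
    and pos: "\<And>t. \<gamma> t > 0" "\<And>t. \<sigma> t > 0" "\<And>t. \<rho> t > 0" "\<And>t. \<epsilon> t > 0"
    and shr: "shrinkage_ok \<rho> (A i)"
  obtains F \<mu>0 \<xi> \<mu> where "bandit_run P F A J \<gamma> \<sigma> \<rho> \<epsilon> i \<mu>0 \<xi> \<mu> a R B K Q"
proof -
  interpret prob_space P by (rule P)
  define G where "G \<xi> t = {\<xi> j u |j u. u < t} \<union> {\<xi> j t |j. j \<noteq> i}" for \<xi> :: "'n \<Rightarrow> nat \<Rightarrow> 'a \<Rightarrow> real^'d" and t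
  obtain \<mu>0 \<xi> \<mu> where all: "\<forall>i. follows_algorithm P A J \<gamma> \<sigma> \<rho> \<epsilon> i (\<mu>0 i)
        (\<lambda>t. generated P ({\<xi> j u |j u. u < t} \<union> {\<xi> j t |j. j \<noteq> i})) (\<xi> i) (\<mu> i) a"
    using run unfolding collective_run_def by blast
  have alg: "follows_algorithm P A J \<gamma> \<sigma> \<rho> \<epsilon> i (\<mu>0 i) (\<lambda>t. generated P (G \<xi> t)) (\<xi> i) (\<mu> i) a"
    using all unfolding G_def by blast
  have \<xi>: "\<xi> j t \<in> borel_measurable P" for j t using all by (simp add: follows_algorithm_def cond_gaussian_def)
  have act: "a t w $ j = closest_point (A j) (\<xi> j t w)" if "w \<in> space P" for t w j
    using all that by (simp add: follows_algorithm_def)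
  have A: "convex (A j)" "compact (A j)" "interior (A j) \<noteq> {}" for j using game by (auto simp: convex_game_def)
  have ne: "A j \<noteq> {}" for j using A(3)[of j] by auto
  have cl: "closed (A j)" for j using A(2) by (rule compact_imp_closed)
  have "bandit_run P (\<lambda>t. generated P (G \<xi> t)) A J \<gamma> \<sigma> \<rho> \<epsilon> i (\<mu>0 i) (\<xi> i) (\<mu> i) a R B K Q"
  proof (intro bandit_run.intro bandit_run_axioms.intro)
    fix t
    show "subalgebra P (generated P (G \<xi> t))" by (rule subalgebra_generated) (auto simp: G_def \<xi>)
    show "subalgebra (generated P (G \<xi> (Suc t))) (generated P (G \<xi> t))"
      unfolding G_def by (rule subalgebra_generated_mono) (blast intro: less_SucI lessI)
    show "\<xi> i t \<in> borel_measurable (generated P (G \<xi> (Suc t)))" by (rule measurable_generated) (auto simp: G_def)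
    show "(\<lambda>w. a t w $ j) \<in> borel_measurable (generated P (G \<xi> t))" if "j \<noteq> i" for j
    proof -
      have "\<xi> j t \<in> borel_measurable (generated P (G \<xi> t))"
        by (rule measurable_generated) (use that in \<open>auto simp: G_def\<close>)
      moreover have "closest_point (A j) \<in> borel_measurable borel"
        by (intro borel_measurable_continuous_onI continuous_on_closest_point A cl ne)
      ultimately have "(\<lambda>w. closest_point (A j) (\<xi> j t w)) \<in> borel_measurable (generated P (G \<xi> t))"
        by (rule measurable_compose)
      then show ?thesis
        by (subst measurable_cong[where g = "\<lambda>w. closest_point (A j) (\<xi> j t w)"]) (auto simp: act)
    qed
    show "a t w $ j \<in> A j" if "w \<in> space P" for w j
      unfolding act[OF that] by (rule closest_point_in_set[OF cl ne])
    show "continuous_on UNIV (J i)" using game by (auto simp: convex_game_def intro: continuously_differentiable_continuous)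
    show "shrink (\<rho> t) (A i) \<noteq> {}" 
      using shr unfolding shrinkage_ok_def by (metis interior_empty)
    show "regular_cost R B K Q (\<lambda>x. J i (deviate b i x))" if "\<And>j. b $ j \<in> A j" for b
      using that by (rule reg)
  qed (assumption | rule P alg A R pos)+
  then show ?thesis by (rule that)
qed

lemma parameters_pos:
  assumes "parameters x \<gamma> \<sigma> \<rho> \<epsilon>"
  shows "\<gamma> t > 0" "\<sigma> t > 0" "\<rho> t > 0" "\<epsilon> t > 0"
  using assms by (auto simp: parameters_def power_sequence_def split: prod.splits)

text \<open>Both scenarios are instances of the same regret bound; in the collective one the actions of the others are
functions of their current samples, which belong to the information of player \<open>i\<close>.\<close>

lemma regret_bounds:
  fixes A :: "('d::finite, 'n::finite) action_sets" and J :: "('d, 'n) costs"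
  assumes game: "convex_game A J" and smooth: "smooth_growth_game J"
    and x: "x \<in> unilateral_exponents" and y: "y \<in> A i" "\<not> bd \<Longrightarrow> y \<in> interior (A i)"
  shows "unilateral_bound TYPE('w) A J i y x (regret_terms bd x)"
    and "collective_bound TYPE('w) A J i y x (regret_terms bd x)"
proof -
  obtain R B K Q where reg: "0 \<le> R" "0 \<le> B" "0 \<le> K" "0 \<le> Q" "\<And>j. A j \<subseteq> cball 0 R"
    "\<And>b. (\<And>j. b $ j \<in> A j) \<Longrightarrow> regular_cost R B K Q (\<lambda>x. J i (deviate b i x))"
    using game_regular[OF game smooth, of i] by blast
  obtain g s r e where x_eq: "x = (g, s, r, e)" by (cases x)
  have ex: "0 < g" "g < 1" "0 < s" "0 < r" "r < 1" "0 < e" "e < 1" "r < s" "0 < g - 2 * s"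
    using x by (auto simp: x_eq unilateral_exponents_def unit_exponents_def)
  have A: "compact (A i)" "convex (A i)" "interior (A i) \<noteq> {}" using game by (auto simp: convex_game_def)
  have rate: "\<exists>C. \<forall>(P :: 'w measure) F \<mu>0 \<xi> \<mu> a. bandit_run P F A J \<gamma> \<sigma> \<rho> \<epsilon> i \<mu>0 \<xi> \<mu> a R B K Q \<longrightarrow>
      (\<forall>T\<ge>1. expected_average_regret P J i a y T \<le> C * regret_terms bd x T)"
    if "parameters x \<gamma> \<sigma> \<rho> \<epsilon>" for \<gamma> \<sigma> \<rho> \<epsilon>
    unfolding x_eq using that[unfolded x_eq] ex A reg(5)[of i] reg(1,3,4,2) y by (rule bandit_regret_rate)
  show "unilateral_bound TYPE('w) A J i y x (regret_terms bd x)"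
    unfolding unilateral_bound_def
  proof (intro allI impI, elim conjE)
    fix \<gamma> \<sigma> \<rho> \<epsilon> assume par: "parameters x \<gamma> \<sigma> \<rho> \<epsilon>" and shr: "shrinkage_ok \<rho> (A i)"
    obtain C where C: "\<And>(P :: 'w measure) F \<mu>0 \<xi> \<mu> a T. bandit_run P F A J \<gamma> \<sigma> \<rho> \<epsilon> i \<mu>0 \<xi> \<mu> a R B K Q \<Longrightarrow> 1 \<le> T \<Longrightarrow>
        expected_average_regret P J i a y T \<le> C * regret_terms bd x T"
      using rate[OF par] by blast
    show "\<exists>C. \<forall>(P :: 'w measure) a. prob_space P \<and> unilateral_run P A J \<gamma> \<sigma> \<rho> \<epsilon> i a \<longrightarrow>
           (\<forall>T\<ge>1. expected_average_regret P J i a y T \<le> C * regret_terms bd x T)"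
    proof (intro exI[of _ C] allI impI, elim conjE)
      fix P :: "'w measure" and a and T :: nat
      assume "prob_space P" "unilateral_run P A J \<gamma> \<sigma> \<rho> \<epsilon> i a" and T: "1 \<le> T"
      from unilateral_run_bandit_run[OF this(1,2) game reg(1,4,5,6) parameters_pos[OF par] shr]
      obtain F \<mu>0 \<xi> \<mu> where "bandit_run P F A J \<gamma> \<sigma> \<rho> \<epsilon> i \<mu>0 \<xi> \<mu> a R B K Q" by blast
      then show "expected_average_regret P J i a y T \<le> C * regret_terms bd x T" using T by (rule C)
    qed
  qed
  show "collective_bound TYPE('w) A J i y x (regret_terms bd x)"
    unfolding collective_bound_def
  proof (intro allI impI, elim conjE)
    fix \<gamma> \<sigma> \<rho> \<epsilon> assume par: "parameters x \<gamma> \<sigma> \<rho> \<epsilon>" and shr: "\<forall>j. shrinkage_ok \<rho> (A j)"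
    obtain C where C: "\<And>(P :: 'w measure) F \<mu>0 \<xi> \<mu> a T. bandit_run P F A J \<gamma> \<sigma> \<rho> \<epsilon> i \<mu>0 \<xi> \<mu> a R B K Q \<Longrightarrow> 1 \<le> T \<Longrightarrow>
        expected_average_regret P J i a y T \<le> C * regret_terms bd x T"
      using rate[OF par] by blast
    show "\<exists>C. \<forall>(P :: 'w measure) a. prob_space P \<and> collective_run P A J \<gamma> \<sigma> \<rho> \<epsilon> a \<longrightarrow>
           (\<forall>T\<ge>1. expected_average_regret P J i a y T \<le> C * regret_terms bd x T)"
    proof (intro exI[of _ C] allI impI, elim conjE)
      fix P :: "'w measure" and a and T :: nat
      assume "prob_space P" "collective_run P A J \<gamma> \<sigma> \<rho> \<epsilon> a" and T: "1 \<le> T"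
      from collective_run_bandit_run[OF this(1,2) game reg(1,4,5,6) parameters_pos[OF par] shr[rule_format]]
      obtain F \<mu>0 \<xi> \<mu> where "bandit_run P F A J \<gamma> \<sigma> \<rho> \<epsilon> i \<mu>0 \<xi> \<mu> a R B K Q" by blast
      then show "expected_average_regret P J i a y T \<le> C * regret_terms bd x T" using T by (rule C)
    qed
  qed
qed


section \<open>From rate terms to guaranteed exponents\<close>

lemma regret_terms_nonneg: "0 \<le> regret_terms bd x T"
  by (cases x) (auto simp: regret_terms_def)

lemma guaranteed_exponent_le:
  "guaranteed_exponent bd (g, s, r, e) \<le> 1 - g" "guaranteed_exponent bd (g, s, r, e) \<le> g - 2 * s"
  "guaranteed_exponent bd (g, s, r, e) \<le> 2 * s" "guaranteed_exponent bd (g, s, r, e) \<le> e"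
  "bd \<Longrightarrow> guaranteed_exponent bd (g, s, r, e) \<le> r"
  by (auto simp only: guaranteed_exponent_def prod.case split: if_split intro!: Min_le)

lemma guaranteed_exponent_ge:
  assumes "b \<le> 1 - g" "b \<le> g - 2 * s" "b \<le> 2 * s" "bd \<Longrightarrow> b \<le> r" "b \<le> e"
  shows "b \<le> guaranteed_exponent bd (g, s, r, e)"
  using assms by (cases bd) (simp_all add: guaranteed_exponent_def)

lemma regret_terms_le_power:
  assumes "b \<le> guaranteed_exponent bd x" and T: "1 \<le> T"
  shows "regret_terms bd x T \<le> 5 * real T powr (- b)"
proof -
  obtain g s r e where x: "x = (g, s, r, e)" by (cases x)
  have le: "real T powr (- q) \<le> real T powr (- b)" if "b \<le> q" for q
    using that T by (intro powr_mono) auto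
  note ge = guaranteed_exponent_le[of bd g s r e, folded x]
  have "(if bd then real T powr (- r) else 0) \<le> real T powr (- b)"
  proof (cases bd)
    case True
    have "b \<le> r" using ge(5)[OF True] assms(1) by linarith
    from le[OF this] show ?thesis using True by (simp only: if_True)
  qed simp
  moreover have "real T powr (- (1 - g)) \<le> real T powr (- b)" "real T powr (- (g - 2 * s)) \<le> real T powr (- b)"
    "real T powr (- (2 * s)) \<le> real T powr (- b)" "real T powr (- e) \<le> real T powr (- b)"
    using ge(1-4)[THEN order.trans[OF assms(1)]] by (blast intro: le)+
  ultimately show ?thesis unfolding x regret_terms_def prod.case by linarith
qed

text \<open>The regret may be negative, and then \<open>C\<close> may be negative too; the maximum restores monotonicity.\<close>

lemma bound_constant_transfer:
  fixes X :: real
  assumes "0 \<le> f" "f \<le> c * h" "X \<le> C * f"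
  shows "X \<le> max C 0 * c * h"
proof -
  have "X \<le> max C 0 * f" using assms by (meson max.cobounded1 mult_right_mono order_trans)
  also have "\<dots> \<le> max C 0 * (c * h)" using assms by (intro mult_left_mono) auto
  finally show ?thesis by (simp add: mult.assoc)
qed

lemma uniform_bound_mono:
  fixes X :: "'p \<Rightarrow> 'a \<Rightarrow> nat \<Rightarrow> real"
  assumes "\<exists>C. \<forall>P a. Run P a \<longrightarrow> (\<forall>T\<ge>1. X P a T \<le> C * f T)"
    and f: "\<And>T. 1 \<le> T \<Longrightarrow> 0 \<le> f T" "\<And>T. 1 \<le> T \<Longrightarrow> f T \<le> c * h T"
  shows "\<exists>C. \<forall>P a. Run P a \<longrightarrow> (\<forall>T\<ge>1. X P a T \<le> C * h T)"
proof -
  obtain C where "\<forall>P a. Run P a \<longrightarrow> (\<forall>T\<ge>1. X P a T \<le> C * f T)" using assms(1) ..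
  then have C: "X P a T \<le> C * f T" if "Run P a" "1 \<le> T" for P a T using that by blast
  show ?thesis
  proof (intro exI[of _ "max C 0 * c"] allI impI)
    fix P a and T :: nat
    assume "Run P a" and T: "1 \<le> T"
    from bound_constant_transfer[OF f[OF T] C[OF this]] show "X P a T \<le> max C 0 * c * h T" .
  qed
qed

lemma unilateral_bound_mono:
  fixes W :: "'w itself"
  assumes b: "unilateral_bound W A J i y x f"
    and f: "\<And>T. 1 \<le> T \<Longrightarrow> 0 \<le> f T" "\<And>T. 1 \<le> T \<Longrightarrow> f T \<le> c * h T"
  shows "unilateral_bound W A J i y x h"
  unfolding unilateral_bound_def
proof (intro allI impI)
  fix \<gamma> \<sigma> \<rho> \<epsilon> assume "parameters x \<gamma> \<sigma> \<rho> \<epsilon> \<and> shrinkage_ok \<rho> (A i)"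
  with b have "\<exists>C. \<forall>(P :: 'w measure) a. prob_space P \<and> unilateral_run P A J \<gamma> \<sigma> \<rho> \<epsilon> i a \<longrightarrow>
      (\<forall>T\<ge>1. expected_average_regret P J i a y T \<le> C * f T)"
    unfolding unilateral_bound_def by (elim allE impE)
  then show "\<exists>C. \<forall>(P :: 'w measure) a. prob_space P \<and> unilateral_run P A J \<gamma> \<sigma> \<rho> \<epsilon> i a \<longrightarrow>
      (\<forall>T\<ge>1. expected_average_regret P J i a y T \<le> C * h T)"
    by (rule uniform_bound_mono[OF _ f])
qed

lemma collective_bound_mono:
  fixes W :: "'w itself"
  assumes b: "collective_bound W A J i y x f"
    and f: "\<And>T. 1 \<le> T \<Longrightarrow> 0 \<le> f T" "\<And>T. 1 \<le> T \<Longrightarrow> f T \<le> c * h T"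
  shows "collective_bound W A J i y x h"
  unfolding collective_bound_def
proof (intro allI impI)
  fix \<gamma> \<sigma> \<rho> \<epsilon> assume "parameters x \<gamma> \<sigma> \<rho> \<epsilon> \<and> (\<forall>j. shrinkage_ok \<rho> (A j))"
  with b have "\<exists>C. \<forall>(P :: 'w measure) a. prob_space P \<and> collective_run P A J \<gamma> \<sigma> \<rho> \<epsilon> a \<longrightarrow>
      (\<forall>T\<ge>1. expected_average_regret P J i a y T \<le> C * f T)"
    unfolding collective_bound_def by (elim allE impE)
  then show "\<exists>C. \<forall>(P :: 'w measure) a. prob_space P \<and> collective_run P A J \<gamma> \<sigma> \<rho> \<epsilon> a \<longrightarrow>
      (\<forall>T\<ge>1. expected_average_regret P J i a y T \<le> C * h T)"
    by (rule uniform_bound_mono[OF _ f])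
qed

text \<open>What remains for each approached rate: the bound in terms of the rate terms, an upper bound for the guaranteed exponents, and
admissible exponents that come arbitrarily close to it.\<close>

lemma optimal_rate_approachedI:
  assumes bound: "\<And>x. x \<in> X \<Longrightarrow> Bd x (regret_terms bd x)"
    and mono: "\<And>x f h c. Bd x f \<Longrightarrow> (\<And>T. 1 \<le> T \<Longrightarrow> 0 \<le> f T) \<Longrightarrow> (\<And>T. 1 \<le> T \<Longrightarrow> f T \<le> c * h T) \<Longrightarrow> Bd x h"
    and upper: "\<And>x. x \<in> X \<Longrightarrow> guaranteed_exponent bd x \<le> b"
    and lower: "\<And>\<eta>. 0 < \<eta> \<Longrightarrow> \<exists>x\<in>X. b - \<eta> \<le> guaranteed_exponent bd x"
  shows "optimal_rate_approached X bd Bd b"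
proof -
  have ne: "X \<noteq> {}" using lower[of 1] by auto
  have bdd: "bdd_above (guaranteed_exponent bd ` X)" using upper by (rule bdd_aboveI2)
  have "(SUP x\<in>X. guaranteed_exponent bd x) = b"
  proof (rule antisym)
    show "(SUP x\<in>X. guaranteed_exponent bd x) \<le> b" using ne upper by (rule cSUP_least)
    show "b \<le> (SUP x\<in>X. guaranteed_exponent bd x)"
    proof (rule field_le_epsilon)
      fix \<eta> :: real assume "0 < \<eta>"
      then obtain x where x: "x \<in> X" "b - \<eta> \<le> guaranteed_exponent bd x" using lower by blast
      have "guaranteed_exponent bd x \<le> (SUP x\<in>X. guaranteed_exponent bd x)" by (rule cSUP_upper[OF x(1) bdd])
      with x(2) show "b \<le> (SUP x\<in>X. guaranteed_exponent bd x) + \<eta>" by linarith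
    qed
  qed
  moreover have "\<exists>x\<in>X. guaranteed_exponent bd x \<ge> b - \<eta> \<and> Bd x (\<lambda>T. real T powr (- (b - \<eta>)))" if \<eta>: "0 < \<eta>" for \<eta>
  proof -
    obtain x where x: "x \<in> X" "b - \<eta> \<le> guaranteed_exponent bd x" using lower[OF \<eta>] by blast
    have "Bd x (\<lambda>T. real T powr (- (b - \<eta>)))"
      by (rule mono[OF bound[OF x(1)] regret_terms_nonneg regret_terms_le_power[OF x(2)]])
    with x show ?thesis by blast
  qed
  ultimately show ?thesis unfolding optimal_rate_approached_def using bound ne bdd by blast
qed

section \<open>Exponents that guarantee convergence\<close>

lemma power_sequence_ratio:
  assumes "power_sequence p f" "power_sequence q h"
  obtains c where "0 < c" "\<And>t. 1 \<le> t \<Longrightarrow> f t / h t = c * real t powr (q - p)"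
proof -
  obtain c where c: "c > 0" "\<And>t. 1 \<le> t \<Longrightarrow> f t = c * real t powr (- p)" using assms(1) by (rule power_sequenceE) blast
  obtain d where d: "d > 0" "\<And>t. 1 \<le> t \<Longrightarrow> h t = d * real t powr (- q)" using assms(2) by (rule power_sequenceE) blast
  show ?thesis
  proof (rule that[of "c / d"])
    show "0 < c / d" using c d by simp
    fix t :: nat assume t: "1 \<le> t"
    show "f t / h t = c / d * real t powr (q - p)"
      unfolding c(2)[OF t] d(2)[OF t] using t d(1) by (simp add: powr_diff powr_minus field_simps)
  qed
qed

lemma power_sequence_mult:
  assumes "power_sequence p f" "power_sequence q h"
  obtains c where "0 < c" "\<And>t. 1 \<le> t \<Longrightarrow> f t * h t = c * real t powr (- (p + q))"
proof -
  obtain c where c: "c > 0" "\<And>t. 1 \<le> t \<Longrightarrow> f t = c * real t powr (- p)" using assms(1) by (rule power_sequenceE) blast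
  obtain d where d: "d > 0" "\<And>t. 1 \<le> t \<Longrightarrow> h t = d * real t powr (- q)" using assms(2) by (rule power_sequenceE) blast
  show ?thesis
  proof (rule that[of "c * d"])
    show "0 < c * d" using c d by simp
    fix t :: nat assume t: "1 \<le> t"
    show "f t * h t = c * d * real t powr (- (p + q))"
      unfolding c(2)[OF t] d(2)[OF t] minus_add_distrib[of p q] powr_add by (simp add: mult_ac)
  qed
qed

lemma summable_power_iff:
  assumes c: "0 < c" and f: "\<And>t. 1 \<le> t \<Longrightarrow> f t = c * real t powr q"
  shows "summable f \<longleftrightarrow> q < -1"
proof -
  have "summable f \<longleftrightarrow> summable (\<lambda>t. c * real t powr q)"
    by (rule summable_cong) (use f in \<open>auto simp: eventually_sequentially intro!: exI[of _ 1]\<close>)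
  also have "\<dots> \<longleftrightarrow> summable (\<lambda>t. real t powr q)" using c by (simp add: summable_cmult_iff)
  also have "\<dots> \<longleftrightarrow> q < -1" by (rule summable_real_powr_iff)
  finally show ?thesis .
qed

lemma summable_Suc_power:
  assumes "q < -1" shows "summable (\<lambda>t. C * real (Suc t) powr q)"
proof -
  have "summable (\<lambda>t. real t powr q)" using assms by (simp add: summable_real_powr_iff)
  then have "summable (\<lambda>t. real (Suc t) powr q)" by (subst summable_Suc_iff)
  then show ?thesis by (rule summable_mult)
qed

text \<open>The mean value theorem, with both bounds: the upper one serves to verify the summability conditions, the lower one to derive
what they imply for the exponents.\<close>

lemma power_increment:
  assumes q: "0 < q" and t: "1 \<le> t"
  shows "q * real (Suc t) powr (- (q + 1)) \<le> real t powr (- q) - real (Suc t) powr (- q)"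
    and "real t powr (- q) - real (Suc t) powr (- q) \<le> q * real t powr (- (q + 1))"
proof -
  have "\<exists>z. real t < z \<and> z < real (Suc t) \<and>
      real (Suc t) powr (- q) - real t powr (- q) = (real (Suc t) - real t) * (- q * z powr (- q - 1))"
    using t by (intro MVT2) (auto intro!: derivative_eq_intros)
  then obtain z where z0: "real t < z" "z < real (Suc t)"
    and eq: "real (Suc t) powr (- q) - real t powr (- q) = (real (Suc t) - real t) * (- q * z powr (- q - 1))"
    by blast
  have "real (Suc t) - real t = 1" "- q - 1 = - (q + 1)" by simp_all
  with eq have "real t powr (- q) - real (Suc t) powr (- q) = q * z powr (- (q + 1))"
    by (simp only: mult_1 mult_minus_left)
  note z = z0 this
  have "real (Suc t) powr (- (q + 1)) \<le> z powr (- (q + 1))" using z t q by (intro powr_mono2') auto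
  then show "q * real (Suc t) powr (- (q + 1)) \<le> real t powr (- q) - real (Suc t) powr (- q)"
    unfolding z(3) using q by (intro mult_left_mono) auto
  have "z powr (- (q + 1)) \<le> real t powr (- (q + 1))" using z t q by (intro powr_mono2') auto
  then show "real t powr (- q) - real (Suc t) powr (- q) \<le> q * real t powr (- (q + 1))"
    unfolding z(3) using q by (intro mult_left_mono) auto
qed

lemma power_sequence_increment:
  assumes f: "power_sequence q f" and q: "0 < q"
  obtains k K where "0 < k" "0 < K" "\<And>t. 1 \<le> t \<Longrightarrow> k * real (Suc t) powr (- (q + 1)) \<le> \<bar>f (Suc t) - f t\<bar>"
    "\<And>t. 1 \<le> t \<Longrightarrow> \<bar>f (Suc t) - f t\<bar> \<le> K * real (Suc t) powr (- (q + 1))"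
proof -
  obtain c where c: "c > 0" "\<And>t. 1 \<le> t \<Longrightarrow> f t = c * real t powr (- q)" using f by (rule power_sequenceE) blast
  have eq: "\<bar>f (Suc t) - f t\<bar> = c * (real t powr (- q) - real (Suc t) powr (- q))" if t: "1 \<le> t" for t
  proof -
    have "f t - f (Suc t) = c * (real t powr (- q) - real (Suc t) powr (- q))"
      using t by (simp add: c(2) right_diff_distrib)
    moreover have "0 \<le> c * (real t powr (- q) - real (Suc t) powr (- q))"
      using powr_neg_antimono[of t "Suc t" q] t q c(1) by simp
    ultimately show ?thesis by linarith
  qed
  show ?thesis
  proof (rule that[of "c * q" "c * (q * 2 powr (q + 1))"])
    fix t :: nat assume t: "1 \<le> t"
    show "c * q * real (Suc t) powr (- (q + 1)) \<le> \<bar>f (Suc t) - f t\<bar>"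
      unfolding eq[OF t] using mult_left_mono[OF power_increment(1)[OF q t], of c] c(1) by (simp add: mult.assoc)
    have "real t powr (- (q + 1)) \<le> (real (Suc t) / 2) powr (- (q + 1))"
      using t q by (intro powr_mono2') auto
    also have "\<dots> = 2 powr (q + 1) * real (Suc t) powr (- (q + 1))"
    proof -
      have "(real (Suc t) / 2) powr (- (q + 1)) = real (Suc t) powr (- (q + 1)) / 2 powr (- (q + 1))"
        by (rule powr_divide)
      also have "(2::real) powr (- (q + 1)) = 1 / 2 powr (q + 1)" by (rule powr_minus_divide)
      finally show ?thesis by simp
    qed
    finally have "q * real t powr (- (q + 1)) \<le> q * (2 powr (q + 1) * real (Suc t) powr (- (q + 1)))"
      using q by (intro mult_left_mono) auto
    then have "c * (real t powr (- q) - real (Suc t) powr (- q)) \<le> c * (q * (2 powr (q + 1) * real (Suc t) powr (- (q + 1))))"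
      using power_increment(2)[OF q t] c(1) by (intro mult_left_mono) linarith+
    then show "\<bar>f (Suc t) - f t\<bar> \<le> c * (q * 2 powr (q + 1)) * real (Suc t) powr (- (q + 1))"
      unfolding eq[OF t] by (simp only: mult.assoc)
  qed (use c(1) q in auto)
qed

text \<open>The increments of \<open>f\<close> are of exact order \<open>t\<close> to the power \<open>- (q + 1)\<close>, so the terms are of exact order \<open>t\<close> to the power
\<open>n e + g - 2 (q + 1)\<close>, and they are summable if and only if this exponent is below \<open>-1\<close>.\<close>

lemma summable_increments_iff:
  assumes f: "power_sequence q f" and q: "0 < q" and \<epsilon>: "power_sequence e \<epsilon>" and \<gamma>: "power_sequence g \<gamma>"
  shows "summable (\<lambda>t. \<bar>f (Suc t) - f t\<bar>\<^sup>2 / (\<epsilon> (Suc t) powr n * \<gamma> (Suc t))) \<longleftrightarrow> n * e + g < 2 * q + 1"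
proof -
  obtain k K where k: "0 < k" "0 < K" "\<And>t. 1 \<le> t \<Longrightarrow> k * real (Suc t) powr (- (q + 1)) \<le> \<bar>f (Suc t) - f t\<bar>"
    "\<And>t. 1 \<le> t \<Longrightarrow> \<bar>f (Suc t) - f t\<bar> \<le> K * real (Suc t) powr (- (q + 1))"
    using power_sequence_increment[OF f q] by blast
  obtain c where c: "c > 0" "\<And>t. 1 \<le> t \<Longrightarrow> \<epsilon> t = c * real t powr (- e)" "\<And>t. 0 < \<epsilon> t" using \<epsilon> by (rule power_sequenceE) blast
  obtain d where d: "d > 0" "\<And>t. 1 \<le> t \<Longrightarrow> \<gamma> t = d * real t powr (- g)" "\<And>t. 0 < \<gamma> t" using \<gamma> by (rule power_sequenceE) blast
  define D where "D = c powr n * d"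
  have D: "0 < D" using c d by (simp add: D_def)
  define m where "m = n * e + g - 2 * (q + 1)"
  have den: "\<epsilon> (Suc t) powr n * \<gamma> (Suc t) = D * real (Suc t) powr (- (n * e + g))" for t
  proof -
    have "\<epsilon> (Suc t) powr n = c powr n * real (Suc t) powr (- (n * e))"
      using c(1,2) by (simp add: powr_mult powr_powr mult_ac)
    moreover have "\<gamma> (Suc t) = d * real (Suc t) powr (- g)" by (rule d(2)) simp
    moreover have "real (Suc t) powr (- (n * e + g)) = real (Suc t) powr (- (n * e)) * real (Suc t) powr (- g)"
      by (simp add: powr_add[symmetric])
    ultimately show ?thesis by (simp add: D_def mult_ac)
  qed
  have quot: "(a * real (Suc t) powr (- (q + 1)))\<^sup>2 / (D * real (Suc t) powr (- (n * e + g))) = a\<^sup>2 / D * real (Suc t) powr m" for a t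
  proof -
    have "(a * real (Suc t) powr (- (q + 1)))\<^sup>2 = a\<^sup>2 * real (Suc t) powr (- 2 * (q + 1))"
    proof -
      have "- (q + 1) + - (q + 1) = - 2 * (q + 1)" by simp
      then have "(real (Suc t) powr (- (q + 1)))\<^sup>2 = real (Suc t) powr (- 2 * (q + 1))"
        by (simp only: power2_eq_square powr_add[symmetric])
      then show ?thesis by (simp only: power_mult_distrib)
    qed
    moreover have "real (Suc t) powr (- 2 * (q + 1)) / real (Suc t) powr (- (n * e + g)) = real (Suc t) powr m"
      by (simp only: powr_diff[symmetric]) (simp add: m_def algebra_simps)
    ultimately show ?thesis by (metis times_divide_times_eq)
  qed
  let ?a = "\<lambda>t. \<bar>f (Suc t) - f t\<bar>\<^sup>2 / (\<epsilon> (Suc t) powr n * \<gamma> (Suc t))"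
  have Dp: "0 \<le> D * real (Suc t) powr (- (n * e + g))" for t using D by simp
  have up: "?a t \<le> K\<^sup>2 / D * real (Suc t) powr m" if t: "1 \<le> t" for t
    unfolding den quot[symmetric] by (intro divide_right_mono power_mono k(4)[OF t] Dp) simp
  have low: "k\<^sup>2 / D * real (Suc t) powr m \<le> ?a t" if t: "1 \<le> t" for t
    unfolding den quot[symmetric] using k(1) by (intro divide_right_mono power_mono k(3)[OF t] Dp) simp
  show ?thesis
  proof
    assume "summable ?a"
    then have "summable (\<lambda>t. k\<^sup>2 / D * real (Suc t) powr m)"
    proof (rule summable_comparison_test_ev[rotated])
      show "\<forall>\<^sub>F t in sequentially. norm (k\<^sup>2 / D * real (Suc t) powr m) \<le> ?a t"
        using eventually_ge_at_top[of 1]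
      proof eventually_elim
        case (elim t)
        have "0 \<le> k\<^sup>2 / D * real (Suc t) powr m" using D by simp
        with low[OF elim] show ?case by (simp only: real_norm_def abs_of_nonneg)
      qed
    qed
    then have "summable (\<lambda>t. real (Suc t) powr m)" using k(1) D by (subst (asm) summable_cmult_iff) auto
    then have "summable (\<lambda>t. real t powr m)" by (subst (asm) summable_Suc_iff)
    then have "m < -1" by (simp add: summable_real_powr_iff)
    then show "n * e + g < 2 * q + 1" by (simp add: m_def)
  next
    assume "n * e + g < 2 * q + 1"
    then have "summable (\<lambda>t. K\<^sup>2 / D * real (Suc t) powr m)" by (intro summable_Suc_power) (simp add: m_def)
    then show "summable ?a"
    proof (rule summable_comparison_test_ev[rotated])
      show "\<forall>\<^sub>F t in sequentially. norm (?a t) \<le> K\<^sup>2 / D * real (Suc t) powr m"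
        using eventually_ge_at_top[of 1]
      proof eventually_elim
        case (elim t)
        have "0 \<le> ?a t" using d(3)[of "Suc t"] by (intro divide_nonneg_nonneg mult_nonneg_nonneg) auto
        with up[OF elim] show ?case by (simp only: real_norm_def abs_of_nonneg)
      qed
    qed
  qed
qed

lemma filterlim_power_at_top:
  fixes c p :: real
  assumes c: "0 < c" and p: "0 < p"
  shows "filterlim (\<lambda>t. c * real t powr p) at_top sequentially"
proof -
  have "(\<lambda>t. inverse c * real t powr (- p)) \<longlonglongrightarrow> inverse c * 0"
    by (intro tendsto_mult tendsto_const tendsto_neg_powr filterlim_real_sequentially) (use p in simp)
  moreover have "\<forall>\<^sub>F t in sequentially. 0 < inverse c * real t powr (- p)"
    using eventually_ge_at_top[of 1] by eventually_elim (use c in auto)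
  ultimately have "filterlim (\<lambda>t. inverse (inverse c * real t powr (- p))) at_top sequentially"
    by (intro filterlim_inverse_at_top) auto
  then show ?thesis by (simp add: powr_minus)
qed

text \<open>The terms are bounded below by the last one, up to a constant factor, and there are \<open>T\<close> of them.\<close>

lemma power_sum_diverges:
  assumes p: "power_sequence p f" "power_sequence q h" and pq: "0 \<le> p + q" "p + q < 1"
  shows "filterlim (\<lambda>T. \<Sum>t=1..T. f t * h t) at_top sequentially"
proof -
  obtain c where c: "0 < c" "\<And>t. 1 \<le> t \<Longrightarrow> f t * h t = c * real t powr (- (p + q))"
    using power_sequence_mult[OF p] by blast
  have "filterlim (\<lambda>T. c * real T powr (1 - (p + q))) at_top sequentially"
    using c(1) pq by (intro filterlim_power_at_top) auto
  then show ?thesis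
  proof (rule filterlim_at_top_mono)
    show "\<forall>\<^sub>F T in sequentially. c * real T powr (1 - (p + q)) \<le> (\<Sum>t=1..T. f t * h t)"
      using eventually_ge_at_top[of 1]
    proof eventually_elim
      case (elim T)
      have "c * real T powr (1 - (p + q)) = real T * (c * real T powr (- (p + q)))"
      proof -
        have "real T powr (1 - (p + q)) = real T powr 1 * real T powr (- (p + q))"
          unfolding powr_add[symmetric] by (simp add: algebra_simps)
        then show ?thesis by simp
      qed
      also have "\<dots> = (\<Sum>t=1..T. c * real T powr (- (p + q)))" by simp
      also have "\<dots> \<le> (\<Sum>t=1..T. f t * h t)"
        using c(1) pq(1) by (intro sum_mono) (auto simp: c(2) simp del: minus_add_distrib intro!: mult_left_mono powr_neg_antimono)
      finally show ?case .
    qed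
  qed
qed

lemma convergence_conditionsI:
  assumes par: "parameters (g, s, r, e) \<gamma> \<sigma> \<rho> \<epsilon>"
    and x: "0 < g" "0 < s" "0 < e" "e < r" "r < s" "g + e < 1" "1 < 2 * g - 2 * s" "1 < g + s"
    and full: "\<not> relaxed \<Longrightarrow> 0 < \<epsilon>' \<and> (5 + 2 * \<epsilon>') * e + g < 2 * r + 1"
  shows "convergence_conditions relaxed \<gamma> \<sigma> \<rho> \<epsilon>"
proof -
  have ps: "power_sequence g \<gamma>" "power_sequence s \<sigma>" "power_sequence r \<rho>" "power_sequence e \<epsilon>"
    using par by (auto simp: parameters_def)
  have r: "0 < r" using x by simp
  have lim: "\<gamma> \<longlonglongrightarrow> 0" "\<epsilon> \<longlonglongrightarrow> 0" "\<sigma> \<longlonglongrightarrow> 0" "\<rho> \<longlonglongrightarrow> 0"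
    using ps x r by (auto intro: power_sequence_tendsto_0)
  have "(\<lambda>t. \<rho> t / \<epsilon> t) \<longlonglongrightarrow> 0"
  proof -
    obtain c where "0 < c" "\<And>t. 1 \<le> t \<Longrightarrow> \<rho> t / \<epsilon> t = c * real t powr (e - r)"
      using power_sequence_ratio[OF ps(3,4)] by blast
    then have "power_sequence (r - e) (\<lambda>t. \<rho> t / \<epsilon> t)"
      using parameters_pos[OF par] by (auto simp: power_sequence_def)
    then show ?thesis by (rule power_sequence_tendsto_0) (use x in simp)
  qed
  moreover have "filterlim (\<lambda>t. \<rho> t / \<sigma> t) at_top sequentially"
  proof -
    obtain c where c: "0 < c" "\<And>t. 1 \<le> t \<Longrightarrow> \<rho> t / \<sigma> t = c * real t powr (s - r)"
      using power_sequence_ratio[OF ps(3,2)] by blast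
    have "filterlim (\<lambda>t. c * real t powr (s - r)) at_top sequentially"
      using c(1) x by (intro filterlim_power_at_top) auto
    then show ?thesis
      by (rule filterlim_at_top_mono) (use eventually_ge_at_top[of 1] in \<open>eventually_elim, simp add: c(2)\<close>)
  qed
  moreover have "filterlim (\<lambda>T. \<Sum>t=1..T. \<gamma> t * \<epsilon> t) at_top sequentially"
    using x by (intro power_sum_diverges[OF ps(1,4)]) auto
  moreover have "summable (\<lambda>t. (\<gamma> t)\<^sup>2 / (\<sigma> t)\<^sup>2)"
  proof -
    obtain c where c: "0 < c" "\<And>t. 1 \<le> t \<Longrightarrow> \<gamma> t / \<sigma> t = c * real t powr (s - g)"
      using power_sequence_ratio[OF ps(1,2)] by blast
    have "(\<gamma> t)\<^sup>2 / (\<sigma> t)\<^sup>2 = c\<^sup>2 * real t powr (2 * s - 2 * g)" if "1 \<le> t" for t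
    proof -
      have "(real t powr (s - g))\<^sup>2 = real t powr (2 * s - 2 * g)"
        by (simp add: power2_eq_square powr_add[symmetric])
      then show ?thesis by (simp only: power_divide[symmetric] c(2)[OF that] power_mult_distrib)
    qed
    with c(1) x show ?thesis by (subst summable_power_iff[of "c\<^sup>2" _ "2 * s - 2 * g"]) auto
  qed
  moreover have "summable (\<lambda>t. \<gamma> t * \<sigma> t)"
  proof -
    obtain c where c: "0 < c" "\<And>t. 1 \<le> t \<Longrightarrow> \<gamma> t * \<sigma> t = c * real t powr (- (g + s))"
      using power_sequence_mult[OF ps(1,2)] by blast
    then show ?thesis using x by (subst summable_power_iff[OF c]) auto
  qed
  moreover have inc: "summable (\<lambda>t. \<bar>\<epsilon> (Suc t) - \<epsilon> t\<bar>\<^sup>2 / (\<epsilon> (Suc t) ^ 3 * \<gamma> (Suc t)))"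
  proof -
    have "\<epsilon> (Suc t) powr 3 = \<epsilon> (Suc t) ^ 3" for t using parameters_pos(4)[OF par, of "Suc t"] by simp
    then show ?thesis
      using summable_increments_iff[OF ps(4) x(3) ps(4) ps(1), of 3] x by simp
  qed
  moreover have "\<exists>\<epsilon>'>0. summable (\<lambda>t. \<bar>\<epsilon> (Suc t) - \<epsilon> t\<bar>\<^sup>2 / (\<epsilon> (Suc t) ^ 3 * \<gamma> (Suc t)) +
           \<bar>\<rho> (Suc t) - \<rho> t\<bar>\<^sup>2 / (\<epsilon> (Suc t) powr (5 + 2 * \<epsilon>') * \<gamma> (Suc t)))" if "\<not> relaxed"
    using full[OF that] summable_add[OF inc] summable_increments_iff[OF ps(3) r ps(4) ps(1), of "5 + 2 * \<epsilon>'"]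
    by (intro exI[of _ \<epsilon>']) simp
  ultimately show ?thesis unfolding convergence_conditions_def using lim by simp
qed

lemma power_sequence_standard: "power_sequence q (\<lambda>t. if t = 0 then 1 else real t powr (- q))"
  by (auto simp: power_sequence_def intro!: exI[of _ "1::real"])

text \<open>The conditions hold for all parameters with these exponents, in particular for the pure powers of \<open>t\<close>, for which
each of them is an inequality between exponents.\<close>

lemma convergent_exponents_necessary:
  assumes x: "(g, s, r, e) \<in> convergent_exponents relaxed"
  shows "e < r" "r < s" "1 < 2 * g - 2 * s" "\<not> relaxed \<Longrightarrow> 5 * e + g < 2 * r + 1"
    and "(g, s, r, e) \<in> unilateral_exponents"
proof -
  define f where "f q = (\<lambda>t. if t = 0 then 1 else real t powr (- q))" for q
  have ps: "power_sequence q (f q)" for q unfolding f_def by (rule power_sequence_standard)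
  have unit: "(g, s, r, e) \<in> unit_exponents" using x by (simp add: convergent_exponents_def)
  then have pos: "0 < g" "g < 1" "0 < s" "0 < r" "0 < e" by (auto simp: unit_exponents_def)
  have par: "parameters (g, s, r, e) (f g) (f s) (f r) (f e)" by (simp add: parameters_def ps)
  then have cc: "convergence_conditions relaxed (f g) (f s) (f r) (f e)" using x by (simp add: convergent_exponents_def)
  have ratio: "f p t / f q t = real t powr (q - p)" if "1 \<le> t" for p q t
    using that by (simp add: f_def powr_diff powr_minus field_simps)
  show "e < r"
  proof (rule ccontr)
    assume "\<not> e < r"
    then have "1 \<le> f r t / f e t" if "1 \<le> t" for t
      unfolding ratio[OF that] using that by (intro ge_one_powr_ge_zero) auto
    moreover have "(\<lambda>t. f r t / f e t) \<longlonglongrightarrow> 0" using cc by (simp add: convergence_conditions_def)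
    ultimately have "(1::real) \<le> 0"
      by (intro tendsto_lowerbound[of _ 0 sequentially 1]) (auto simp: eventually_sequentially intro!: exI[of _ 1])
    then show False by simp
  qed
  show rs: "r < s"
  proof (rule ccontr)
    assume "\<not> r < s"
    then have le: "f r t / f s t \<le> 1" if "1 \<le> t" for t
      unfolding ratio[OF that] using powr_neg_le_one[OF that, of "r - s"] by simp
    have "filterlim (\<lambda>t. f r t / f s t) at_top sequentially" using cc by (simp add: convergence_conditions_def)
    then have "\<forall>\<^sub>F t in sequentially. 1 < f r t / f s t" by (rule filterlim_at_top_dense[THEN iffD1, rule_format])
    then obtain N where "\<And>t. N \<le> t \<Longrightarrow> 1 < f r t / f s t" by (auto simp: eventually_sequentially)
    from this[of "max N 1"] le[of "max N 1"] show False by simp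
  qed
  show gs: "1 < 2 * g - 2 * s"
  proof -
    have sm: "summable (\<lambda>t. (f g t)\<^sup>2 / (f s t)\<^sup>2)" using cc by (simp add: convergence_conditions_def)
    have "(f g t)\<^sup>2 / (f s t)\<^sup>2 = 1 * real t powr (2 * s - 2 * g)" if "1 \<le> t" for t
    proof -
      have "(real t powr (s - g))\<^sup>2 = real t powr (2 * s - 2 * g)"
        by (simp add: power2_eq_square powr_add[symmetric])
      then show ?thesis by (simp only: power_divide[symmetric] ratio[OF that] mult_1)
    qed
    then have "2 * s - 2 * g < -1" by (rule iffD1[OF summable_power_iff[OF zero_less_one] sm])
    then show ?thesis by simp
  qed
  show "(g, s, r, e) \<in> unilateral_exponents"
    using unit rs gs pos by (simp add: unilateral_exponents_def)
  show "5 * e + g < 2 * r + 1" if "\<not> relaxed"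
  proof -
    have rel: "relaxed = False" using that by simp
    let ?E = "\<lambda>t. \<bar>f e (Suc t) - f e t\<bar>\<^sup>2 / (f e (Suc t) ^ 3 * f g (Suc t))"
    let ?I = "\<lambda>\<epsilon>' t. \<bar>f r (Suc t) - f r t\<bar>\<^sup>2 / (f e (Suc t) powr (5 + 2 * \<epsilon>') * f g (Suc t))"
    have "\<exists>\<epsilon>'>0. summable (\<lambda>t. ?E t +
           ?I \<epsilon>' t)"
      using cc unfolding convergence_conditions_def rel if_False by (elim conjE)
    then obtain \<epsilon>' where \<epsilon>': "0 < \<epsilon>'" "summable (\<lambda>t. ?E t +
           ?I \<epsilon>' t)"
      by (elim exE conjE)
    have fp: "0 \<le> f q t" for q t by (simp add: f_def)
    have "summable (?I \<epsilon>')"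
    proof (rule summable_comparison_test[OF _ \<epsilon>'(2)], intro exI allI impI)
      fix t
      have "0 \<le> ?E t"
        "0 \<le> ?I \<epsilon>' t"
        by (intro divide_nonneg_nonneg mult_nonneg_nonneg zero_le_power fp powr_ge_zero; simp)+
      then show "norm (?I \<epsilon>' t) \<le>
        ?E t +
           ?I \<epsilon>' t"
        unfolding real_norm_def by linarith
    qed
    then have "(5 + 2 * \<epsilon>') * e + g < 2 * r + 1" by (rule iffD1[OF summable_increments_iff[OF ps pos(4) ps ps]])
    moreover have "0 < 2 * \<epsilon>' * e" using \<epsilon>'(1) pos by simp
    ultimately show ?thesis by (simp add: algebra_simps)
  qed
qed

lemma convergent_exponentsI:
  assumes "0 < g" "0 < s" "0 < e" "e < r" "r < s" "g + e < 1" "1 < 2 * g - 2 * s" "1 < g + s" "s < 1" 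
    and "\<not> relaxed \<Longrightarrow> 0 < \<epsilon>' \<and> (5 + 2 * \<epsilon>') * e + g < 2 * r + 1"
  shows "(g, s, r, e) \<in> convergent_exponents relaxed"
proof -
  have "(g, s, r, e) \<in> unit_exponents" using assms(1-9) by (simp add: unit_exponents_def)
  moreover have "convergence_conditions relaxed \<gamma> \<sigma> \<rho> \<epsilon>" if "parameters (g, s, r, e) \<gamma> \<sigma> \<rho> \<epsilon>" for \<gamma> \<sigma> \<rho> \<epsilon>
    using that assms(1-8,10) by (rule convergence_conditionsI)
  ultimately show ?thesis unfolding convergent_exponents_def by blast
qed

section \<open>Optimal exponents\<close>

text \<open>The three quantities \<open>1 - g\<close>, \<open>g - 2 s\<close> and \<open>2 s\<close> add up to \<open>1\<close>; the optimum makes them equal.\<close>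

lemma unilateral_interior_exponent:
  shows "guaranteed_exponent False x \<le> 1/3"
    and "(2/3, 1/6, 1/12, 1/2) \<in> unilateral_exponents"
    and "guaranteed_exponent False (2/3, 1/6, 1/12, 1/2) = 1/3"
proof -
  obtain g s r e where x: "x = (g, s, r, e)" by (cases x)
  show "guaranteed_exponent False x \<le> 1/3"
    using guaranteed_exponent_le(1-3)[of False g s r e] unfolding x by linarith
  show "(2/3, 1/6, 1/12, 1/2) \<in> unilateral_exponents" by (simp add: unilateral_exponents_def unit_exponents_def)
  show "guaranteed_exponent False (2/3, 1/6, 1/12, 1/2) = 1/3" by (simp add: guaranteed_exponent_def)
qed

text \<open>Now \<open>r < s\<close> bounds the guaranteed exponent \<open>b\<close> by \<open>s\<close>, so that \<open>1 = (1 - g) + (g - 2 s) + 2 s\<close> is at least \<open>4 b\<close>. Equality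
would need \<open>r \<ge> s\<close>, hence the value is only approached.\<close>

lemma unilateral_boundary_exponent:
  shows "x \<in> unilateral_exponents \<Longrightarrow> guaranteed_exponent True x \<le> 1/4"
    and "0 < \<eta> \<Longrightarrow> \<exists>x\<in>unilateral_exponents. 1/4 - \<eta> \<le> guaranteed_exponent True x"
proof -
  show "guaranteed_exponent True x \<le> 1/4" if "x \<in> unilateral_exponents"
  proof -
    obtain g s r e where x: "x = (g, s, r, e)" by (cases x)
    have "r < s" using that by (simp add: x unilateral_exponents_def)
    with guaranteed_exponent_le(1-4)[of True g s r e] guaranteed_exponent_le(5)[of True g s r e, OF TrueI] show ?thesis unfolding x by linarith
  qed
  assume \<eta>: "0 < \<eta>"
  define d where "d = min \<eta> (1/8)"
  have d: "0 < d" "d \<le> \<eta>" "d \<le> 1/8" using \<eta> by (auto simp: d_def)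
  show "\<exists>x\<in>unilateral_exponents. 1/4 - \<eta> \<le> guaranteed_exponent True x"
  proof (rule bexI[of _ "(3/4, 1/4, 1/4 - d, 1/2)"])
    show "(3/4, 1/4, 1/4 - d, 1/2) \<in> unilateral_exponents"
      using d by (simp add: unilateral_exponents_def unit_exponents_def)
    show "1/4 - \<eta> \<le> guaranteed_exponent True (3/4, 1/4, 1/4 - d, 1/2)"
      by (rule guaranteed_exponent_ge) (use d in simp_all)
  qed
qed

text \<open>As for a boundary point in the unilateral case, with \<open>e\<close> in the role of \<open>r\<close>, since convergence forces \<open>e < r < s\<close>. The exponents
below tend with \<open>d\<close> to the limit point \<open>g = 3/4\<close>, \<open>s = r = e = 1/4\<close>, where the required strict inequalities degenerate to equalities.\<close>

lemma collective_interior_exponent: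
  shows "x \<in> convergent_exponents True \<Longrightarrow> guaranteed_exponent False x \<le> 1/4"
    and "0 < \<eta> \<Longrightarrow> \<exists>x\<in>convergent_exponents True. 1/4 - \<eta> \<le> guaranteed_exponent False x"
proof -
  show "guaranteed_exponent False x \<le> 1/4" if "x \<in> convergent_exponents True"
  proof -
    obtain g s r e where x: "x = (g, s, r, e)" by (cases x)
    show ?thesis
      using convergent_exponents_necessary(1-2)[OF that[unfolded x]] guaranteed_exponent_le[of False g s r e]
      unfolding x by linarith
  qed
  assume \<eta>: "0 < \<eta>"
  define d where "d = min (\<eta> / 2) (1/16)"
  have d: "0 < d" "2 * d \<le> \<eta>" "d \<le> 1/16" using \<eta> by (auto simp: d_def)
  show "\<exists>x\<in>convergent_exponents True. 1/4 - \<eta> \<le> guaranteed_exponent False x"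
  proof (rule bexI[of _ "(3/4 + d, 1/4, 1/4 - d, 1/4 - 2 * d)"])
    show "(3/4 + d, 1/4, 1/4 - d, 1/4 - 2 * d) \<in> convergent_exponents True"
      by (rule convergent_exponentsI) (use d in simp_all)
    show "1/4 - \<eta> \<le> guaranteed_exponent False (3/4 + d, 1/4, 1/4 - d, 1/4 - 2 * d)"
      by (rule guaranteed_exponent_ge) (use d in simp_all)
  qed
qed

text \<open>With \<open>b\<close> the guaranteed exponent, \<open>b \<le> e\<close>, \<open>r < s\<close> and \<open>2 s + b \<le> g\<close> turn the summability condition
\<open>5 e + g < 2 r + 1\<close> into \<open>6 b < 1\<close>. The limit point of the exponents below is \<open>g = 5/6\<close>, \<open>s = r = 1/3\<close>, \<open>e = 1/6\<close>; the slack \<open>6 d\<close>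
that they leave in the summability condition admits \<open>\<epsilon>' = d\<close>.\<close>

lemma collective_boundary_exponent:
  shows "x \<in> convergent_exponents False \<Longrightarrow> guaranteed_exponent True x \<le> 1/6"
    and "0 < \<eta> \<Longrightarrow> \<exists>x\<in>convergent_exponents False. 1/6 - \<eta> \<le> guaranteed_exponent True x"
proof -
  show "guaranteed_exponent True x \<le> 1/6" if "x \<in> convergent_exponents False"
  proof -
    obtain g s r e where x: "x = (g, s, r, e)" by (cases x)
    have n: "e < r" "r < s" "5 * e + g < 2 * r + 1"
      using convergent_exponents_necessary(1-4)[OF that[unfolded x]] by simp_all
    with guaranteed_exponent_le(1-4)[of True g s r e] guaranteed_exponent_le(5)[of True g s r e, OF TrueI] show ?thesis unfolding x by linarith
  qed
  assume \<eta>: "0 < \<eta>"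
  define d where "d = min (\<eta> / 2) (1/24)"
  have d: "0 < d" "2 * d \<le> \<eta>" "d \<le> 1/24" using \<eta> by (auto simp: d_def)
  show "\<exists>x\<in>convergent_exponents False. 1/6 - \<eta> \<le> guaranteed_exponent True x"
  proof (rule bexI[of _ "(5/6, 1/3 - d, 1/3 - 2 * d, 1/6 - 2 * d)"])
    have "0 < d * 17 + d * (d * 12)" using d by (intro add_pos_pos mult_pos_pos) simp_all
    then have "(5 + 2 * d) * (1/6 - 2 * d) + 5/6 < 2 * (1/3 - 2 * d) + 1"
      using d by (simp add: algebra_simps)
    then show "(5/6, 1/3 - d, 1/3 - 2 * d, 1/6 - 2 * d) \<in> convergent_exponents False"
      by (intro convergent_exponentsI[where \<epsilon>' = d]) (use d in simp_all)
    show "1/6 - \<eta> \<le> guaranteed_exponent True (5/6, 1/3 - d, 1/3 - 2 * d, 1/6 - 2 * d)"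
      by (rule guaranteed_exponent_ge) (use d in simp_all)
  qed
qed

theorem corollary1:
  fixes A :: "('d::finite, 'n::finite) action_sets" and J :: "('d, 'n) costs"
  assumes "convex_game A J" and "merely_monotone_game A J" and "smooth_growth_game J"
  shows
    "(\<forall>i. \<forall>y\<in>interior (A i).
        optimal_rate_attained unilateral_exponents False
          (unilateral_bound TYPE('w) A J i y) (1/3)) \<and>
     (\<forall>i. \<forall>y\<in>frontier (A i).
        optimal_rate_approached unilateral_exponents True
          (unilateral_bound TYPE('w) A J i y) (1/4)) \<and>
     (interior_case A J \<longrightarrow>
       (\<forall>i. \<forall>y\<in>interior (A i).
          optimal_rate_approached (convergent_exponents True) False
            (collective_bound TYPE('w) A J i y) (1/4))) \<and>
     (\<forall>i. \<forall>y\<in>frontier (A i).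
        optimal_rate_approached (convergent_exponents False) True
          (collective_bound TYPE('w) A J i y) (1/6))"
proof -
  have fr: "y \<in> A i" if "y \<in> frontier (A i)" for y i
  proof -
    have "closed (A i)" using assms(1) by (simp add: convex_game_def compact_imp_closed)
    then show ?thesis using that frontier_subset_closed by blast
  qed
  have int: "y \<in> A i" if "y \<in> interior (A i)" for y i using that interior_subset by blast
  have conv: "x \<in> unilateral_exponents" if "x \<in> convergent_exponents relaxed" for x relaxed
    using that by (cases x) (simp only: convergent_exponents_necessary(5))
  note bounds = regret_bounds[OF assms(1,3)]
  have "optimal_rate_attained unilateral_exponents False (unilateral_bound TYPE('w) A J i y) (1/3)"
    if y: "y \<in> interior (A i)" for i y
    unfolding optimal_rate_attained_def
  proof (intro conjI ballI bexI[of _ "(2/3, 1/6, 1/12, 1/2)"])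
    show "unilateral_bound TYPE('w) A J i y x (regret_terms False x)" if "x \<in> unilateral_exponents" for x
      by (rule bounds(1)[OF that int[OF y] y])
    have "unilateral_bound TYPE('w) A J i y (2/3, 1/6, 1/12, 1/2) (regret_terms False (2/3, 1/6, 1/12, 1/2))"
      by (rule bounds(1)[OF unilateral_interior_exponent(2) int[OF y] y])
    then show "unilateral_bound TYPE('w) A J i y (2/3, 1/6, 1/12, 1/2) (\<lambda>T. real T powr (- (1/3)))"
      by (rule unilateral_bound_mono[OF _ regret_terms_nonneg regret_terms_le_power])
         (simp add: unilateral_interior_exponent(3))
  qed (use unilateral_interior_exponent in auto)
  moreover have "optimal_rate_approached unilateral_exponents True (unilateral_bound TYPE('w) A J i y) (1/4)"
    if y: "y \<in> frontier (A i)" for i y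
  proof (rule optimal_rate_approachedI)
    show "unilateral_bound TYPE('w) A J i y x (regret_terms True x)" if "x \<in> unilateral_exponents" for x
      by (rule bounds(1)[OF that fr[OF y]]) simp_all
    show "unilateral_bound TYPE('w) A J i y x h" if "unilateral_bound TYPE('w) A J i y x f"
      "\<And>T. 1 \<le> T \<Longrightarrow> 0 \<le> f T" "\<And>T. 1 \<le> T \<Longrightarrow> f T \<le> c * h T" for x f h c
      using that by (rule unilateral_bound_mono)
  qed (rule unilateral_boundary_exponent, assumption)+
  moreover have "optimal_rate_approached (convergent_exponents True) False (collective_bound TYPE('w) A J i y) (1/4)"
    if y: "y \<in> interior (A i)" for i y
  proof (rule optimal_rate_approachedI)
    show "collective_bound TYPE('w) A J i y x (regret_terms False x)" if "x \<in> (convergent_exponents True)" for x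
      by (rule bounds(2)[OF conv[OF that] int[OF y] y])
    show "collective_bound TYPE('w) A J i y x h" if "collective_bound TYPE('w) A J i y x f"
      "\<And>T. 1 \<le> T \<Longrightarrow> 0 \<le> f T" "\<And>T. 1 \<le> T \<Longrightarrow> f T \<le> c * h T" for x f h c
      using that by (rule collective_bound_mono)
  qed (rule collective_interior_exponent, assumption)+
  moreover have "optimal_rate_approached (convergent_exponents False) True (collective_bound TYPE('w) A J i y) (1/6)"
    if y: "y \<in> frontier (A i)" for i y
  proof (rule optimal_rate_approachedI)
    show "collective_bound TYPE('w) A J i y x (regret_terms True x)" if "x \<in> (convergent_exponents False)" for x
      by (rule bounds(2)[OF conv[OF that] fr[OF y]]) simp_all
    show "collective_bound TYPE('w) A J i y x h" if "collective_bound TYPE('w) A J i y x f"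
      "\<And>T. 1 \<le> T \<Longrightarrow> 0 \<le> f T" "\<And>T. 1 \<le> T \<Longrightarrow> f T \<le> c * h T" for x f h c
      using that by (rule collective_bound_mono)
  qed (rule collective_boundary_exponent, assumption)+
  ultimately show ?thesis by blast
qed

end
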